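(* Suppose $\max\{\omega\|u\|_1,\sqrt{\omega}\|u\|_2\}<2\pi/C$ and that for some multi-index $\alpha=(\alpha_1,\alpha_2)$, $u$ is smooth to order $|\alpha|$ and $|\partial^{\alpha'}u|\in L^1(\Omega)\cap L^2(\Omega)$ for all multi-indices $\alpha'$ with $|\alpha'|\le|\alpha|$. Let $\mu$ be the Jost function of $u$. Then $\mu$ is smooth to order $|\alpha|$ (in the variables $(x,y)$) and $$|\widehat{u\mu}(m,\xi;z)|=O\!\left(\frac{1}{1+|\omega m|^{\alpha_1}+|\xi|^{\alpha_2}}\right)\qquad\text{for }(m,\xi;z)\in\mathscr{C}\times\mathbb{C}_\omega.$$
   Context: Fix $\ell>0$ and put $\omega=\pi/\ell$. $\Omega=[-\ell,\ell]\times\mathbb{R}$; functions on $\Omega$ are complex-valued and regarded as $2\ell$-periodic in $x$; $\|\cdot\|_p$ is the norm of $L^p(\Omega)$. $\mathbb{Z}^*=\mathbb{Z}\setminus\{0\}$, $\mathscr{C}=\mathbb{Z}\times\mathbb{R}$, $\mathbb{C}_\omega=\{z\in\mathbb{C}: 2\,\mathrm{Re}\,z\notin\omega\mathbb{Z}^*\}$. For a multi-index $\alpha=(\alpha_1,\alpha_2)$, $\partial^\alpha=\partial_x^{\alpha_1}\partial_y^{\alpha_2}$ and $|\alpha|=\alpha_1+\alpha_2$; "smooth to order $k$" means possessing continuous partial derivatives in $(x,y)$ up to order $k$. The Fourier transform in $(x,y)$ (with $z$ as a parameter) is $$\widehat f(m,\xi)=\frac{1}{2\ell}\int_{-\infty}^{\infty}\int_{-\ell}^{\ell}f(x,y)e^{-i\omega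 mx-i\xi y}\,dx\,dy,\qquad (m,\xi)\in\mathscr{C}.$$ Put $P_z(m,\xi)=(\omega m)^2+2\omega mz+i\xi$ and $C=\frac{4\pi^2}{3\omega^2}+\frac{\pi}{\omega}\sqrt{\frac{\pi}{3}}$. Standing assumption (zero mass): $\int_{-\ell}^{\ell}u(x,y)\,dx=0$ for all $y\in\mathbb{R}$. The Jost function $\mu(x,y;z)$ of $u$ is the unique bounded solution, for $(x,y)\in\Omega$, $z\in\mathbb{C}_\omega$, of $$\mu(x,y;z)=1+\frac{1}{2\pi}\sum_{m\in\mathbb{Z}^*}\int_{-\infty}^{\infty}\frac{\widehat{u\mu}(m,\xi;z)}{P_z(m,\xi)}e^{i\omega mx+i\xi y}\,d\xi,$$ which is the integral form of the boundary-value problem $(-\partial_y+\partial_x^2+2iz\partial_x)\mu+u\mu=0$, $\mu\to1$ as $|y|\to\infty$. The $O$-bound means that there is a constant $M$ with the stated inequality for all $(m,\xi;z)$ in the indicated set. *)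

theory Defs
  imports "HOL-Analysis.Analysis"
begin

text \<open>A function on the strip \<open>[-l, l] \<times> \<real>\<close> that is regarded as \<open>2 l\<close>-periodic in \<open>x\<close> is
  represented by a function on the whole plane together with the hypothesis \<open>x_periodic l\<close>.
  Continuity and differentiability are therefore required across \<open>x = \<plusminus> l\<close> as well.\<close>

definition x_periodic :: "real \<Rightarrow> (real \<Rightarrow> real \<Rightarrow> complex) \<Rightarrow> bool" where
  "x_periodic l f \<longleftrightarrow> (\<forall>x y. f (x + 2 * l) y = f x y)"

definition strip :: "real \<Rightarrow> (real \<times> real) set" where
  "strip l = {-l..l} \<times> UNIV"

definition omega :: "real \<Rightarrow> real" where
  "omega l = pi / l"

definition C_omega :: "real \<Rightarrow> complex set" where
  "C_omega l = {z. \<forall>m::int. m \<noteq> 0 \<longrightarrow> 2 * Re z \<noteq> omega l * of_int m}"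

definition in_Lp :: "real \<Rightarrow> real \<Rightarrow> (real \<Rightarrow> real \<Rightarrow> complex) \<Rightarrow> bool" where
  "in_Lp l p f \<longleftrightarrow>
     set_borel_measurable lborel (strip l) (\<lambda>(x, y). f x y) \<and>
     set_integrable lborel (strip l) (\<lambda>(x, y). norm (f x y) powr p)"

definition Lp_norm :: "real \<Rightarrow> real \<Rightarrow> (real \<Rightarrow> real \<Rightarrow> complex) \<Rightarrow> real" where
  "Lp_norm l p f = (LINT w:strip l|lborel. norm (f (fst w) (snd w)) powr p) powr (1 / p)"

definition partial_x :: "(real \<Rightarrow> real \<Rightarrow> complex) \<Rightarrow> real \<Rightarrow> real \<Rightarrow> complex" where
  "partial_x f = (\<lambda>x y. vector_derivative (\<lambda>t. f t y) (at x))"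

definition partial_y :: "(real \<Rightarrow> real \<Rightarrow> complex) \<Rightarrow> real \<Rightarrow> real \<Rightarrow> complex" where
  "partial_y f = (\<lambda>x y. vector_derivative (\<lambda>t. f x t) (at y))"

definition partial_deriv ::
    "nat \<times> nat \<Rightarrow> (real \<Rightarrow> real \<Rightarrow> complex) \<Rightarrow> real \<Rightarrow> real \<Rightarrow> complex" where
  "partial_deriv a f = (partial_x ^^ fst a) ((partial_y ^^ snd a) f)"

text \<open>All iterated partial derivatives up to order \<open>k\<close>, taken in any order of the variables,
  exist everywhere and are jointly continuous. Existence is stated explicitly because
  \<open>vector_derivative\<close> is a total function.\<close>

primrec smooth_to_order :: "nat \<Rightarrow> (real \<Rightarrow> real \<Rightarrow> complex) \<Rightarrow> bool" where
  "smooth_to_order 0 f \<longleftrightarrow> continuous_on UNIV (\<lambda>(x, y). f x y)"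
| "smooth_to_order (Suc k) f \<longleftrightarrow>
     continuous_on UNIV (\<lambda>(x, y). f x y) \<and>
     (\<forall>x y. (\<lambda>t. f t y) differentiable at x \<and> (\<lambda>t. f x t) differentiable at y) \<and>
     smooth_to_order k (partial_x f) \<and> smooth_to_order k (partial_y f)"

definition fourier :: "real \<Rightarrow> (real \<Rightarrow> real \<Rightarrow> complex) \<Rightarrow> int \<Rightarrow> real \<Rightarrow> complex" where
  "fourier l f m \<xi> = 1 / (2 * of_real l) *
     (LINT y|lborel. (LINT x:{-l..l}|lborel.
        f x y * exp (- \<i> * of_real (omega l * of_int m * x) - \<i> * of_real (\<xi> * y))))"

definition P_symbol :: "real \<Rightarrow> complex \<Rightarrow> int \<Rightarrow> real \<Rightarrow> complex" where
  "P_symbol l z m \<xi> =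
     of_real ((omega l * of_int m)\<^sup>2) + 2 * of_real (omega l * of_int m) * z + \<i> * of_real \<xi>"

definition C_const :: "real \<Rightarrow> real" where
  "C_const l = 4 * pi\<^sup>2 / (3 * (omega l)\<^sup>2) + pi / omega l * sqrt (pi / 3)"

definition jost_integrand ::
    "real \<Rightarrow> (real \<Rightarrow> real \<Rightarrow> complex) \<Rightarrow> (real \<Rightarrow> real \<Rightarrow> complex \<Rightarrow> complex) \<Rightarrow>
     complex \<Rightarrow> real \<Rightarrow> real \<Rightarrow> int \<Rightarrow> real \<Rightarrow> complex" where
  "jost_integrand l u \<mu> z x y m \<xi> =
     fourier l (\<lambda>x' y'. u x' y' * \<mu> x' y' z) m \<xi> / P_symbol l z m \<xi> *
     exp (\<i> * of_real (omega l * of_int m * x) + \<i> * of_real (\<xi> * y))"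

text \<open>Bounded solutions of the integral equation. The integrability and summability clauses say
  that the right-hand side of the equation is meaningful, since the integral and the infinite sum
  have default values otherwise; for \<open>u\<close> in \<open>L\<^sup>1 \<inter> L\<^sup>2\<close> and \<open>\<mu>\<close> bounded and measurable they hold
  automatically. Boundedness is joint in \<open>(x, y; z)\<close>; values of \<open>\<mu>\<close> at \<open>z\<close> outside \<open>C_omega l\<close>
  are irrelevant. Uniqueness is not part of the predicate, so a result about all \<open>\<mu>\<close> satisfying
  it covers in particular the unique bounded solution.\<close>

definition jost_function ::
    "real \<Rightarrow> (real \<Rightarrow> real \<Rightarrow> complex) \<Rightarrow> (real \<Rightarrow> real \<Rightarrow> complex \<Rightarrow> complex) \<Rightarrow> bool" where
  "jost_function l u \<mu> \<longleftrightarrow>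
     bounded ((\<lambda>((x, y), z). \<mu> x y z) ` (strip l \<times> C_omega l)) \<and>
     (\<forall>z \<in> C_omega l.
        x_periodic l (\<lambda>x y. \<mu> x y z) \<and>
        (\<lambda>(x, y). \<mu> x y z) \<in> borel_measurable borel \<and>
        (\<forall>(x, y) \<in> strip l.
           (\<forall>m. m \<noteq> 0 \<longrightarrow> integrable lborel (jost_integrand l u \<mu> z x y m)) \<and>
           (\<lambda>m. LINT \<xi>|lborel. jost_integrand l u \<mu> z x y m \<xi>) summable_on (UNIV - {0}) \<and>
           \<mu> x y z = 1 + 1 / (2 * of_real pi) *
             (\<Sum>\<^sub>\<infinity>m \<in> UNIV - {0}. LINT \<xi>|lborel. jost_integrand l u \<mu> z x y m \<xi>)))"

end

theory Submission
  imports Defs "HOL-Probability.Characteristic_Functions" "HOL-Real_Asymp.Real_Asymp"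
begin

text \<open>Expanding in modes \<open>exp (\<i> \<omega> m x)\<close> and inverting the Fourier transform in \<open>y\<close>, the integral equation
  becomes \<open>\<mu> = 1 + T (u \<mu>)\<close>, where \<open>T\<close> solves \<open>p' + b p = w\<close> with \<open>b = (\<omega> m)\<^sup>2 + 2 \<omega> m z\<close> in each mode
  \<open>m \<noteq> 0\<close>. On a mode, \<open>T\<close> is bounded from \<open>L\<^sup>1\<close> with constant independent of \<open>b\<close> and from \<open>L\<^sup>2\<close> with
  constant \<open>(2 \<bar>Re b\<bar>) powr (- 1/2)\<close>; as \<open>1 / \<bar>Re b\<bar>\<close> is summable over all \<open>m\<close> but at most one resonant
  index, \<open>T\<close> is bounded uniformly in \<open>z\<close>, and its high non-resonant part is a contraction. A derivative
  of \<open>\<mu>\<close> solves an equation of the same form, so sup-norm bounds for solutions propagate to all derivatives.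
  For bounded \<open>z\<close> the finitely many remaining modes are differentiated through their differential equation.
  For large \<open>z\<close> the remaining finite-rank part \<open>Q\<close> has a small square: the diagonal terms vanish because
  \<open>u\<close> has zero mass, the others because the exponents \<open>b\<close> of two such modes are far apart. The decay of the
  Fourier transform follows from the uniform bounds on the derivatives of \<open>u \<mu>\<close>.\<close>

subsection \<open>Kernels of first-order equations on the line\<close>

text \<open>The obstacle is uniformity in z: \<open>C_omega l\<close> is unbounded, and
  \<open>Re (bsym z m)\<close> tends to 0 as z approaches an excluded line. Near such a line only
  the bound by the L1 norm survives, and it gives no smallness, so the resonant mode is kept apart
  together with the low ones. Differentiating a kept mode through its equation gains an order of
  smoothness but costs a factor \<open>bsym z m\<close>, which is harmless for bounded z only. For
  large z the kept part Q stays in the equation f = g + Q f + S f, where S is the contractive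
  remainder, and the equation is inserted once into its own term: Q f = Q g + Q Q f + Q S f. Here Q
  Q and Q S are small although Q is not.

  Existence of derivatives and bounds on them are separate matters. At a fixed z a Picard iteration
  shows that the derivative exists, with constants depending on z; only then does the equation that
  it solves bound it uniformly. This is why the sup-norm bounds are proved for an arbitrary source
  g: the sources of the differentiated equations are no longer constant.\<close>

text \<open>The decaying fundamental solution of p' + b p = delta: it lives on the forward half-line
  for Re b > 0 and on the backward one for Re b < 0, and so never exceeds 1 in modulus.\<close>

definition kern :: "complex \<Rightarrow> real \<Rightarrow> complex" where
  "kern b t = (if 0 < Re b then (if 0 \<le> t then exp (- (b * of_real t)) else 0)
     else (if t \<le> 0 then - exp (- (b * of_real t)) else 0))"

definition conv :: "complex \<Rightarrow> (real \<Rightarrow> complex) \<Rightarrow> real \<Rightarrow> complex" where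
  "conv b g y = (LINT t|lborel. kern b (y - t) * g t)"

lemma norm_kern_le_1: "norm (kern b t) \<le> 1"
  by (auto simp: kern_def mult_nonneg_nonneg mult_nonpos_nonpos)

lemma kern_measurable [measurable]: "kern b \<in> borel_measurable borel"
  unfolding kern_def by measurable

lemma kern_uminus: "Re b \<noteq> 0 \<Longrightarrow> kern b t = - kern (- b) (- t)"
  by (auto simp: kern_def)

text \<open>Modulation moves b along the imaginary direction, which leaves the sign of Re b and
  hence the support of the kernel unchanged.\<close>

lemma kern_times_exp: "kern b t * exp (- (\<i> * of_real (\<xi> * t))) = kern (b + \<i> * of_real \<xi>) t"
  by (auto simp: kern_def exp_add [symmetric] algebra_simps simp flip: exp_diff exp_minus exp_add)

lemma has_vector_derivative_exp_linear:
  "((\<lambda>t. exp (c * of_real t)) has_vector_derivative c * exp (c * of_real t)) (at t within S)" for c :: complex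
  by (rule has_vector_derivative_real_field) (auto intro!: derivative_eq_intros)

lemma kern_integrable_norm_power:
  assumes "Re b \<noteq> 0" "0 < p"
  shows "integrable lborel (\<lambda>t. norm (kern b t) ^ p)"
    and "(LINT t|lborel. norm (kern b t) ^ p) = 1 / (p * \<bar>Re b\<bar>)"
proof -
  have pos: "has_bochner_integral lborel (\<lambda>t. norm (kern b t) ^ p) (1 / (p * \<bar>Re b\<bar>))"
    if b: "0 < Re b" for b
  proof (rule has_bochner_integral_nn_integral)
    define c where "c = p * Re b"
    have c: "c > 0" using b assms(2) by (simp add: c_def)
    have eq: "ennreal (norm (kern b t) ^ p) = ennreal (exp (- (c * t))) * indicator {0..} t" for t
      using b assms(2) by (auto simp: kern_def c_def simp flip: exp_of_nat_mult)
    have "(\<integral>\<^sup>+t. ennreal (exp (- (c * t))) * indicator {0..} t \<partial>lborel) = ennreal (0 - (- exp (- (c * 0)) / c))"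
    proof (rule nn_integral_FTC_atLeast)
      show "((\<lambda>x. - exp (- (c * x)) / c) \<longlongrightarrow> 0) at_top"
        using c by real_asymp
    qed (use c in \<open>auto intro!: derivative_eq_intros\<close>)
    then show "(\<integral>\<^sup>+t. ennreal (norm (kern b t) ^ p) \<partial>lborel) = ennreal (1 / (p * \<bar>Re b\<bar>))"
      using b unfolding eq by (simp add: c_def)
  qed auto
  have "has_bochner_integral lborel (\<lambda>t. norm (kern b t) ^ p) (1 / (p * \<bar>Re b\<bar>))"
  proof (cases "0 < Re b")
    case False
    then have "0 < Re (-b)" using assms by auto
    from pos[OF this] have *: "has_bochner_integral lborel (\<lambda>t. norm (kern (-b) t) ^ p) (1 / (p * \<bar>Re b\<bar>))" by simp
    have "has_bochner_integral lborel (\<lambda>t. norm (kern (-b) (0 + (-1) * t)) ^ p) ((1 / (p * \<bar>Re b\<bar>)) /\<^sub>R \<bar>-1\<bar>)"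
      by (rule lborel_has_bochner_integral_real_affine_iff[THEN iffD1, rotated, OF *]) simp
    then show ?thesis using assms(1) by (simp add: kern_uminus[of b])
  qed (use pos in auto)
  then show "integrable lborel (\<lambda>t. norm (kern b t) ^ p)"
    and "(LINT t|lborel. norm (kern b t) ^ p) = 1 / (p * \<bar>Re b\<bar>)"
    by (auto simp: has_bochner_integral_iff)
qed

lemma kern_integrable: "Re b \<noteq> 0 \<Longrightarrow> integrable lborel (kern b)"
  using kern_integrable_norm_power(1)[of b 1] by (simp add: integrable_norm_iff)

text \<open>Read with \<open>b + \<i> * of_real \<xi>\<close> in place of b, this is the Fourier
  transform of \<open>kern b\<close>, by \<open>kern_times_exp\<close>.\<close>

lemma integral_kern:
  assumes "Re b \<noteq> 0"
  shows "(LINT t|lborel. kern b t) = 1 / b"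
proof -
  have pos: "(LINT t|lborel. kern b t) = 1 / b" if b: "0 < Re b" for b
  proof -
    have b0: "b \<noteq> 0" using b by auto
    have "((\<lambda>y. LINT x|lborel. indicator {..y} x *\<^sub>R kern b x) \<longlongrightarrow> (LINT t|lborel. kern b t)) at_top"
      by (rule tendsto_integral_at_top) (use b kern_integrable in auto)
    moreover have "((\<lambda>y. LINT x|lborel. indicator {..y} x *\<^sub>R kern b x) \<longlongrightarrow> 1 / b) at_top"
    proof (rule Lim_transform_eventually)
      show "((\<lambda>y. - exp (- (b * of_real y)) / b - (- 1 / b)) \<longlongrightarrow> 1 / b) at_top"
      proof -
        have "((\<lambda>y. exp (- (Re b * y))) \<longlongrightarrow> 0) at_top" using b by real_asymp
        then have "((\<lambda>y. exp (- (b * of_real y))) \<longlongrightarrow> 0) at_top"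
          by (subst tendsto_norm_zero_iff[symmetric]) simp
        then have "((\<lambda>y. - exp (- (b * of_real y)) / b - (- 1 / b)) \<longlongrightarrow> - 0 / b - (- 1 / b)) at_top"
          by (intro tendsto_intros) (use b0 in auto)
        then show ?thesis by simp
      qed
      show "\<forall>\<^sub>F y in at_top. - exp (- (b * of_real y)) / b - (- 1 / b) = (LINT x|lborel. indicator {..y} x *\<^sub>R kern b x)"
        using eventually_ge_at_top[of 0]
      proof eventually_elim
        fix y :: real assume y: "0 \<le> y"
        have "(LINT x|lborel. indicator {0..y} x *\<^sub>R exp (- (b * of_real x)))
            = - exp (- (b * of_real y)) / b - (- exp (- (b * of_real 0)) / b)"
          by (rule integral_FTC_Icc[OF y])
            (use b0 has_vector_derivative_mult_right[OF has_vector_derivative_exp_linear[of "-b"], of "-1/b"]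
              in \<open>auto intro!: continuous_intros\<close>)
        also have "(LINT x|lborel. indicator {0..y} x *\<^sub>R exp (- (b * of_real x))) = (LINT x|lborel. indicator {..y} x *\<^sub>R kern b x)"
          by (rule Bochner_Integration.integral_cong) (use b in \<open>auto simp: kern_def indicator_def\<close>)
        finally show "- exp (- (b * of_real y)) / b - (- 1 / b) = (LINT x|lborel. indicator {..y} x *\<^sub>R kern b x)" by simp
      qed
    qed
    ultimately show ?thesis by (rule tendsto_unique[OF trivial_limit_at_top_linorder])
  qed
  show ?thesis
  proof (cases "0 < Re b")
    case False
    then have "0 < Re (-b)" using assms by auto
    from pos[OF this] have *: "(LINT t|lborel. kern (-b) t) = - 1 / b" by simp
    have "(LINT t|lborel. kern (-b) t) = (LINT t|lborel. kern (-b) (-t))"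
      using lborel_integral_real_affine[of "-1" "kern (-b)" 0] by simp
    then have "(LINT t|lborel. kern b t) = - (LINT t|lborel. kern (-b) t)"
      using kern_uminus[OF assms] by simp
    then show ?thesis using * by simp
  qed (use pos in auto)
qed

lemma conv_integrable:
  assumes "integrable lborel g"
  shows "integrable lborel (\<lambda>t. kern b (y - t) * g t)"
proof (rule Bochner_Integration.integrable_bound)
  show "integrable lborel (\<lambda>t. norm (g t))" using assms by simp
  show "(\<lambda>t. kern b (y - t) * g t) \<in> borel_measurable lborel" using assms by measurable
  show "AE t in lborel. norm (kern b (y - t) * g t) \<le> norm (norm (g t))"
    using norm_kern_le_1 by (auto simp: norm_mult intro!: mult_left_le_one_le)
qed

lemma norm_conv_le:
  assumes "integrable lborel g"
  shows "norm (conv b g y) \<le> (LINT t|lborel. norm (g t))"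
proof -
  have "norm (conv b g y) \<le> (LINT t|lborel. norm (kern b (y - t) * g t))"
    unfolding conv_def by (rule integral_norm_bound)
  also have "\<dots> \<le> (LINT t|lborel. norm (g t))"
    by (intro integral_mono integrable_norm conv_integrable assms)
      (auto simp: norm_mult norm_kern_le_1 intro!: mult_left_le_one_le)
  finally show ?thesis .
qed

text \<open>Cauchy-Schwarz is replaced by 2 p q <= r p^2 + q^2 / r with r free. The bound is then
  linear in 1 / |Re b| and in the squared L2 norm of g, so it can be summed over modes before r is
  optimised.\<close>

lemma norm_conv_le_square:
  assumes "integrable lborel g" "integrable lborel (\<lambda>t. norm (g t) ^ 2)" "Re b \<noteq> 0" "0 < r"
  shows "norm (conv b g y) \<le> (r / (2 * \<bar>Re b\<bar>) + (LINT t|lborel. norm (g t) ^ 2) / r) / 2"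
proof -
  have i: "integrable lborel (\<lambda>t. norm (kern b (y - t)) ^ 2)"
    using lborel_integrable_real_affine[OF kern_integrable_norm_power(1)[OF assms(3), of 2], of "-1" y] by simp
  have v: "(LINT t|lborel. norm (kern b (y - t)) ^ 2) = 1 / (2 * \<bar>Re b\<bar>)"
    using lborel_integral_real_affine[of "-1" "\<lambda>t. norm (kern b t) ^ 2" y] kern_integrable_norm_power(2)[OF assms(3), of 2] by simp
  have le: "p * q \<le> (r * p ^ 2 + q ^ 2 / r) / 2" for p q :: real
  proof -
    have "0 \<le> (r * p - q) ^ 2 / r" using assms(4) by simp
    also have "\<dots> = r * p ^ 2 + q ^ 2 / r - 2 * (p * q)"
      using assms(4) by (simp add: power2_eq_square field_simps)
    finally show ?thesis by simp
  qed
  have "norm (conv b g y) \<le> (LINT t|lborel. norm (kern b (y - t) * g t))"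
    unfolding conv_def by (rule integral_norm_bound)
  also have "\<dots> \<le> (LINT t|lborel. (r * norm (kern b (y - t)) ^ 2 + norm (g t) ^ 2 / r) / 2)"
    using assms i le
    by (intro integral_mono integrable_norm conv_integrable) (auto simp: norm_mult)
  also have "\<dots> = (r * (LINT t|lborel. norm (kern b (y - t)) ^ 2) + (LINT t|lborel. norm (g t) ^ 2) / r) / 2"
    using i assms by simp
  finally show ?thesis by (simp add: v)
qed

lemma conv_add:
  assumes "integrable lborel g" "integrable lborel h"
  shows "conv b (\<lambda>t. g t + h t) y = conv b g y + conv b h y"
  unfolding conv_def using conv_integrable assms
  by (simp add: distrib_left)

lemma conv_cmult: "conv b (\<lambda>t. c * g t) y = c * conv b g y"
proof -
  have "conv b (\<lambda>t. c * g t) y = (LINT t|lborel. c * (kern b (y - t) * g t))"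
    unfolding conv_def by (rule Bochner_Integration.integral_cong) auto
  then show ?thesis by (simp add: conv_def)
qed

lemma conv_zero [simp]: "conv b (\<lambda>t. 0) y = 0"
  by (simp add: conv_def)

lemma conv_sum:
  assumes "finite F" "\<And>i. i \<in> F \<Longrightarrow> integrable lborel (g i)"
  shows "conv b (\<lambda>t. \<Sum>i\<in>F. g i t) y = (\<Sum>i\<in>F. conv b (g i) y)"
  using assms by (induction F rule: finite_induct) (auto simp: conv_add)

text \<open>Variation of constants starting at a. Only the integral over [a, y] and an explicit
  exponential still depend on y, so differentiation in y needs no care about the jump of the kernel.
  The formula is the same for both signs of Re b.\<close>

lemma conv_step:
  assumes g: "integrable lborel g" and ay: "a \<le> y" and b: "Re b \<noteq> 0"
  shows "conv b g y = exp (- (b * of_real (y - a))) *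
    (conv b g a + (LINT t|lborel. indicator {a..y} t *\<^sub>R (exp (b * of_real (t - a)) * g t)))"
proof -
  let ?e = "exp (- (b * of_real (y - a)))"
  have i3: "integrable lborel (\<lambda>t. indicator {a..y} t *\<^sub>R (exp (b * of_real (t - a)) * g t))"
  proof (rule Bochner_Integration.integrable_bound)
    show "integrable lborel (\<lambda>t. exp (\<bar>Re b\<bar> * (y - a)) * norm (g t))" using g by simp
    show "(\<lambda>t. indicator {a..y} t *\<^sub>R (exp (b * of_real (t - a)) * g t)) \<in> borel_measurable lborel"
      using g by measurable
    show "AE t in lborel. norm (indicator {a..y} t *\<^sub>R (exp (b * of_real (t - a)) * g t))
        \<le> norm (exp (\<bar>Re b\<bar> * (y - a)) * norm (g t))"
    proof (intro AE_I2)
      fix t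
      have "Re b * (t - a) \<le> \<bar>Re b\<bar> * (y - a)" if "t \<in> {a..y}"
        using that by (intro mult_mono) auto
      then show "norm (indicator {a..y} t *\<^sub>R (exp (b * of_real (t - a)) * g t))
        \<le> norm (exp (\<bar>Re b\<bar> * (y - a)) * norm (g t))"
        by (auto simp: indicator_def norm_mult intro!: mult_right_mono)
    qed
  qed
  have "conv b g y = (LINT t|lborel. ?e * (kern b (a - t) * g t) + ?e * (indicator {a..y} t *\<^sub>R (exp (b * of_real (t - a)) * g t)))"
    unfolding conv_def
  proof (rule integral_cong_AE)
    show "AE t in lborel. kern b (y - t) * g t = ?e * (kern b (a - t) * g t) + ?e * (indicator {a..y} t *\<^sub>R (exp (b * of_real (t - a)) * g t))"
      \<comment> \<open>The kernel identity can fail at the jumps t = y and t = a, a null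
        set.\<close>
      using AE_lborel_singleton[of y] AE_lborel_singleton[of a]
    proof eventually_elim
      fix t assume t: "t \<noteq> y" "t \<noteq> a"
      have 1: "?e * exp (- (b * of_real (a - t))) = exp (- (b * of_real (y - t)))"
        by (simp add: exp_add[symmetric] algebra_simps)
      have 2: "?e * exp (b * of_real (t - a)) = exp (- (b * of_real (y - t)))"
        by (simp add: exp_add[symmetric] algebra_simps)
      have "kern b (y - t) = ?e * kern b (a - t) + indicator {a..y} t *\<^sub>R (?e * exp (b * of_real (t - a)))"
        using t ay 1 unfolding 2 by (auto simp: kern_def indicator_def)
      then show "kern b (y - t) * g t = ?e * (kern b (a - t) * g t) + ?e * (indicator {a..y} t *\<^sub>R (exp (b * of_real (t - a)) * g t))"
        by (simp add: algebra_simps)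
    qed
  qed (use g in measurable)
  also have "\<dots> = ?e * conv b g a + ?e * (LINT t|lborel. indicator {a..y} t *\<^sub>R (exp (b * of_real (t - a)) * g t))"
    unfolding Bochner_Integration.integral_add[OF integrable_mult_right[OF conv_integrable[OF g]] integrable_mult_right[OF i3]]
      integral_mult_right_zero conv_def ..
  finally show ?thesis by (simp add: algebra_simps)
qed

lemma conv_has_vector_derivative:
  assumes g: "integrable lborel g" "continuous_on UNIV g" and b: "Re b \<noteq> 0"
  shows "(conv b g has_vector_derivative g y - b * conv b g y) (at y)"
proof -
  \<comment> \<open>\<open>conv_step\<close> speaks of points to the right of a only; starting one
    unit before y makes y an interior point, so a two-sided derivative results.\<close>
  define a where "a = y - 1"
  define J where "J = (\<lambda>y. integral {a..y} (\<lambda>t. exp (b * of_real (t - a)) * g t))"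
  have eq: "conv b g v = exp (- (b * of_real (v - a))) * (conv b g a + J v)" if "v \<in> {a..y+1}" for v
  proof -
    have "set_integrable lborel {a..v} (\<lambda>t. exp (b * of_real (t - a)) * g t)"
      by (intro borel_integrable_atLeastAtMost' continuous_intros continuous_on_subset[OF g(2)]) auto
    from set_borel_integral_eq_integral(2)[OF this] show ?thesis
      using conv_step[OF g(1) _ b, of a v] that by (simp add: J_def set_lebesgue_integral_def)
  qed
  have J: "(J has_vector_derivative exp (b * of_real (y - a)) * g y) (at y within {a..y+1})"
    unfolding J_def
    by (rule integral_has_vector_derivative)
      (auto intro!: continuous_intros continuous_on_subset[OF g(2)] simp: a_def)
  define E where "E = (\<lambda>v. exp (- (b * of_real (v - a))))"
  have E: "(E has_vector_derivative - b * E y) (at y within {a..y+1})"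
  proof -
    have "E = (\<lambda>v. exp (b * of_real a) * exp (- b * of_real v))"
      by (auto simp: E_def exp_add[symmetric] algebra_simps)
    moreover from this have "- b * E y = exp (b * of_real a) * (- b * exp (- b * of_real y))"
      by simp
    ultimately show ?thesis
      using has_vector_derivative_mult_right[OF has_vector_derivative_exp_linear] by metis
  qed
  have ey: "E y * (conv b g a + J y) = conv b g y"
    unfolding E_def by (rule eq[symmetric]) (simp add: a_def)
  have J': "((\<lambda>v. conv b g a + J v) has_vector_derivative exp (b * of_real (y - a)) * g y) (at y within {a..y+1})"
    using has_vector_derivative_add[OF has_vector_derivative_const J] by simp
  have "((\<lambda>v. E v * (conv b g a + J v)) has_vector_derivative
      (E y * (exp (b * of_real (y - a)) * g y) + - b * E y * (conv b g a + J y))) (at y within {a..y+1})"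
    by (rule has_vector_derivative_mult[OF E J'])
  then have "((\<lambda>v. exp (- (b * of_real (v - a))) * (conv b g a + J v)) has_vector_derivative
      (exp (- (b * of_real (y - a))) * (exp (b * of_real (y - a)) * g y) + - b * conv b g y)) (at y within {a..y+1})"
    unfolding mult.assoc[of "- b" "E y"] ey unfolding E_def .
  then have "(conv b g has_vector_derivative
      (exp (- (b * of_real (y - a))) * (exp (b * of_real (y - a)) * g y) + - b * conv b g y)) (at y within {a..y+1})"
    by (rule has_vector_derivative_transform_within[OF _ zero_less_one _ eq[symmetric]]) (simp_all add: a_def)
  moreover have "at y within {a..y+1} = at y" by (rule at_within_interior) (simp add: a_def)
  moreover have "exp (- (b * of_real (y - a))) * (exp (b * of_real (y - a)) * g y) + - b * conv b g y = g y - b * conv b g y"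
    unfolding mult.assoc[symmetric] exp_add[symmetric] by simp
  ultimately show ?thesis by (simp only:)
qed

text \<open>Dominated convergence: \<open>kern b\<close> jumps only at 0, so the integrand converges
  for every t other than y, and \<open>g\<close> need only be integrable.\<close>

lemma continuous_on_conv:
  assumes g: "integrable lborel g" and b: "Re b \<noteq> 0"
  shows "continuous_on UNIV (conv b g)"
proof -
  have "(\<lambda>n. conv b g (X n)) \<longlonglongrightarrow> conv b g y" if X: "X \<longlonglongrightarrow> y" for X y
    unfolding conv_def
  proof (rule integral_dominated_convergence)
    show "integrable lborel (\<lambda>t. norm (g t))" using g by simp
    show "AE t in lborel. (\<lambda>n. kern b (X n - t) * g t) \<longlonglongrightarrow> kern b (y - t) * g t"
      using AE_lborel_singleton[of y]
    proof eventually_elim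
      fix t assume t: "t \<noteq> y"
      have "isCont (kern b) (y - t)"
      proof (cases "y - t > 0")
        case True
        have "\<forall>\<^sub>F s in nhds (y - t). kern b s = (if 0 < Re b then exp (- (b * of_real s)) else 0)"
          using eventually_nhds_in_open[of "{0<..}" "y - t"] True
          by (auto elim!: eventually_mono simp: kern_def)
        from isCont_cong[OF this] show ?thesis by (cases "0 < Re b") auto
      next
        case False
        then have "y - t < 0" using t by simp
        then have "\<forall>\<^sub>F s in nhds (y - t). kern b s = (if 0 < Re b then 0 else - exp (- (b * of_real s)))"
          using eventually_nhds_in_open[of "{..<0}" "y - t"]
          by (auto elim!: eventually_mono simp: kern_def)
        from isCont_cong[OF this] show ?thesis by (cases "0 < Re b") auto
      qed
      then show "(\<lambda>n. kern b (X n - t) * g t) \<longlonglongrightarrow> kern b (y - t) * g t"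
        using X by (intro tendsto_mult isCont_tendsto_compose[of _ "kern b"] tendsto_diff) auto
    qed
    show "AE t in lborel. norm (kern b (X n - t) * g t) \<le> norm (g t)" for n
      using norm_kern_le_1 by (auto simp: norm_mult intro!: mult_left_le_one_le)
  qed (use g in measurable)
  then show ?thesis
    by (auto simp: continuous_on_sequentially comp_def)
qed

text \<open>Every solution is a multiple of exp (- b y), which blows up at one end of the line. This
  is the uniqueness principle behind \<open>conv_deriv_eq\<close>.\<close>

lemma bounded_solution_homogeneous_ode:
  fixes q :: "real \<Rightarrow> complex"
  assumes q: "\<And>y. (q has_vector_derivative - b * q y) (at y)" and b: "Re b \<noteq> 0" and bdd: "\<And>y. norm (q y) \<le> B"
  shows "q y = 0"
proof -
  define h where "h = (\<lambda>y. exp (b * of_real y) * q y)"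
  have "(h has_vector_derivative exp (b * of_real y) * (- b * q y) + b * exp (b * of_real y) * q y) (at y)" for y
    unfolding h_def
    by (rule has_vector_derivative_mult[OF _ q])
      (rule has_vector_derivative_exp_linear)
  then have "(h has_vector_derivative 0) (at y)" for y by (simp add: algebra_simps)
  then obtain c where c: "\<And>y. h y = c"
    using has_vector_derivative_zero_constant[of UNIV h] by auto
  have le: "norm c \<le> exp (Re b * y) * B" for y
    using c[of y] bdd[of y] by (auto simp: h_def norm_mult mult_left_mono simp flip: c[of y])
  \<comment> \<open>The points - sgn (Re b) t run to the end of the line at which exp (Re b y)
    decays, and \<open>le\<close> holds at each of them.\<close>
  have "((\<lambda>t. exp (Re b * (- sgn (Re b) * t)) * B) \<longlongrightarrow> 0) at_top"
  proof (cases "Re b > 0")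
    case True
    then have "((\<lambda>t. exp (- (Re b * t)) * B) \<longlongrightarrow> 0) at_top" by real_asymp
    then show ?thesis using True by simp
  next
    case False
    then have "Re b < 0" using b by simp
    then have "((\<lambda>t. exp (Re b * t) * B) \<longlongrightarrow> 0) at_top" by real_asymp
    then show ?thesis using \<open>Re b < 0\<close> by simp
  qed
  then have "norm c \<le> 0"
    by (rule tendsto_lowerbound) (intro always_eventually allI le, simp)
  then show ?thesis using c[of y] by (simp add: h_def)
qed

text \<open>Both sides are bounded solutions of p' + b p = g', so their difference solves the
  homogeneous equation and vanishes. This takes the place of integrating by parts across the jump of
  the kernel.\<close>

lemma conv_deriv_eq:
  assumes g: "integrable lborel g" "\<And>y. (g has_vector_derivative g' y) (at y)" "\<And>y. norm (g y) \<le> B"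
    and g': "integrable lborel g'" "continuous_on UNIV g'" and b: "Re b \<noteq> 0"
  shows "conv b g' y = g y - b * conv b g y"
proof -
  have cg: "continuous_on UNIV g"
    using g(2) by (meson UNIV_I continuous_at_imp_continuous_on has_vector_derivative_continuous)
  define q where "q = (\<lambda>y. conv b g' y - (g y - b * conv b g y))"
  have "(q has_vector_derivative (g' y - b * conv b g' y) - (g' y - b * (g y - b * conv b g y))) (at y)" for y
    unfolding q_def
    by (intro has_vector_derivative_diff conv_has_vector_derivative g g' cg b has_vector_derivative_mult_right)
  then have "(q has_vector_derivative - b * q y) (at y)" for y
    by (simp add: q_def algebra_simps)
  moreover have "norm (q y) \<le> (LINT t|lborel. norm (g' t)) + (B + norm b * (LINT t|lborel. norm (g t)))" for y
    unfolding q_def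
    by (intro order_trans[OF norm_triangle_ineq4] add_mono norm_conv_le g g')
      (auto simp: norm_mult intro!: mult_left_mono norm_conv_le g)
  ultimately have "q y = 0"
    by (rule bounded_solution_homogeneous_ode[OF _ b])
  then show ?thesis by (simp add: q_def)
qed

lemma conv_has_vector_derivative_conv:
  assumes "integrable lborel g" "\<And>y. (g has_vector_derivative g' y) (at y)" "\<And>y. norm (g y) \<le> B"
    and "integrable lborel g'" "continuous_on UNIV g'" and "Re b \<noteq> 0"
  shows "(conv b g has_vector_derivative conv b g' y) (at y)"
proof -
  have cg: "continuous_on UNIV g"
    using assms(2) by (meson UNIV_I continuous_at_imp_continuous_on has_vector_derivative_continuous)
  show ?thesis
    using conv_has_vector_derivative[OF assms(1) cg assms(6), of y] conv_deriv_eq[OF assms, of y] by simp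
qed

text \<open>The integral of a derivative vanishes: average the identity
  \<open>h (y + 1) - h y = \<integral>\<^sub>0\<^sup>1 h' (y + s) ds\<close> over \<open>y\<close>.\<close>

lemma integral_derivative_eq_0:
  fixes h :: "real \<Rightarrow> complex"
  assumes h: "integrable lborel h" "\<And>y. (h has_vector_derivative h' y) (at y)"
    and h': "integrable lborel h'" "continuous_on UNIV h'"
  shows "(LINT y|lborel. h' y) = 0"
proof -
  have [measurable]: "h' \<in> borel_measurable borel"
    using borel_measurable_integrable[OF h'(1)] by simp
  define w where "w = (\<lambda>y s. indicator {0..1::real} s *\<^sub>R h' (y + s))"
  have shift: "integrable lborel (\<lambda>y. h' (y + s))" "(LINT y|lborel. h' (y + s)) = (LINT y|lborel. h' y)"
    and shift_norm: "(LINT y|lborel. norm (h' (y + s))) = (LINT y|lborel. norm (h' y))" for s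
    using lborel_integrable_real_affine[OF h'(1), of 1 s] lborel_integral_real_affine[of 1 h' s]
      lborel_integral_real_affine[of 1 "\<lambda>y. norm (h' y)" s] by (simp_all add: add.commute)
  have int: "integrable (lborel \<Otimes>\<^sub>M lborel) (case_prod (\<lambda>s y. w y s))"
  proof (rule lborel_pair.Fubini_integrable)
    show "case_prod (\<lambda>s y. w y s) \<in> borel_measurable (lborel \<Otimes>\<^sub>M lborel)"
      unfolding w_def by measurable
    have "(LINT y|lborel. norm (case_prod (\<lambda>s y. w y s) (s, y))) = indicator {0..1} s * (LINT y|lborel. norm (h' y))" for s
      using shift_norm[of s] by (auto simp: w_def indicator_def)
    then show "integrable lborel (\<lambda>s. LINT y|lborel. norm (case_prod (\<lambda>s y. w y s) (s, y)))"
      by simp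
    show "AE s in lborel. integrable lborel (\<lambda>y. case_prod (\<lambda>s y. w y s) (s, y))"
      using shift by (auto simp: w_def)
  qed
  have "(LINT y|lborel. LINT s|lborel. w y s) = (LINT s|lborel. LINT y|lborel. w y s)"
    using lborel_pair.Fubini_integral[OF int] .
  also have "\<dots> = (LINT s|lborel. indicator {0..1::real} s *\<^sub>R (LINT y|lborel. h' y))"
    unfolding w_def integral_scaleR_right shift ..
  also have "\<dots> = (LINT y|lborel. h' y)"
    by simp
  also have "(LINT y|lborel. LINT s|lborel. w y s) = (LINT y|lborel. h (y + 1) - h y)"
  proof (rule Bochner_Integration.integral_cong)
    fix y
    have d: "((\<lambda>s. h (y + s)) has_vector_derivative h' (y + s)) (at s within {0..1})" for s
    proof -
      have "((\<lambda>s. y + s) has_vector_derivative 1) (at s)"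
        by (auto intro!: derivative_eq_intros)
      from vector_diff_chain_at[OF this h(2)] show ?thesis
        by (simp add: comp_def has_vector_derivative_at_within)
    qed
    have "(LINT s|lborel. indicator {0..1} s *\<^sub>R h' (y + s)) = h (y + 1) - h (y + 0)"
      by (rule integral_FTC_Icc[OF zero_le_one d]) (rule continuous_on_compose2[OF h'(2)], auto intro!: continuous_intros)
    then show "(LINT s|lborel. w y s) = h (y + 1) - h y" by (simp add: w_def)
  qed auto
  also have "\<dots> = 0"
    using lborel_integrable_real_affine[OF h(1), of 1 1] lborel_integral_real_affine[of 1 h 1] h(1)
    by (simp add: add.commute)
  finally show ?thesis by simp
qed

section \<open>The Fourier transform on the line: derivatives, convolution with the kernels,
  inversion\<close>

definition ft :: "(real \<Rightarrow> complex) \<Rightarrow> real \<Rightarrow> complex" where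
  "ft g \<xi> = (LINT t|lborel. g t * exp (- (\<i> * of_real (\<xi> * t))))"

lemma norm_exp_i_real [simp]: "norm (exp (\<i> * complex_of_real a)) = 1" "norm (exp (- (\<i> * complex_of_real a))) = 1"
  by (simp_all add: norm_exp_eq_Re)

lemma integrable_times_phase:
  assumes "integrable lborel (g :: real \<Rightarrow> complex)"
  shows "integrable lborel (\<lambda>t. g t * exp (- (\<i> * of_real (\<xi> * t))))"
proof (rule Bochner_Integration.integrable_bound)
  show "(\<lambda>t. g t * exp (- (\<i> * of_real (\<xi> * t)))) \<in> borel_measurable lborel"
    using assms by measurable
qed (use assms in \<open>auto simp: norm_mult simp del: of_real_mult\<close>)

lemma norm_ft_le: "integrable lborel g \<Longrightarrow> norm (ft g \<xi>) \<le> (LINT t|lborel. norm (g t))"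
  unfolding ft_def
  by (rule order_trans[OF integral_norm_bound]) (simp add: norm_mult del: of_real_mult)

text \<open>The product of g with the exponential has an integrable continuous derivative, whose
  integral vanishes; there are no boundary terms to discuss.\<close>

lemma ft_derivative:
  assumes g: "integrable lborel g" "\<And>y. (g has_vector_derivative g' y) (at y)"
    and g': "integrable lborel g'" "continuous_on UNIV g'"
  shows "ft g' \<xi> = \<i> * of_real \<xi> * ft g \<xi>"
proof -
  let ?e = "\<lambda>t. exp (- (\<i> * of_real (\<xi> * t)))"
  have cg: "continuous_on UNIV g"
    using g(2) by (meson UNIV_I continuous_at_imp_continuous_on has_vector_derivative_continuous)
  have e: "(?e has_vector_derivative - (\<i> * of_real \<xi>) * ?e t) (at t)" for t
    using has_vector_derivative_exp_linear[of "- (\<i> * of_real \<xi>)" t UNIV] by (simp add: mult.assoc)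
  have "(LINT t|lborel. g t * (- (\<i> * of_real \<xi>) * ?e t) + g' t * ?e t) = 0"
  proof (rule integral_derivative_eq_0)
    show "integrable lborel (\<lambda>t. g t * ?e t)" by (rule integrable_times_phase) fact
    show "((\<lambda>t. g t * ?e t) has_vector_derivative g y * (- (\<i> * of_real \<xi>) * ?e y) + g' y * ?e y) (at y)" for y
      by (rule has_vector_derivative_mult g e)+
    have "integrable lborel (\<lambda>t. - (\<i> * of_real \<xi>) * (g t * ?e t) + g' t * ?e t)"
      by (intro Bochner_Integration.integrable_add integrable_mult_right integrable_times_phase g g')
    then show "integrable lborel (\<lambda>t. g t * (- (\<i> * of_real \<xi>) * ?e t) + g' t * ?e t)"
      by (simp add: algebra_simps)
    show "continuous_on UNIV (\<lambda>t. g t * (- (\<i> * of_real \<xi>) * ?e t) + g' t * ?e t)"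
      by (intro continuous_intros cg g')
  qed
  also have "(LINT t|lborel. g t * (- (\<i> * of_real \<xi>) * ?e t) + g' t * ?e t)
      = (LINT t|lborel. - (\<i> * of_real \<xi>) * (g t * ?e t) + g' t * ?e t)"
    by (rule Bochner_Integration.integral_cong) auto
  also have "\<dots> = - (\<i> * of_real \<xi>) * ft g \<xi> + ft g' \<xi>"
    unfolding ft_def
    unfolding Bochner_Integration.integral_add[OF integrable_mult_right[OF integrable_times_phase[OF g(1)]] integrable_times_phase[OF g'(1)]]
      integral_mult_right_zero ..
  finally show ?thesis by (simp add: algebra_simps)
qed

lemma ft_conv:
  assumes g: "integrable lborel g" and b: "Re b \<noteq> 0"
  shows "integrable lborel (conv b g)" "ft (conv b g) \<xi> = ft g \<xi> / (b + \<i> * of_real \<xi>)"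
proof -
  have [measurable]: "g \<in> borel_measurable borel"
    using borel_measurable_integrable[OF g] by simp
  let ?e = "\<lambda>t. exp (- (\<i> * of_real (\<xi> * t)))"
  define w where "w = (\<lambda>t y. kern b (y - t) * g t * ?e y)"
  define v where "v = (\<lambda>t y. kern b (y - t) * g t)"
  have k: "integrable lborel (\<lambda>y. kern b (y - t))" for t
    using lborel_integrable_real_affine[OF kern_integrable[OF b], of 1 "-t"] by simp
  have kn: "(LINT y|lborel. norm (kern b (y - t))) = 1 / \<bar>Re b\<bar>" for t
    using lborel_integral_real_affine[of 1 "\<lambda>y. norm (kern b y)" "-t"] kern_integrable_norm_power(2)[OF b, of 1] by simp
  have v: "integrable (lborel \<Otimes>\<^sub>M lborel) (case_prod v)"
  proof (rule lborel_pair.Fubini_integrable)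
    show "case_prod v \<in> borel_measurable (lborel \<Otimes>\<^sub>M lborel)"
      unfolding v_def by measurable
    show "integrable lborel (\<lambda>t. LINT y|lborel. norm (case_prod v (t, y)))"
      using g by (simp add: v_def norm_mult kn)
    show "AE t in lborel. integrable lborel (\<lambda>y. case_prod v (t, y))"
      using k by (auto simp: v_def)
  qed
  have w: "integrable (lborel \<Otimes>\<^sub>M lborel) (case_prod w)"
  proof (rule Bochner_Integration.integrable_bound[OF v])
    show "case_prod w \<in> borel_measurable (lborel \<Otimes>\<^sub>M lborel)"
      unfolding w_def by measurable
    show "AE p in lborel \<Otimes>\<^sub>M lborel. norm (case_prod w p) \<le> norm (case_prod v p)"
      by (auto simp: w_def v_def norm_mult simp del: of_real_mult)
  qed
  show "integrable lborel (conv b g)"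
    using lborel_pair.integrable_snd[OF v] by (simp add: conv_def[abs_def] v_def)
  have "ft (conv b g) \<xi> = (LINT y|lborel. LINT t|lborel. w t y)"
    by (simp add: ft_def conv_def w_def)
  also have "\<dots> = (LINT t|lborel. LINT y|lborel. w t y)"
    by (rule lborel_pair.Fubini_integral[OF w])
  also have "\<dots> = (LINT t|lborel. g t * ?e t * (1 / (b + \<i> * of_real \<xi>)))"
  proof (rule Bochner_Integration.integral_cong)
    fix t
    have "w t y = g t * ?e t * kern (b + \<i> * of_real \<xi>) (y - t)" for y
      by (simp add: w_def kern_times_exp[symmetric] exp_add[symmetric] algebra_simps)
    then have "(LINT y|lborel. w t y) = g t * ?e t * (LINT y|lborel. kern (b + \<i> * of_real \<xi>) (y - t))"
      by simp
    also have "(LINT y|lborel. kern (b + \<i> * of_real \<xi>) (y - t)) = 1 / (b + \<i> * of_real \<xi>)"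
      using lborel_integral_real_affine[of 1 "kern (b + \<i> * of_real \<xi>)" "-t"] integral_kern[of "b + \<i> * of_real \<xi>"] b by simp
    finally show "(LINT y|lborel. w t y) = g t * ?e t * (1 / (b + \<i> * of_real \<xi>))" .
  qed auto
  also have "\<dots> = ft g \<xi> / (b + \<i> * of_real \<xi>)"
    by (simp add: ft_def)
  finally show "ft (conv b g) \<xi> = ft g \<xi> / (b + \<i> * of_real \<xi>)" .
qed

lemma std_normal_ft: "(LINT x|lborel. of_real (std_normal_density x) * exp (\<i> * of_real (x * t))) = of_real (exp (- (t^2) / 2))"
proof -
  have "char std_normal_distribution t = (LINT x|lborel. of_real (std_normal_density x) * exp (\<i> * of_real (x * t)))"
    unfolding char_def
    by (subst integral_density) (auto simp: scaleR_conv_of_real mult.commute)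
  then show ?thesis by (simp add: char_std_normal_distribution)
qed

text \<open>Fourier inversion, by regularising with the Gaussian \<open>std_normal_density (e \<xi>)\<close> and letting \<open>e \<rightarrow> 0\<close>.\<close>

lemma fourier_inversion:
  fixes v :: "real \<Rightarrow> complex"
  assumes v: "integrable lborel v" "continuous_on UNIV v" "\<And>t. norm (v t) \<le> B"
    and i: "integrable lborel (\<lambda>\<xi>. ft v \<xi> * exp (\<i> * of_real (\<xi> * y)))"
  shows "(LINT \<xi>|lborel. ft v \<xi> * exp (\<i> * of_real (\<xi> * y))) = 2 * pi * v y"
proof -
  have [measurable]: "v \<in> borel_measurable borel"
    using borel_measurable_integrable[OF v(1)] by simp
  let ?d = "\<lambda>x. complex_of_real (std_normal_density x)"
  define e where "e = (\<lambda>n. 1 / real (Suc n))"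
  have e: "e n > 0" "e \<longlonglongrightarrow> 0" for n
    using lim_inverse_n'[THEN LIMSEQ_Suc] by (auto simp: e_def)
  have dint: "integrable lborel (\<lambda>\<xi>. std_normal_density (e n * \<xi>))" for n
    using lborel_integrable_real_affine[OF integrable_normal_density[of 1 0], of "e n" 0] e(1)[of n] by simp
  \<comment> \<open>Fubini and the transform of the Gaussian turn the regularised inversion integral
    into a Gaussian average of v around y at scale \<open>e n\<close>.\<close>
  have A: "(LINT \<xi>|lborel. ft v \<xi> * exp (\<i> * of_real (\<xi> * y)) * ?d (e n * \<xi>))
      = (LINT t|lborel. v (y + e n * t) * of_real (exp (- (t^2) / 2)))" for n
  proof -
    define w where "w = (\<lambda>t \<xi>. v t * ?d (e n * \<xi>) * exp (\<i> * of_real (\<xi> * (y - t))))"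
    have w: "integrable (lborel \<Otimes>\<^sub>M lborel) (case_prod w)"
    proof (rule lborel_pair.Fubini_integrable)
      show "case_prod w \<in> borel_measurable (lborel \<Otimes>\<^sub>M lborel)"
        unfolding w_def by measurable
      show "integrable lborel (\<lambda>t. LINT \<xi>|lborel. norm (case_prod w (t, \<xi>)))"
        using v(1) by (simp add: w_def norm_mult del: of_real_mult)
      have "integrable lborel (\<lambda>\<xi>. w t \<xi>)" for t
      proof (rule Bochner_Integration.integrable_bound)
        show "integrable lborel (\<lambda>\<xi>. norm (v t) * std_normal_density (e n * \<xi>))" using dint by simp
      qed (auto simp: w_def norm_mult simp del: of_real_mult)
      then show "AE t in lborel. integrable lborel (\<lambda>\<xi>. case_prod w (t, \<xi>))" by simp
    qed
    have "(LINT \<xi>|lborel. ft v \<xi> * exp (\<i> * of_real (\<xi> * y)) * ?d (e n * \<xi>)) = (LINT \<xi>|lborel. LINT t|lborel. w t \<xi>)"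
    proof (rule Bochner_Integration.integral_cong)
      fix \<xi>
      have "w t \<xi> = exp (\<i> * of_real (\<xi> * y)) * ?d (e n * \<xi>) * (v t * exp (- (\<i> * of_real (\<xi> * t))))" for t
        by (simp add: w_def algebra_simps exp_diff exp_minus divide_inverse)
      then show "ft v \<xi> * exp (\<i> * of_real (\<xi> * y)) * ?d (e n * \<xi>) = (LINT t|lborel. w t \<xi>)"
        by (simp add: ft_def)
    qed auto
    also have "\<dots> = (LINT t|lborel. LINT \<xi>|lborel. w t \<xi>)"
      by (rule lborel_pair.Fubini_integral[OF w])
    also have "\<dots> = (LINT t|lborel. v t * (of_real (exp (- (((y - t) / e n)^2) / 2)) / e n))"
    proof (rule Bochner_Integration.integral_cong)
      fix t
      have "(LINT \<xi>|lborel. w t \<xi>) = v t * (LINT \<xi>|lborel. ?d (e n * \<xi>) * exp (\<i> * of_real (\<xi> * (y - t))))"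
        by (simp add: w_def mult.assoc)
      also have "(LINT x|lborel. ?d x * exp (\<i> * of_real (x * ((y - t) / e n))))
          = e n *\<^sub>R (LINT \<xi>|lborel. ?d (e n * \<xi>) * exp (\<i> * of_real (\<xi> * (y - t))))"
      proof -
        have "e n * \<xi> * ((y - t) / e n) = \<xi> * (y - t)" for \<xi> using e(1)[of n] by simp
        then show ?thesis
          using lborel_integral_real_affine[of "e n" "\<lambda>x. ?d x * exp (\<i> * of_real (x * ((y - t) / e n)))" 0] e(1)[of n]
          by (simp del: of_real_mult of_real_divide of_real_diff)
      qed
      then have "(LINT \<xi>|lborel. ?d (e n * \<xi>) * exp (\<i> * of_real (\<xi> * (y - t)))) = of_real (exp (- (((y - t) / e n)^2) / 2)) / e n"
        unfolding std_normal_ft using e(1)[of n] by (simp add: scaleR_conv_of_real field_simps)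
      finally show "(LINT \<xi>|lborel. w t \<xi>) = v t * (of_real (exp (- (((y - t) / e n)^2) / 2)) / e n)" .
    qed auto
    also have "\<dots> = (LINT t|lborel. v (y + e n * t) * of_real (exp (- (t^2) / 2)))"
      using lborel_integral_real_affine[of "e n" "\<lambda>t. v t * (of_real (exp (- (((y - t) / e n)^2) / 2)) / e n)" y] e(1)[of n]
      by (simp add: scaleR_conv_of_real)
    finally show ?thesis .
  qed
  have L: "(\<lambda>n. LINT \<xi>|lborel. ft v \<xi> * exp (\<i> * of_real (\<xi> * y)) * ?d (e n * \<xi>))
      \<longlonglongrightarrow> (LINT \<xi>|lborel. ft v \<xi> * exp (\<i> * of_real (\<xi> * y)) * ?d 0)"
  proof (rule integral_dominated_convergence)
    show "integrable lborel (\<lambda>\<xi>. norm (ft v \<xi> * exp (\<i> * of_real (\<xi> * y))))" using i by (rule integrable_norm)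
    have "(\<lambda>n. std_normal_density (e n * \<xi>)) \<longlonglongrightarrow> std_normal_density (0 * \<xi>)" for \<xi>
      unfolding std_normal_density_def by (intro tendsto_intros e) auto
    then show "AE \<xi> in lborel. (\<lambda>n. ft v \<xi> * exp (\<i> * of_real (\<xi> * y)) * ?d (e n * \<xi>)) \<longlonglongrightarrow> ft v \<xi> * exp (\<i> * of_real (\<xi> * y)) * ?d 0"
      by (auto intro!: tendsto_intros)
    have "std_normal_density x \<le> 1" for x
    proof -
      have "1 * exp (- x\<^sup>2 / 2) \<le> sqrt (2 * pi)"
        by (rule order_trans[of _ "1 * 1"]) (use pi_gt3 in \<open>auto intro!: real_le_rsqrt\<close>)
      then show ?thesis by (simp add: std_normal_density_def divide_simps)
    qed
    then show "AE \<xi> in lborel. norm (ft v \<xi> * exp (\<i> * of_real (\<xi> * y)) * ?d (e n * \<xi>)) \<le> norm (ft v \<xi> * exp (\<i> * of_real (\<xi> * y)))" for n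
      by (auto simp: norm_mult simp del: of_real_mult intro!: mult_left_le)
  qed (use borel_measurable_integrable[OF i] in measurable)
  have gi: "integrable lborel (\<lambda>t::real. exp (- (t^2) / 2))"
    using integrable_mult_right[OF integrable_normal_density[of 1 0], of "sqrt (2 * pi)"] by (simp add: std_normal_density_def)
  have gv: "(LINT t|lborel. exp (- ((t::real)^2) / 2)) = sqrt (2 * pi)"
  proof -
    have "(LINT t|lborel. exp (- ((t::real)^2) / 2)) = (LINT t|lborel. sqrt (2 * pi) * std_normal_density t)"
      by (rule Bochner_Integration.integral_cong) (auto simp: std_normal_density_def)
    then show ?thesis using integral_normal_density[of 1 0] by simp
  qed
  have R: "(\<lambda>n. LINT t|lborel. v (y + e n * t) * of_real (exp (- (t^2) / 2)))
      \<longlonglongrightarrow> (LINT t|lborel. v y * of_real (exp (- (t^2) / 2)))"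
  proof (rule integral_dominated_convergence)
    show "integrable lborel (\<lambda>t. B * exp (- (t^2) / 2))" using gi by simp
    have "isCont v y" using v(2) by (simp add: continuous_on_eq_continuous_at)
    then have "(\<lambda>n. v (y + e n * t)) \<longlonglongrightarrow> v y" for t
      by (rule isCont_tendsto_compose) (use tendsto_add[OF tendsto_const tendsto_mult[OF e(2) tendsto_const], of y t] in auto)
    then show "AE t in lborel. (\<lambda>n. v (y + e n * t) * of_real (exp (- (t^2) / 2))) \<longlonglongrightarrow> v y * of_real (exp (- (t^2) / 2))"
      by (auto intro!: tendsto_intros)
    show "AE t in lborel. norm (v (y + e n * t) * of_real (exp (- (t^2) / 2))) \<le> B * exp (- (t^2) / 2)" for n
      using v(3) by (auto simp: norm_mult intro!: mult_right_mono)
  qed auto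
  \<comment> \<open>The two limits of the same sequence agree. The left one carries the density at
    0, that is 1 / sqrt (2 pi), the right one the Gaussian integral sqrt (2 pi); together they give
    the factor 2 pi.\<close>
  have "(LINT \<xi>|lborel. ft v \<xi> * exp (\<i> * of_real (\<xi> * y)) * ?d 0) = (LINT t|lborel. v y * of_real (exp (- (t^2) / 2)))"
    using LIMSEQ_unique[OF L[unfolded A] R] .
  then have I: "(LINT \<xi>|lborel. ft v \<xi> * exp (\<i> * of_real (\<xi> * y))) * ?d 0 = v y * of_real (sqrt (2 * pi))"
    using gv by simp
  have "?d 0 * of_real (sqrt (2 * pi)) = 1"
    unfolding of_real_mult[symmetric] by (simp add: std_normal_density_def)
  then have "(LINT \<xi>|lborel. ft v \<xi> * exp (\<i> * of_real (\<xi> * y)))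
      = (LINT \<xi>|lborel. ft v \<xi> * exp (\<i> * of_real (\<xi> * y))) * (?d 0 * of_real (sqrt (2 * pi)))"
    by simp
  also have "\<dots> = v y * of_real (sqrt (2 * pi) * sqrt (2 * pi))"
    using arg_cong[OF I, of "\<lambda>v. v * of_real (sqrt (2 * pi))"] by (simp only: mult.assoc of_real_mult)
  also have "sqrt (2 * pi) * sqrt (2 * pi) = 2 * pi" by simp
  finally show ?thesis by simp
qed

text \<open>Identifies the frequency integral of the Jost equation with a convolution; the
  integrability hypothesis is supplied by a clause of \<open>jost_function\<close>.\<close>

lemma conv_inversion:
  assumes g: "integrable lborel g" and b: "Re b \<noteq> 0"
    and i: "integrable lborel (\<lambda>\<xi>. ft g \<xi> / (b + \<i> * of_real \<xi>) * exp (\<i> * of_real (\<xi> * y)))"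
  shows "(LINT \<xi>|lborel. ft g \<xi> / (b + \<i> * of_real \<xi>) * exp (\<i> * of_real (\<xi> * y))) = 2 * pi * conv b g y"
  using fourier_inversion[OF ft_conv(1)[OF g b] continuous_on_conv[OF g b] norm_conv_le[OF g, of b], of y] i
  by (simp add: ft_conv(2)[OF g b])

subsection \<open>Fourier modes on the strip\<close>

text \<open>The one-dimensional Sobolev embedding: |g y| <= |g (y + s)| plus the integral of |g'|,
  averaged over s in [0, 1].\<close>

lemma norm_le_integral_derivative:
  fixes g :: "real \<Rightarrow> complex"
  assumes g: "integrable lborel g" "\<And>y. (g has_vector_derivative g' y) (at y)"
    and g': "integrable lborel g'" "continuous_on UNIV g'"
  shows "norm (g y) \<le> (LINT t|lborel. norm (g t)) + (LINT t|lborel. norm (g' t))"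
proof -
  let ?I = "LINT t|lborel. norm (g' t)"
  have le: "norm (g y) \<le> norm (g (y + s)) + ?I" if s: "0 \<le> s" for s
  proof -
    have "(LINT t|lborel. indicator {y..y+s} t *\<^sub>R g' t) = g (y + s) - g y"
      by (rule integral_FTC_Icc) (use s g(2) g'(2) in \<open>auto intro: has_vector_derivative_at_within continuous_on_subset\<close>)
    then have "norm (g (y + s) - g y) \<le> (LINT t|lborel. norm (indicator {y..y+s} t *\<^sub>R g' t))"
      by (metis integral_norm_bound)
    also have "\<dots> \<le> ?I"
      by (rule integral_mono[OF integrable_norm[OF integrable_mult_indicator[OF _ g'(1)]] integrable_norm[OF g'(1)]])
        (auto simp: indicator_def)
    finally have "norm (g (y + s) - g y) \<le> ?I" .
    then show ?thesis
      using norm_triangle_ineq4[of "g (y + s)" "g (y + s) - g y"] by simp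
  qed
  have "norm (g y) - ?I = (LINT s|lborel. indicator {0..1::real} s * (norm (g y) - ?I))"
    by simp
  also have "\<dots> \<le> (LINT s|lborel. norm (g (y + s)))"
  proof (rule integral_mono)
    show "integrable lborel (\<lambda>s. norm (g (y + s)))"
      using lborel_integrable_real_affine[OF g(1), of 1 y] by simp
    show "indicator {0..1} s * (norm (g y) - ?I) \<le> norm (g (y + s))" for s
      using le[of s] by (auto simp: indicator_def)
  qed simp
  also have "\<dots> = (LINT t|lborel. norm (g t))"
    using lborel_integral_real_affine[of 1 "\<lambda>t. norm (g t)" y] by simp
  finally show ?thesis by simp
qed

lemma set_integral_sum_finite:
  fixes f :: "'i \<Rightarrow> 'b \<Rightarrow> 'a :: {banach, second_countable_topology}"
  assumes "finite F" "\<And>i. i \<in> F \<Longrightarrow> set_integrable M A (f i)"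
  shows "set_integrable M A (\<lambda>x. \<Sum>i\<in>F. f i x)"
    and "(LINT x:A|M. (\<Sum>i\<in>F. f i x)) = (\<Sum>i\<in>F. (LINT x:A|M. f i x))"
  using assms unfolding set_integrable_def set_lebesgue_integral_def scaleR_sum_right
   apply -
   apply (rule Bochner_Integration.integrable_sum, blast)
  apply (rule Bochner_Integration.integral_sum, blast)
  done

abbreviation continuous2 :: "(real \<Rightarrow> real \<Rightarrow> complex) \<Rightarrow> bool" where
  "continuous2 f \<equiv> continuous_on UNIV (\<lambda>(x, y). f x y)"

abbreviation pointwise_times :: "(real \<Rightarrow> real \<Rightarrow> complex) \<Rightarrow> (real \<Rightarrow> real \<Rightarrow> complex) \<Rightarrow> real \<Rightarrow> real \<Rightarrow> complex"
    (infixl "\<odot>" 70) where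
  "w \<odot> f \<equiv> \<lambda>x y. w x y * f x y"

locale strip_setup =
  fixes l :: real
  assumes l_pos: "0 < l"
begin

lemma omega_pos: "0 < omega l"
  using l_pos by (simp add: omega_def)

lemma omega_l: "omega l * l = pi"
  using l_pos by (simp add: omega_def)

definition emode :: "int \<Rightarrow> real \<Rightarrow> complex" where
  "emode m x = exp (\<i> * of_real (omega l * of_int m * x))"

definition fcoef :: "(real \<Rightarrow> real \<Rightarrow> complex) \<Rightarrow> int \<Rightarrow> real \<Rightarrow> complex" where
  "fcoef w m y = 1 / (2 * of_real l) * (LINT x:{-l..l}|lborel. w x y * emode (- m) x)"

definition slice :: "nat \<Rightarrow> (real \<Rightarrow> real \<Rightarrow> complex) \<Rightarrow> real \<Rightarrow> real" where
  "slice p w y = (LINT x:{-l..l}|lborel. norm (w x y) ^ p)"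

text \<open>Norm control of \<open>L\<^sup>1\<close> and \<open>L\<^sup>2\<close> simultaneously, with integrals taken in \<open>x\<close> first.\<close>

definition tame :: "real \<Rightarrow> (real \<Rightarrow> real \<Rightarrow> complex) \<Rightarrow> bool" where
  "tame c w \<longleftrightarrow> 0 < c \<and> x_periodic l w \<and> (\<lambda>(x, y). w x y) \<in> borel_measurable borel \<and>
     (\<forall>y. \<exists>B. \<forall>x\<in>{-l..l}. norm (w x y) \<le> B) \<and>
     (\<forall>p\<in>{1, 2}. integrable lborel (slice p w) \<and> (LINT y|lborel. slice p w y) \<le> c ^ p)"

lemma norm_emode [simp]: "norm (emode m x) = 1"
  by (simp add: emode_def del: of_real_mult)

lemma emode_0 [simp]: "emode 0 x = 1"
  by (simp add: emode_def)

lemma emode_add: "emode (m + n) x = emode m x * emode n x"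
  by (simp add: emode_def exp_add[symmetric] algebra_simps)

lemma cnj_emode: "cnj (emode m x) = emode (- m) x"
  by (simp add: emode_def exp_cnj)

lemma emode_periodic: "emode m (x + 2 * l) = emode m x"
proof -
  have "emode m (x + 2 * l) = emode m x * exp (2 * of_int m * of_real pi * \<i>)"
    unfolding emode_def exp_add[symmetric] omega_l[symmetric] by (simp add: algebra_simps)
  then show ?thesis using exp_integer_2pi[of "of_int m"] by simp
qed

lemma emode_has_vector_derivative:
  "(emode m has_vector_derivative \<i> * of_real (omega l * of_int m) * emode m x) (at x within S)"
  using has_vector_derivative_exp_linear[of "\<i> * of_real (omega l * of_int m)" x S]
  by (simp add: emode_def[abs_def] mult.assoc)

lemma continuous_on_emode [continuous_intros]: "continuous_on S f \<Longrightarrow> continuous_on S (\<lambda>t. emode m (f t))"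
  unfolding emode_def by (intro continuous_intros)

lemma emode_measurable [measurable]: "emode m \<in> borel_measurable borel"
  by (intro borel_measurable_continuous_onI continuous_intros)

lemma emode_ends: "emode m l = emode m (- l)"
  using emode_periodic[of m "-l"] by simp

lemma integral_emode:
  "(LINT x:{-l..l}|lborel. emode m x) = (if m = 0 then 2 * of_real l else 0)"
proof (cases "m = 0")
  case True
  then show ?thesis using l_pos by (simp add: set_lebesgue_integral_def scaleR_conv_of_real)
next
  case False
  let ?k = "\<i> * of_real (omega l * of_int m)"
  have k: "?k \<noteq> 0" using omega_pos False by simp
  have "(LINT x|lborel. indicator {-l..l} x *\<^sub>R emode m x) = 1 / ?k * emode m l - 1 / ?k * emode m (- l)"
  proof (rule integral_FTC_Icc)
    show "((\<lambda>x. 1 / ?k * emode m x) has_vector_derivative emode m x) (at x within {-l..l})" for x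
      by (rule has_vector_derivative_eq_rhs[OF has_vector_derivative_mult_right[OF emode_has_vector_derivative]])
        (use k in simp)
  qed (use l_pos in \<open>auto intro!: continuous_intros\<close>)
  then show ?thesis using False by (simp add: set_lebesgue_integral_def emode_ends)
qed

lemma tame_measurable:
  assumes "tame c w" "f \<in> borel_measurable M" "g \<in> borel_measurable M"
  shows "(\<lambda>t. w (f t) (g t)) \<in> borel_measurable M"
proof -
  have "(\<lambda>(x, y). w x y) \<in> borel_measurable (borel \<Otimes>\<^sub>M borel)"
    using assms(1) by (simp add: tame_def borel_prod)
  from measurable_compose[OF measurable_Pair[OF assms(2,3)] this] show ?thesis by simp
qed

lemma set_integrable_bounded:
  fixes h :: "real \<Rightarrow> 'a :: {banach, second_countable_topology}"
  assumes "h \<in> borel_measurable borel" "\<And>x. x \<in> {-l..l} \<Longrightarrow> norm (h x) \<le> B"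
  shows "set_integrable lborel {-l..l} h"
  unfolding set_integrable_def
proof (rule Bochner_Integration.integrable_bound)
  show "integrable lborel (\<lambda>x. indicator {-l..l} x * B)"
    using borel_integrable_atLeastAtMost'[of "-l" l "\<lambda>_. B"] by (simp add: set_integrable_def)
  show "(\<lambda>x. indicator {-l..l} x *\<^sub>R h x) \<in> borel_measurable lborel" using assms(1) by simp
  show "AE x in lborel. norm (indicator {-l..l} x *\<^sub>R h x) \<le> norm (indicator {-l..l} x * B)"
    using assms(2) by (force simp: indicator_def intro!: AE_I2)
qed

lemma tame_slice:
  assumes w: "tame c w"
  shows "set_integrable lborel {-l..l} (\<lambda>x. w x y)"
    and "set_integrable lborel {-l..l} (\<lambda>x. w x y * emode m x)"
    and "set_integrable lborel {-l..l} (\<lambda>x. norm (w x y) ^ p)"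
proof -
  have [measurable]: "(\<lambda>x. w x y) \<in> borel_measurable borel"
    by (rule tame_measurable[OF w]) auto
  obtain B where B: "\<And>x. x \<in> {-l..l} \<Longrightarrow> norm (w x y) \<le> B"
    using w unfolding tame_def by blast
  show "set_integrable lborel {-l..l} (\<lambda>x. w x y)"
    by (rule set_integrable_bounded[of _ B]) (use B in auto)
  show "set_integrable lborel {-l..l} (\<lambda>x. w x y * emode m x)"
    by (rule set_integrable_bounded[of _ B]) (use B in \<open>auto simp: norm_mult\<close>)
  show "set_integrable lborel {-l..l} (\<lambda>x. norm (w x y) ^ p)"
    by (rule set_integrable_bounded[of _ "B ^ p"]) (use B in \<open>auto intro!: power_mono simp: norm_power\<close>)
qed

lemma slice_nonneg: "0 \<le> slice p w y"
  unfolding slice_def set_lebesgue_integral_def by (rule integral_nonneg_AE) auto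

lemma tameD:
  assumes "tame c w"
  shows "0 < c" "x_periodic l w" "integrable lborel (slice 1 w)" "integrable lborel (slice 2 w)"
    "(LINT y|lborel. slice 1 w y) \<le> c" "(LINT y|lborel. slice 2 w y) \<le> c\<^sup>2"
  using assms by (auto simp: tame_def)

lemma norm_fcoef_le:
  assumes w: "tame c w"
  shows "norm (fcoef w m y) \<le> slice 1 w y / (2 * l)"
proof -
  have "norm (LINT x:{-l..l}|lborel. w x y * emode (- m) x) \<le> slice 1 w y"
    unfolding set_lebesgue_integral_def slice_def
    by (rule order_trans[OF integral_norm_bound]) (simp add: norm_mult)
  then show ?thesis
    using l_pos by (simp add: fcoef_def norm_mult norm_divide divide_simps)
qed

lemma fcoef_measurable [measurable (raw)]:
  assumes w: "tame c w"
  shows "fcoef w m \<in> borel_measurable borel"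
proof -
  have [measurable]: "(\<lambda>p. w (snd p) (fst p)) \<in> borel_measurable (borel \<Otimes>\<^sub>M borel)"
    by (rule tame_measurable[OF w]) auto
  show ?thesis
    unfolding fcoef_def[abs_def] set_lebesgue_integral_def by measurable
qed

lemma fcoef_integrable:
  assumes w: "tame c w"
  shows "integrable lborel (fcoef w m)" "(LINT y|lborel. norm (fcoef w m y)) \<le> c / (2 * l)"
proof -
  have i: "integrable lborel (\<lambda>y. slice 1 w y / (2 * l))" using tameD[OF w] by simp
  show int: "integrable lborel (fcoef w m)"
  proof (rule Bochner_Integration.integrable_bound[OF i])
    show "fcoef w m \<in> borel_measurable lborel" using fcoef_measurable[OF w] by simp
    show "AE y in lborel. norm (fcoef w m y) \<le> norm (slice 1 w y / (2 * l))"
      using norm_fcoef_le[OF w] slice_nonneg l_pos by (auto simp: abs_of_nonneg)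
  qed
  have "(LINT y|lborel. norm (fcoef w m y)) \<le> (LINT y|lborel. slice 1 w y / (2 * l))"
    by (rule integral_mono) (use i int norm_fcoef_le[OF w] in auto)
  also have "\<dots> \<le> c / (2 * l)" using tameD[OF w] l_pos by (simp add: divide_right_mono)
  finally show "(LINT y|lborel. norm (fcoef w m y)) \<le> c / (2 * l)" .
qed

text \<open>Bessel's inequality on a horizontal line. Expand the squared L2 distance from w to its
  partial Fourier sum \<open>S\<close>; the cross term and the square of \<open>S\<close> both
  produce 2 l N.\<close>

lemma bessel_slice:
  assumes w: "tame c w" and F: "finite F"
  shows "(\<Sum>m\<in>F. norm (fcoef w m y) ^ 2) \<le> slice 2 w y / (2 * l)"
proof -
  define S where "S = (\<lambda>x. \<Sum>m\<in>F. fcoef w m y * emode m x)"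
  define N where "N = (\<Sum>m\<in>F. norm (fcoef w m y) ^ 2)"
  have cS: "continuous_on A S" for A unfolding S_def by (intro continuous_intros)
  have iw: "set_integrable lborel {-l..l} (\<lambda>x. w x y * emode m x)" for m
    by (rule tame_slice[OF w])
  have coef: "(LINT x:{-l..l}|lborel. w x y * emode (- m) x) = 2 * of_real l * fcoef w m y" for m
    using l_pos by (simp add: fcoef_def)
  have A: "(LINT x:{-l..l}|lborel. w x y * cnj (S x)) = 2 * of_real l * of_real N"
    and Ai: "set_integrable lborel {-l..l} (\<lambda>x. w x y * cnj (S x))"
  proof -
    have eq: "w x y * cnj (S x) = (\<Sum>m\<in>F. cnj (fcoef w m y) * (w x y * emode (- m) x))" for x
      by (simp add: S_def sum_distrib_left cnj_emode algebra_simps)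
    show "set_integrable lborel {-l..l} (\<lambda>x. w x y * cnj (S x))"
      unfolding eq by (intro set_integral_sum_finite(1) set_integrable_mult_right F iw)
    have "(LINT x:{-l..l}|lborel. w x y * cnj (S x)) = (\<Sum>m\<in>F. cnj (fcoef w m y) * (2 * of_real l * fcoef w m y))"
      unfolding eq set_integral_sum_finite(2)[OF F set_integrable_mult_right[OF iw]] set_integral_mult_right coef ..
    also have "\<dots> = 2 * of_real l * of_real N"
      by (simp add: N_def sum_distrib_left of_real_sum complex_norm_square[symmetric] algebra_simps)
    finally show "(LINT x:{-l..l}|lborel. w x y * cnj (S x)) = 2 * of_real l * of_real N" .
  qed
  have B: "(LINT x:{-l..l}|lborel. S x * cnj (S x)) = 2 * of_real l * of_real N"
    and Bi: "set_integrable lborel {-l..l} (\<lambda>x. S x * cnj (S x))"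
  proof -
    show "set_integrable lborel {-l..l} (\<lambda>x. S x * cnj (S x))"
      by (intro borel_integrable_atLeastAtMost' continuous_intros cS)
    have eq: "S x * cnj (S x) = (\<Sum>m\<in>F. \<Sum>n\<in>F. fcoef w m y * cnj (fcoef w n y) * emode (m - n) x)" for x
      unfolding S_def by (simp add: sum_product cnj_emode emode_add[of _ "- _", simplified] algebra_simps)
    have i: "set_integrable lborel {-l..l} (\<lambda>x. c * emode k x)" for k c
      by (intro borel_integrable_atLeastAtMost' continuous_intros)
    have "(LINT x:{-l..l}|lborel. S x * cnj (S x))
        = (\<Sum>m\<in>F. \<Sum>n\<in>F. fcoef w m y * cnj (fcoef w n y) * (if m - n = 0 then 2 * of_real l else 0))"
      unfolding eq set_integral_sum_finite(2)[OF F set_integral_sum_finite(1)[OF F i]] set_integral_sum_finite(2)[OF F i]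
        set_integral_mult_right integral_emode ..
    also have "\<dots> = 2 * of_real l * of_real N"
      using F by (simp add: N_def sum_distrib_left of_real_sum complex_norm_square[symmetric] algebra_simps if_distrib cong: if_cong)
    finally show "(LINT x:{-l..l}|lborel. S x * cnj (S x)) = 2 * of_real l * of_real N" .
  qed
  have "0 \<le> (LINT x:{-l..l}|lborel. norm (w x y - S x) ^ 2)"
    unfolding set_lebesgue_integral_def by (rule integral_nonneg_AE) auto
  also have "\<dots> = (LINT x:{-l..l}|lborel. norm (w x y) ^ 2 + Re (S x * cnj (S x)) - 2 * Re (w x y * cnj (S x)))"
  proof (rule arg_cong[where f="set_lebesgue_integral lborel {-l..l}"], rule ext)
    show "norm (w x y - S x) ^ 2 = norm (w x y) ^ 2 + Re (S x * cnj (S x)) - 2 * Re (w x y * cnj (S x))" for x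
      unfolding cmod_power2 by (simp add: power2_eq_square algebra_simps)
  qed
  also have "\<dots> = slice 2 w y + Re (LINT x:{-l..l}|lborel. S x * cnj (S x)) - 2 * Re (LINT x:{-l..l}|lborel. w x y * cnj (S x))"
  proof -
    have R: "set_integrable lborel {-l..l} (\<lambda>x. Re (h x))" "(LINT x:{-l..l}|lborel. Re (h x)) = Re (LINT x:{-l..l}|lborel. h x)"
      if "set_integrable lborel {-l..l} h" for h :: "real \<Rightarrow> complex"
      using integrable_Re[OF that[unfolded set_integrable_def]] integral_Re[OF that[unfolded set_integrable_def]]
      by (simp_all add: set_integrable_def set_lebesgue_integral_def)
    note i = tame_slice(3)[OF w, of y 2] R(1)[OF Bi] set_integrable_mult_right[OF R(1)[OF Ai], of 2]
    show ?thesis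
      unfolding set_integral_diff(2)[OF set_integral_add(1)[OF i(1,2)] i(3)] set_integral_add(2)[OF i(1,2)] slice_def
        set_integral_mult_right R(2)[OF Ai] R(2)[OF Bi] ..
  qed
  also have "\<dots> = slice 2 w y - 2 * l * N"
    unfolding A B by simp
  finally show ?thesis using l_pos by (simp add: N_def field_simps)
qed

lemma fcoef_square_integrable:
  assumes w: "tame c w"
  shows "integrable lborel (\<lambda>y. norm (fcoef w m y) ^ 2)"
proof (rule Bochner_Integration.integrable_bound)
  show "integrable lborel (\<lambda>y. slice 2 w y / (2 * l))" using tameD[OF w] by simp
  show "(\<lambda>y. norm (fcoef w m y) ^ 2) \<in> borel_measurable lborel" using fcoef_measurable[OF w] by simp
  show "AE y in lborel. norm (norm (fcoef w m y) ^ 2) \<le> norm (slice 2 w y / (2 * l))"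
    using bessel_slice[OF w, of "{m}"] slice_nonneg l_pos by (auto simp: abs_of_nonneg)
qed

lemma bessel:
  assumes w: "tame c w" and F: "finite F"
  shows "(\<Sum>m\<in>F. (LINT y|lborel. norm (fcoef w m y) ^ 2)) \<le> c\<^sup>2 / (2 * l)"
proof -
  have "(\<Sum>m\<in>F. (LINT y|lborel. norm (fcoef w m y) ^ 2)) = (LINT y|lborel. (\<Sum>m\<in>F. norm (fcoef w m y) ^ 2))"
    using fcoef_square_integrable[OF w] by simp
  also have "\<dots> \<le> (LINT y|lborel. slice 2 w y / (2 * l))"
    by (rule integral_mono) (use fcoef_square_integrable[OF w] bessel_slice[OF w F] tameD[OF w] in auto)
  also have "\<dots> \<le> c\<^sup>2 / (2 * l)" using tameD[OF w] l_pos by (simp add: divide_right_mono)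
  finally show ?thesis .
qed

text \<open>\<open>fourier\<close> integrates in x first, so the inner integral is a Fourier
  coefficient and the outer one a transform in y.\<close>

lemma fourier_eq_ft: "fourier l w m = ft (fcoef w m)"
proof
  fix \<xi>
  have e: "exp (- \<i> * of_real (omega l * of_int m * x) - \<i> * of_real (\<xi> * y)) = emode (- m) x * exp (- (\<i> * of_real (\<xi> * y)))" for x y
    unfolding emode_def exp_add[symmetric] by (rule arg_cong[where f=exp]) (simp add: algebra_simps)
  have i: "(LINT x:{-l..l}|lborel. w x y * (emode (- m) x * E)) = (LINT x:{-l..l}|lborel. w x y * emode (- m) x) * E" for y E
    using set_integral_mult_left[of _ _ "\<lambda>x. w x y * emode (- m) x" E] by (simp only: mult.assoc)
  show "fourier l w m \<xi> = ft (fcoef w m) \<xi>"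
    unfolding fourier_def e i ft_def fcoef_def by (simp only: mult.assoc integral_mult_right_zero)
qed

lemma fcoef_add:
  assumes "tame c w" "tame d v"
  shows "fcoef (\<lambda>x y. w x y + v x y) m y = fcoef w m y + fcoef v m y"
  unfolding fcoef_def using tame_slice(2)[OF assms(1), of y "-m"] tame_slice(2)[OF assms(2), of y "-m"]
  by (simp add: distrib_right set_integral_add add_divide_distrib)

lemma fcoef_cmult: "fcoef (\<lambda>x y. k * w x y) m y = k * fcoef w m y"
  unfolding fcoef_def by (simp add: mult.assoc)

text \<open>Multiplication by u couples mode n to mode m through \<open>fcoef u (m - n)\<close>; a
  mode couples to itself through \<open>fcoef u 0\<close>, the mean of u in x.\<close>

lemma fcoef_mode_mult: "fcoef (\<lambda>x y. u x y * (emode n x * p y)) m y = p y * fcoef u (m - n) y"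
proof -
  have "u x y * (emode n x * p y) * emode (- m) x = p y * (u x y * emode (- (m - n)) x)" for x
    using emode_add[of n "-m" x] by (simp add: algebra_simps)
  then show ?thesis unfolding fcoef_def by (simp only: set_integral_mult_right) (simp add: algebra_simps)
qed

end

subsection \<open>The Green operator\<close>

text \<open>The nonnegative and the negative members of F each inject into the naturals by n -> |n|
  - N, whence the factor 2. The subtraction is exact because N <= |n|.\<close>

lemma sum_inverse_squares_int_le:
  assumes "finite F" "\<And>n. n \<in> F \<Longrightarrow> int N \<le> \<bar>n\<bar>"
  shows "(\<Sum>n\<in>F. 1 / (real_of_int n)\<^sup>2) \<le> 2 * (\<Sum>k. 1 / (real (k + N))\<^sup>2)"
proof -
  have sm: "summable (\<lambda>k. 1 / (real (k + N))\<^sup>2)"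
    using inverse_power_summable[of 2, where 'a=real] summable_iff_shift[of "\<lambda>k. 1 / (real k)\<^sup>2" N]
    by (simp add: inverse_eq_divide)
  have le: "(\<Sum>n\<in>G. 1 / (real_of_int n)\<^sup>2) \<le> (\<Sum>k. 1 / (real (k + N))\<^sup>2)"
    if G: "G \<subseteq> F" "inj_on (\<lambda>n. nat \<bar>n\<bar> - N) G" for G
  proof -
    have "(\<Sum>n\<in>G. 1 / (real_of_int n)\<^sup>2) = (\<Sum>n\<in>G. 1 / (real ((nat \<bar>n\<bar> - N) + N))\<^sup>2)"
    proof (rule sum.cong)
      fix n assume "n \<in> G"
      then have "int N \<le> \<bar>n\<bar>" using G assms(2) by auto
      then have "real ((nat \<bar>n\<bar> - N) + N) = \<bar>real_of_int n\<bar>" by (simp add: le_nat_iff)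
      then show "1 / (real_of_int n)\<^sup>2 = 1 / (real ((nat \<bar>n\<bar> - N) + N))\<^sup>2" by simp
    qed simp
    also have "\<dots> = (\<Sum>k\<in>(\<lambda>n. nat \<bar>n\<bar> - N) ` G. 1 / (real (k + N))\<^sup>2)"
      by (subst sum.reindex[OF G(2)]) simp
    also have "\<dots> \<le> (\<Sum>k. 1 / (real (k + N))\<^sup>2)"
      by (rule sum_le_suminf[OF sm]) (use G assms(1) in \<open>auto intro: finite_subset\<close>)
    finally show ?thesis .
  qed
  have "(\<Sum>n\<in>F. 1 / (real_of_int n)\<^sup>2) = (\<Sum>n\<in>F \<inter> {0..}. 1 / (real_of_int n)\<^sup>2) + (\<Sum>n\<in>F - {0..}. 1 / (real_of_int n)\<^sup>2)"
    using assms(1) by (rule sum.Int_Diff)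
  also have "\<dots> \<le> (\<Sum>k. 1 / (real (k + N))\<^sup>2) + (\<Sum>k. 1 / (real (k + N))\<^sup>2)"
  proof (intro add_mono le)
    show "inj_on (\<lambda>n. nat \<bar>n\<bar> - N) (F \<inter> {0..})"
    proof (rule inj_onI)
      fix m n assume *: "m \<in> F \<inter> {0..}" "n \<in> F \<inter> {0..}" "nat \<bar>m\<bar> - N = nat \<bar>n\<bar> - N"
      have "int N \<le> \<bar>m\<bar>" "int N \<le> \<bar>n\<bar>" by (rule assms(2); use * in simp)+
      then show "m = n" using * by auto
    qed
    show "inj_on (\<lambda>n. nat \<bar>n\<bar> - N) (F - {0..})"
    proof (rule inj_onI)
      fix m n assume *: "m \<in> F - {0..}" "n \<in> F - {0..}" "nat \<bar>m\<bar> - N = nat \<bar>n\<bar> - N"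
      have "int N \<le> \<bar>m\<bar>" "int N \<le> \<bar>n\<bar>" by (rule assms(2); use * in simp)+
      then show "m = n" using * by auto
    qed
  qed auto
  finally show ?thesis by simp
qed

text \<open>A member n = 0 of F contributes 1 / 0 = 0.\<close>

lemma sum_inverse_squares_int_bounded:
  obtains K where "0 < K" "\<And>F. finite F \<Longrightarrow> (\<Sum>n\<in>F. 1 / (real_of_int n)\<^sup>2) \<le> K"
proof
  show "0 < \<bar>2 * (\<Sum>k. 1 / (real (k + 0))\<^sup>2)\<bar> + 1" by linarith
  show "(\<Sum>n\<in>F. 1 / (real_of_int n)\<^sup>2) \<le> \<bar>2 * (\<Sum>k. 1 / (real (k + 0))\<^sup>2)\<bar> + 1" if "finite F" for F
    using sum_inverse_squares_int_le[OF that, of 0] by simp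
qed

lemma sum_inverse_squares_int_tail:
  assumes "0 < e"
  obtains N where "0 < N" "\<And>F. finite F \<Longrightarrow> (\<And>n. n \<in> F \<Longrightarrow> int N \<le> \<bar>n\<bar>) \<Longrightarrow> (\<Sum>n\<in>F. 1 / (real_of_int n)\<^sup>2) \<le> e"
proof -
  have "summable (\<lambda>k. 1 / (real k)\<^sup>2)"
    using inverse_power_summable[of 2, where 'a=real] by (simp add: inverse_eq_divide)
  from suminf_exist_split[OF _ this, of "e / 2"] assms
  obtain N where N: "\<And>n. n \<ge> N \<Longrightarrow> norm (\<Sum>i. 1 / (real (i + n))\<^sup>2) < e / 2" by auto
  show ?thesis
  proof
    show "0 < Suc N" by simp
    show "(\<Sum>n\<in>F. 1 / (real_of_int n)\<^sup>2) \<le> e" if "finite F" "\<And>n. n \<in> F \<Longrightarrow> int (Suc N) \<le> \<bar>n\<bar>" for F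
      using sum_inverse_squares_int_le[OF that] N[of "Suc N"] by auto
  qed
qed

text \<open>Uniform in the shift: if j is the integer nearest to s, then |m + s| >= |m + j| / 2 for
  all m other than - j, and the term m = - j is at most 4 by the distance hypothesis. That distance
  is the one excluded by \<open>resonant\<close>.\<close>

lemma sum_inverse_squares_shift_bounded:
  obtains K where "0 < K"
    "\<And>F s. finite F \<Longrightarrow> (\<And>m. m \<in> F \<Longrightarrow> 1 / 2 \<le> \<bar>of_int m + s\<bar>) \<Longrightarrow> (\<Sum>m\<in>F. 1 / (of_int m + s :: real)\<^sup>2) \<le> K"
proof -
  obtain K where K: "0 < K" "\<And>F. finite F \<Longrightarrow> (\<Sum>n\<in>F. 1 / (real_of_int n)\<^sup>2) \<le> K"
    using sum_inverse_squares_int_bounded by blast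
  show ?thesis
  proof
    show "0 < 4 * K + 4" using K by simp
    fix F :: "int set" and s :: real
    assume F: "finite F" "\<And>m. m \<in> F \<Longrightarrow> 1 / 2 \<le> \<bar>of_int m + s\<bar>"
    define j where "j = round s"
    have j: "\<bar>s - of_int j\<bar> \<le> 1 / 2"
      unfolding j_def using of_int_round_abs_le[of s] by (simp add: abs_minus_commute)
    have le: "1 / (of_int m + s)\<^sup>2 \<le> 4 * (1 / (real_of_int (m + j))\<^sup>2) + (if m = - j then 4 else 0)" if m: "m \<in> F" for m
    proof (cases "m = - j")
      case True
      have "(1/2)\<^sup>2 \<le> \<bar>of_int m + s\<bar>\<^sup>2" using F(2)[OF m] by (intro power_mono) auto
      then have "1 / 4 \<le> (of_int m + s)\<^sup>2" by (simp add: power2_eq_square)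
      moreover have "0 < (of_int m + s)\<^sup>2" using F(2)[OF m] by auto
      ultimately show ?thesis using True by (simp add: divide_simps)
    next
      case False
      then have "1 \<le> \<bar>real_of_int (m + j)\<bar>" by linarith
      then have "\<bar>real_of_int (m + j)\<bar> / 2 \<le> \<bar>of_int m + s\<bar>"
        using j abs_triangle_ineq4[of "of_int m + s" "s - of_int j"] by (simp add: field_simps)
      then have "(\<bar>real_of_int (m + j)\<bar> / 2)\<^sup>2 \<le> \<bar>of_int m + s\<bar>\<^sup>2" by (intro power_mono) auto
      then have "(real_of_int (m + j))\<^sup>2 / 4 \<le> (of_int m + s)\<^sup>2" by (simp add: power_divide)
      moreover have "0 < (real_of_int (m + j))\<^sup>2" using False by simp
      ultimately have "1 / (of_int m + s)\<^sup>2 \<le> 1 / ((real_of_int (m + j))\<^sup>2 / 4)"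
        by (intro divide_left_mono mult_pos_pos) auto
      then show ?thesis using False by simp
    qed
    have "(\<Sum>m\<in>F. 1 / (of_int m + s)\<^sup>2) \<le> (\<Sum>m\<in>F. 4 * (1 / (real_of_int (m + j))\<^sup>2) + (if m = - j then 4 else 0))"
      by (rule sum_mono) (rule le)
    also have "\<dots> = 4 * (\<Sum>n\<in>(\<lambda>m. m + j) ` F. 1 / (real_of_int n)\<^sup>2) + (\<Sum>m\<in>F. if m = - j then 4 else 0)"
      by (subst sum.reindex) (auto simp: sum.distrib sum_distrib_left inj_on_def)
    also have "\<dots> \<le> 4 * K + 4"
      using K(2)[of "(\<lambda>m. m + j) ` F"] F(1) by (intro add_mono) (auto simp: sum.delta)
    finally show "(\<Sum>m\<in>F. 1 / (of_int m + s)\<^sup>2) \<le> 4 * K + 4" .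
  qed
qed

section \<open>Sizes of the mode symbols, the resonant index, and the Green operator\<close>

context strip_setup
begin

text \<open>The symbol at frequency 0. Since \<open>P_symbol l z m \<xi>\<close> equals
  \<open>bsym z m + \<i> * of_real \<xi>\<close>, this is the coefficient b in the first-order
  equation of mode m.\<close>

definition bsym :: "complex \<Rightarrow> int \<Rightarrow> complex" where
  "bsym z m = P_symbol l z m 0"

text \<open>For nonzero Re b this is the squared L2 norm of \<open>kern b\<close> at b =
  \<open>bsym z m\<close>, by \<open>kern_integrable_norm_power\<close> with exponent 2.\<close>

definition mode_weight :: "complex \<Rightarrow> int \<Rightarrow> real" where
  "mode_weight z m = 1 / (2 * \<bar>Re (bsym z m)\<bar>)"

text \<open>The resonant index: the only nonzero \<open>m\<close> for which \<open>Re (bsym z m)\<close> may be arbitrarily small.\<close>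

definition resonant :: "complex \<Rightarrow> int set" where
  "resonant z = {m. m \<noteq> 0 \<and> \<bar>of_int m + 2 * Re z / omega l\<bar> < 1 / 2}"

lemma bsym_eq: "bsym z m = of_real (omega l * of_int m) * (of_real (omega l * of_int m) + 2 * z)"
  by (simp add: bsym_def P_symbol_def power2_eq_square algebra_simps)

lemma Re_bsym: "Re (bsym z m) = (omega l)\<^sup>2 * of_int m * (of_int m + 2 * Re z / omega l)"
  using omega_pos by (simp add: bsym_eq power2_eq_square field_simps)

lemma Re_bsym_nonzero:
  assumes "z \<in> C_omega l" "m \<noteq> 0"
  shows "Re (bsym z m) \<noteq> 0"
proof
  assume "Re (bsym z m) = 0"
  then have "of_int m + 2 * Re z / omega l = 0"
    using assms(2) omega_pos by (simp add: Re_bsym)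
  then have "2 * Re z = omega l * of_int (- m)"
    using omega_pos by (simp add: field_simps)
  moreover have "\<forall>k::int. k \<noteq> 0 \<longrightarrow> 2 * Re z \<noteq> omega l * of_int k"
    using assms(1) by (simp add: C_omega_def)
  ultimately show False using assms(2) by (metis neg_equal_0_iff_equal)
qed

lemma resonant_subset_singleton: "\<exists>k. resonant z \<subseteq> {k}"
proof -
  have "m = n" if "m \<in> resonant z" "n \<in> resonant z" for m n
  proof -
    have "\<bar>of_int m + 2 * Re z / omega l\<bar> < 1 / 2" "\<bar>of_int n + 2 * Re z / omega l\<bar> < 1 / 2"
      using that by (simp_all add: resonant_def)
    then have "\<bar>real_of_int m - of_int n\<bar> < 1" by linarith
    then show ?thesis by linarith
  qed
  then show ?thesis by blast
qed

lemma finite_resonant [simp]: "finite (resonant z)"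
  using resonant_subset_singleton[of z] finite_subset by blast

lemma card_resonant_le: "card (resonant z) \<le> 1"
  using resonant_subset_singleton[of z] by (metis card.empty card.insert card_mono empty_iff finite.intros One_nat_def)

lemma mode_weight_nonneg: "0 \<le> mode_weight z m"
  by (simp add: mode_weight_def)

text \<open>The weight is a product of the inverse distances of m from 0 and from the resonant point
  - 2 Re z / omega. A weighted arithmetic-geometric inequality separates the two, and t decides
  which of the two inverse squares is penalised.\<close>

lemma mode_weight_le:
  assumes "m \<noteq> 0" "m \<notin> resonant z" "0 < t"
  shows "mode_weight z m \<le> 1 / (4 * (omega l)\<^sup>2) * (t * (1 / (of_int m)\<^sup>2) + 1 / t * (1 / (of_int m + 2 * Re z / omega l)\<^sup>2))"
proof -
  define p where "p = 1 / \<bar>real_of_int m\<bar>"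
  define q where "q = 1 / \<bar>of_int m + 2 * Re z / omega l\<bar>"
  have "0 \<le> (t * p - q)\<^sup>2 / t" using assms by simp
  also have "\<dots> = t * p\<^sup>2 + q\<^sup>2 / t - 2 * (p * q)"
    using assms by (simp add: power2_eq_square field_simps)
  finally have "2 * (p * q) \<le> t * p\<^sup>2 + q\<^sup>2 / t" by simp
  then have "1 / (4 * (omega l)\<^sup>2) * (2 * (p * q)) \<le> 1 / (4 * (omega l)\<^sup>2) * (t * p\<^sup>2 + q\<^sup>2 / t)"
    by (intro mult_left_mono) auto
  moreover have "mode_weight z m = 1 / (4 * (omega l)\<^sup>2) * (2 * (p * q))"
    by (simp add: mode_weight_def Re_bsym p_def q_def abs_mult)
  moreover have "t * p\<^sup>2 + q\<^sup>2 / t = t * (1 / (of_int m)\<^sup>2) + 1 / t * (1 / (of_int m + 2 * Re z / omega l)\<^sup>2)"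
    by (simp add: p_def q_def power_divide)
  ultimately show ?thesis by (simp only:)
qed

lemma mode_weight_sum_le:
  assumes "finite F" "\<And>m. m \<in> F \<Longrightarrow> m \<noteq> 0 \<and> m \<notin> resonant z" "0 < t"
    and P: "(\<Sum>m\<in>F. 1 / (real_of_int m)\<^sup>2) \<le> P"
    and Q: "(\<Sum>m\<in>F. 1 / (of_int m + 2 * Re z / omega l)\<^sup>2) \<le> Q"
  shows "(\<Sum>m\<in>F. mode_weight z m) \<le> 1 / (4 * (omega l)\<^sup>2) * (t * P + 1 / t * Q)"
proof -
  have "(\<Sum>m\<in>F. mode_weight z m) \<le> (\<Sum>m\<in>F. 1 / (4 * (omega l)\<^sup>2) * (t * (1 / (of_int m)\<^sup>2) + 1 / t * (1 / (of_int m + 2 * Re z / omega l)\<^sup>2)))"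
    using assms by (intro sum_mono mode_weight_le) auto
  also have "\<dots> = 1 / (4 * (omega l)\<^sup>2) * (t * (\<Sum>m\<in>F. 1 / (real_of_int m)\<^sup>2) + 1 / t * (\<Sum>m\<in>F. 1 / (of_int m + 2 * Re z / omega l)\<^sup>2))"
    by (simp only: sum_distrib_left sum.distrib distrib_left)
  also have "\<dots> \<le> 1 / (4 * (omega l)\<^sup>2) * (t * P + 1 / t * Q)"
    using assms by (intro mult_left_mono add_mono) auto
  finally show ?thesis .
qed

lemma mode_weight_bounded:
  obtains K where "0 < K"
    "\<And>z F. finite F \<Longrightarrow> (\<And>m. m \<in> F \<Longrightarrow> m \<noteq> 0 \<and> m \<notin> resonant z) \<Longrightarrow> (\<Sum>m\<in>F. mode_weight z m) \<le> K"
proof -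
  obtain P where P: "0 < P" "\<And>F. finite F \<Longrightarrow> (\<Sum>n\<in>F. 1 / (real_of_int n)\<^sup>2) \<le> P"
    using sum_inverse_squares_int_bounded by blast
  obtain Q where Q: "0 < Q"
    "\<And>F s. finite F \<Longrightarrow> (\<And>m. m \<in> F \<Longrightarrow> 1 / 2 \<le> \<bar>of_int m + s\<bar>) \<Longrightarrow> (\<Sum>m\<in>F. 1 / (of_int m + s :: real)\<^sup>2) \<le> Q"
    using sum_inverse_squares_shift_bounded by blast
  show ?thesis
  proof
    show "0 < 1 / (4 * (omega l)\<^sup>2) * (1 * P + 1 / 1 * Q)" using P Q omega_pos by simp
    show "(\<Sum>m\<in>F. mode_weight z m) \<le> 1 / (4 * (omega l)\<^sup>2) * (1 * P + 1 / 1 * Q)"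
      if F: "finite F" "\<And>m. m \<in> F \<Longrightarrow> m \<noteq> 0 \<and> m \<notin> resonant z" for z F
      by (rule mode_weight_sum_le[OF F _ P(2) Q(2)]) (use F in \<open>auto simp: resonant_def not_less\<close>)
  qed
qed

text \<open>Only the inverse squares of m have tails that are small uniformly in z; the shifted
  inverse squares are merely bounded. So t is first taken large enough to suppress the shifted sum,
  and N is chosen afterwards.\<close>

lemma mode_weight_tail:
  assumes "0 < e"
  obtains N where "0 < N"
    "\<And>z F. finite F \<Longrightarrow> (\<And>m. m \<in> F \<Longrightarrow> int N \<le> \<bar>m\<bar> \<and> m \<notin> resonant z) \<Longrightarrow> (\<Sum>m\<in>F. mode_weight z m) \<le> e"
proof -
  obtain Q where Q: "0 < Q"
    "\<And>F s. finite F \<Longrightarrow> (\<And>m. m \<in> F \<Longrightarrow> 1 / 2 \<le> \<bar>of_int m + s\<bar>) \<Longrightarrow> (\<Sum>m\<in>F. 1 / (of_int m + s :: real)\<^sup>2) \<le> Q"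
    using sum_inverse_squares_shift_bounded by blast
  define k where "k = 1 / (4 * (omega l)\<^sup>2)"
  \<comment> \<open>Makes k Q / t equal to e / 2; the tail bound e / (2 k t) below accounts for the
    other half.\<close>
  define t where "t = 2 * k * Q / e"
  have k: "0 < k" using omega_pos by (simp add: k_def)
  have t: "0 < t" using k Q assms by (simp add: t_def)
  have "0 < e / (2 * k * t)" using k t assms by simp
  from sum_inverse_squares_int_tail[OF this] obtain N where N: "0 < N"
    "\<And>F. finite F \<Longrightarrow> (\<And>n. n \<in> F \<Longrightarrow> int N \<le> \<bar>n\<bar>) \<Longrightarrow> (\<Sum>n\<in>F. 1 / (real_of_int n)\<^sup>2) \<le> e / (2 * k * t)"
    by metis
  show ?thesis
  proof
    show "0 < N" by fact
    fix z F assume F: "finite F" "\<And>m. m \<in> F \<Longrightarrow> int N \<le> \<bar>m\<bar> \<and> m \<notin> resonant z"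
    then have F0: "\<And>m. m \<in> F \<Longrightarrow> m \<noteq> 0 \<and> m \<notin> resonant z" using N(1) by fastforce
    have "(\<Sum>m\<in>F. mode_weight z m) \<le> k * (t * (e / (2 * k * t)) + 1 / t * Q)"
      unfolding k_def by (rule mode_weight_sum_le[OF F(1) F0 t N(2)[OF F(1), unfolded k_def] Q(2)])
        (use F F0 in \<open>auto simp: resonant_def not_less\<close>)
    also have "\<dots> = e" using k t assms Q by (simp add: t_def field_simps)
    finally show "(\<Sum>m\<in>F. mode_weight z m) \<le> e" .
  qed
qed

lemma mode_weight_summable: "mode_weight z summable_on (- {0})"
proof -
  obtain K where K: "\<And>F. finite F \<Longrightarrow> (\<And>m. m \<in> F \<Longrightarrow> m \<noteq> 0 \<and> m \<notin> resonant z) \<Longrightarrow> (\<Sum>m\<in>F. mode_weight z m) \<le> K"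
    using mode_weight_bounded by metis
  show ?thesis
  proof (rule nonneg_bounded_partial_sums_imp_summable_on)
    show "\<forall>\<^sub>F F in finite_subsets_at_top (- {0}). sum (mode_weight z) F \<le> (\<Sum>m\<in>resonant z. mode_weight z m) + K"
    proof (rule eventually_finite_subsets_at_top_weakI)
      fix F :: "int set" assume F: "finite F" "F \<subseteq> - {0}"
      have "sum (mode_weight z) F = sum (mode_weight z) (F \<inter> resonant z) + sum (mode_weight z) (F - resonant z)"
        using F(1) by (rule sum.Int_Diff)
      also have "\<dots> \<le> (\<Sum>m\<in>resonant z. mode_weight z m) + K"
        using F mode_weight_nonneg by (intro add_mono sum_mono2 K) auto
      finally show "sum (mode_weight z) F \<le> (\<Sum>m\<in>resonant z. mode_weight z m) + K" .
    qed
  qed (rule mode_weight_nonneg)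
qed

text \<open>T restricted to the modes in A. The index set is a parameter because the proof splits
  \<open>- {0}\<close> into a finite and a contractive part, depending on z.\<close>

definition green_op :: "complex \<Rightarrow> int set \<Rightarrow> (real \<Rightarrow> real \<Rightarrow> complex) \<Rightarrow> real \<Rightarrow> real \<Rightarrow> complex" where
  "green_op z A w x y = (\<Sum>\<^sub>\<infinity>m\<in>A. emode m x * conv (bsym z m) (fcoef w m) y)"

lemma mode_bound:
  assumes "z \<in> C_omega l" "m \<noteq> 0" "tame c w" "0 < r"
  shows "norm (emode m x * conv (bsym z m) (fcoef w m) y) \<le> (r * mode_weight z m + (LINT t|lborel. norm (fcoef w m t) ^ 2) / r) / 2"
  using norm_conv_le_square[OF fcoef_integrable(1)[OF assms(3)] fcoef_square_integrable[OF assms(3)] Re_bsym_nonzero[OF assms(1,2)] assms(4)]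
  by (simp add: norm_mult mode_weight_def)

lemma mode_bound_1:
  assumes "z \<in> C_omega l" "A \<subseteq> - {0}" "tame c w" "m \<in> A"
  shows "norm (emode m x * conv (bsym z m) (fcoef w m) y) \<le> (mode_weight z m + (LINT t|lborel. norm (fcoef w m t) ^ 2)) / 2"
  using mode_bound[OF assms(1) _ assms(3), of m 1 x y] assms(2,4) by auto

text \<open>The majorant of \<open>mode_bound_1\<close>, which does not involve x and y: one half is
  summable by the mode weights, the other by Bessel's inequality.\<close>

lemma mode_majorant_summable:
  assumes "A \<subseteq> - {0}" "tame c w"
  shows "(\<lambda>m. (mode_weight z m + (LINT t|lborel. norm (fcoef w m t) ^ 2)) / 2) summable_on A"
proof -
  have "(\<lambda>m. LINT t|lborel. norm (fcoef w m t) ^ 2) summable_on A"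
    by (rule nonneg_bounded_partial_sums_imp_summable_on[where C="c\<^sup>2 / (2 * l)"])
      (auto intro!: eventually_finite_subsets_at_top_weakI bessel assms)
  then have "(\<lambda>m. (1/2) * (mode_weight z m + (LINT t|lborel. norm (fcoef w m t) ^ 2))) summable_on A"
    by (intro summable_on_cmult_right summable_on_add summable_on_subset_banach[OF mode_weight_summable assms(1)])
  then show ?thesis by simp
qed

lemma green_op_uniform_limit:
  assumes "z \<in> C_omega l" "A \<subseteq> - {0}" "tame c w"
  shows "uniform_limit UNIV (\<lambda>X (x, y). \<Sum>m\<in>X. emode m x * conv (bsym z m) (fcoef w m) y)
    (\<lambda>(x, y). green_op z A w x y) (finite_subsets_at_top A)"
proof -
  have "uniform_limit UNIV (\<lambda>X p. \<Sum>m\<in>X. emode m (fst p) * conv (bsym z m) (fcoef w m) (snd p))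
    (\<lambda>p. \<Sum>\<^sub>\<infinity>m\<in>A. emode m (fst p) * conv (bsym z m) (fcoef w m) (snd p)) (finite_subsets_at_top A)"
    by (rule Weierstrass_m_test_general[OF mode_bound_1[OF assms] mode_majorant_summable[OF assms(2,3), of z]])
  then show ?thesis by (simp add: green_op_def case_prod_beta')
qed

lemma green_op_summable:
  assumes "z \<in> C_omega l" "A \<subseteq> - {0}" "tame c w"
  shows "(\<lambda>m. emode m x * conv (bsym z m) (fcoef w m) y) summable_on A"
proof -
  have "(\<lambda>m. norm (emode m x * conv (bsym z m) (fcoef w m) y)) summable_on A"
    by (rule Infinite_Sum.abs_summable_on_comparison_test'[OF mode_majorant_summable[OF assms(2,3), of z] mode_bound_1[OF assms]])
  then show ?thesis by (rule abs_summable_summable)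
qed

text \<open>\<open>has_pd_uniform_limit\<close> is about sequences, so the net of finite subsets is
  replaced by symmetric truncations.\<close>

lemma green_op_sequence:
  assumes "z \<in> C_omega l" "A \<subseteq> - {0}" "tame c w"
  shows "uniform_limit UNIV (\<lambda>n (x, y). \<Sum>m\<in>A \<inter> {- int n..int n}. emode m x * conv (bsym z m) (fcoef w m) y)
    (\<lambda>(x, y). green_op z A w x y) sequentially"
proof -
  have "filterlim (\<lambda>n. A \<inter> {- int n..int n}) (finite_subsets_at_top A) sequentially"
    unfolding filterlim_finite_subsets_at_top
  proof (intro allI impI)
    fix X assume X: "finite X \<and> X \<subseteq> A"
    \<comment> \<open>Inserting 0 keeps the maximum meaningful for empty X.\<close>
    define N where "N = nat (Max (insert 0 (abs ` X)))"
    have "\<bar>m\<bar> \<le> int N" if "m \<in> X" for m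
      using X that by (auto simp: N_def le_nat_iff Max_ge_iff intro: Max_ge)
    then have "finite (A \<inter> {- int n..int n}) \<and> X \<subseteq> A \<inter> {- int n..int n} \<and> A \<inter> {- int n..int n} \<subseteq> A" if "n \<ge> N" for n
      using X that by fastforce
    then show "\<forall>\<^sub>F n in sequentially. finite (A \<inter> {- int n..int n}) \<and> X \<subseteq> A \<inter> {- int n..int n} \<and> A \<inter> {- int n..int n} \<subseteq> A"
      unfolding eventually_sequentially by blast
  qed
  from filterlim_compose[OF green_op_uniform_limit[OF assms] this] show ?thesis .
qed

lemma green_op_finite: "finite A \<Longrightarrow> green_op z A w x y = (\<Sum>m\<in>A. emode m x * conv (bsym z m) (fcoef w m) y)"
  by (simp add: green_op_def)

lemma green_op_Un:
  assumes "z \<in> C_omega l" "A \<subseteq> - {0}" "B \<subseteq> - {0}" "A \<inter> B = {}" "tame c w"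
  shows "green_op z (A \<union> B) w x y = green_op z A w x y + green_op z B w x y"
  unfolding green_op_def by (rule infsum_Un_disjoint) (use assms green_op_summable in auto)

lemma green_op_periodic: "x_periodic l (green_op z A w)"
  by (simp add: x_periodic_def green_op_def emode_periodic)

lemma green_op_continuous:
  assumes "z \<in> C_omega l" "A \<subseteq> - {0}" "tame c w"
  shows "continuous_on UNIV (\<lambda>(x, y). green_op z A w x y)"
proof (rule uniform_limit_theorem[OF _ green_op_sequence[OF assms]])
  have "continuous_on UNIV (\<lambda>p. \<Sum>m\<in>A \<inter> {- int n..int n}. emode m (fst p) * conv (bsym z m) (fcoef w m) (snd p))" for n
    by (intro continuous_intros continuous_on_compose2[OF continuous_on_conv[OF fcoef_integrable(1)[OF assms(3)]]] Re_bsym_nonzero assms)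
      (use assms in auto)
  then show "\<forall>\<^sub>F n in sequentially. continuous_on UNIV (\<lambda>(x, y). \<Sum>m\<in>A \<inter> {- int n..int n}. emode m x * conv (bsym z m) (fcoef w m) y)"
    by (simp add: case_prod_beta')
qed simp

lemma green_op_norm_le_mode_weight:
  assumes "z \<in> C_omega l" "A \<subseteq> - {0}" "tame c w" "0 < s"
    and mode_weight: "\<And>F. finite F \<Longrightarrow> F \<subseteq> A \<Longrightarrow> (\<Sum>m\<in>F. mode_weight z m) \<le> s"
  shows "norm (green_op z A w x y) \<le> sqrt (s / (2 * l)) * c"
proof -
  have c: "0 < c" using assms(3) by (rule tameD)
  define q where "q = sqrt (s / (2 * l))"
  have q: "0 < q" "q\<^sup>2 = s / (2 * l)" using assms(4) l_pos by (auto simp: q_def)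
  \<comment> \<open>The optimal weight in \<open>mode_bound\<close>: it makes r s and c^2 / (2 l r)
    both equal to q c.\<close>
  define r where "r = c * q / s"
  have r: "0 < r" using c q assms(4) by (simp add: r_def)
  have fin: "norm (\<Sum>m\<in>F. emode m x * conv (bsym z m) (fcoef w m) y) \<le> q * c" if F: "finite F" "F \<subseteq> A" for F
  proof -
    have "norm (\<Sum>m\<in>F. emode m x * conv (bsym z m) (fcoef w m) y)
        \<le> (\<Sum>m\<in>F. (r * mode_weight z m + (LINT t|lborel. norm (fcoef w m t) ^ 2) / r) / 2)"
    proof (rule sum_norm_le)
      fix m assume "m \<in> F"
      then have "m \<noteq> 0" using F assms(2) by auto
      then show "norm (emode m x * conv (bsym z m) (fcoef w m) y) \<le> (r * mode_weight z m + (LINT t|lborel. norm (fcoef w m t) ^ 2) / r) / 2"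
        by (rule mode_bound[OF assms(1) _ assms(3) r])
    qed
    also have "\<dots> = (r * (\<Sum>m\<in>F. mode_weight z m) + (\<Sum>m\<in>F. (LINT t|lborel. norm (fcoef w m t) ^ 2)) / r) / 2"
      by (simp only: sum_divide_distrib[symmetric] sum_distrib_left[symmetric] sum.distrib)
    also have "\<dots> \<le> (r * s + c\<^sup>2 / (2 * l) / r) / 2"
      using r mode_weight[OF F] bessel[OF assms(3) F(1)] by (intro divide_right_mono add_mono mult_left_mono) auto
    also have "c\<^sup>2 / (2 * l) / r = q * c"
    proof -
      have "c\<^sup>2 / (2 * l) = c\<^sup>2 * q\<^sup>2 / s" using q(2) assms(4) by simp
      then have "c\<^sup>2 / (2 * l) / r = (c\<^sup>2 * q\<^sup>2 / s) / (c * q / s)" by (simp add: r_def)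
      also have "\<dots> = q * c" using q(1) c assms(4) by (simp add: power2_eq_square)
      finally show ?thesis .
    qed
    also have "r * s = q * c" using assms(4) by (simp add: r_def)
    finally show ?thesis by (simp add: mult.commute)
  qed
  have "((\<lambda>F. \<Sum>m\<in>F. emode m x * conv (bsym z m) (fcoef w m) y) \<longlongrightarrow> green_op z A w x y) (finite_subsets_at_top A)"
    using has_sum_infsum[OF green_op_summable[OF assms(1-3)]] by (simp add: has_sum_def green_op_def)
  from tendsto_norm[OF this] show ?thesis
    unfolding q_def[symmetric]
    by (rule tendsto_upperbound) (auto intro!: eventually_finite_subsets_at_top_weakI fin)
qed

lemma green_op_norm_le_card:
  assumes "finite A" "tame c w"
  shows "norm (green_op z A w x y) \<le> card A * (1 / (2 * l)) * c"
proof -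
  have "norm (green_op z A w x y) \<le> (\<Sum>m\<in>A. c / (2 * l))"
    unfolding green_op_finite[OF assms(1)]
    by (rule sum_norm_le)
      (use order_trans[OF norm_conv_le[OF fcoef_integrable(1)[OF assms(2)]] fcoef_integrable(2)[OF assms(2)]] in \<open>auto simp: norm_mult\<close>)
  then show ?thesis by simp
qed

lemma green_op_bounded:
  obtains \<tau> where "0 < \<tau>"
    "\<And>z A c w x y. z \<in> C_omega l \<Longrightarrow> A \<subseteq> - {0} \<Longrightarrow> tame c w \<Longrightarrow> norm (green_op z A w x y) \<le> \<tau> * c"
proof -
  obtain K where K: "0 < K"
    "\<And>z F. finite F \<Longrightarrow> (\<And>m. m \<in> F \<Longrightarrow> m \<noteq> 0 \<and> m \<notin> resonant z) \<Longrightarrow> (\<Sum>m\<in>F. mode_weight z m) \<le> K"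
    using mode_weight_bounded by metis
  show ?thesis
  proof
    show "0 < 1 / (2 * l) + sqrt (K / (2 * l))" using K l_pos by (simp add: add_pos_pos)
    fix z and A :: "int set" and c :: real and w :: "real \<Rightarrow> real \<Rightarrow> complex" and x y
    assume z: "z \<in> C_omega l" and A: "A \<subseteq> - {0}" and w: "tame c w"
    have "green_op z ((A \<inter> resonant z) \<union> (A - resonant z)) w x y = green_op z (A \<inter> resonant z) w x y + green_op z (A - resonant z) w x y"
      by (rule green_op_Un[OF z _ _ _ w]) (use A in auto)
    also have "(A \<inter> resonant z) \<union> (A - resonant z) = A" by auto
    finally have eq: "green_op z A w x y = green_op z (A \<inter> resonant z) w x y + green_op z (A - resonant z) w x y" .
    have "norm (green_op z (A \<inter> resonant z) w x y) \<le> card (A \<inter> resonant z) * (1 / (2 * l)) * c"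
      by (rule green_op_norm_le_card[OF _ w]) simp
    also have "\<dots> \<le> 1 * (1 / (2 * l)) * c"
    proof -
      have "card (A \<inter> resonant z) \<le> 1" using card_mono[of "resonant z" "A \<inter> resonant z"] card_resonant_le[of z] by simp
      then show ?thesis using l_pos tameD(1)[OF w] by (intro mult_right_mono) auto
    qed
    finally have "norm (green_op z (A \<inter> resonant z) w x y) \<le> 1 / (2 * l) * c" by simp
    moreover have "norm (green_op z (A - resonant z) w x y) \<le> sqrt (K / (2 * l)) * c"
      by (rule green_op_norm_le_mode_weight[OF z _ w K(1) K(2)]) (use A in auto)
    ultimately show "norm (green_op z A w x y) \<le> (1 / (2 * l) + sqrt (K / (2 * l))) * c"
      unfolding eq by (intro order_trans[OF norm_triangle_ineq]) (simp add: distrib_right)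
  qed
qed

lemma green_op_add:
  assumes "z \<in> C_omega l" "A \<subseteq> - {0}" "tame c w" "tame d v"
  shows "green_op z A (\<lambda>x y. w x y + v x y) x y = green_op z A w x y + green_op z A v x y"
proof -
  have "conv (bsym z m) (fcoef (\<lambda>x y. w x y + v x y) m) y = conv (bsym z m) (fcoef w m) y + conv (bsym z m) (fcoef v m) y" for m
    using conv_add[OF fcoef_integrable(1)[OF assms(3)] fcoef_integrable(1)[OF assms(4)]] fcoef_add[OF assms(3,4)]
    by (simp add: conv_def)
  then show ?thesis
    unfolding green_op_def
    using infsum_add[OF green_op_summable[OF assms(1-3), of x y] green_op_summable[OF assms(1,2,4), of x y]]
    by (simp add: distrib_left)
qed

lemma green_op_cmult: "green_op z A (\<lambda>x y. k * w x y) x y = k * green_op z A w x y"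
proof -
  have "emode m x * conv (bsym z m) (fcoef (\<lambda>x y. k * w x y) m) y = k * (emode m x * conv (bsym z m) (fcoef w m) y)" for m
    using conv_cmult[of "bsym z m" k "fcoef w m"] by (simp add: fcoef_cmult[abs_def])
  then show ?thesis unfolding green_op_def by (simp only: infsum_cmult_right')
qed

lemma tame_borel: "tame c w \<Longrightarrow> (\<lambda>(x, y). w x y) \<in> borel_measurable borel"
  by (simp add: tame_def)

lemma slice_mono:
  assumes "tame c w" and v: "(\<lambda>(x, y). v x y) \<in> borel_measurable borel"
    and le: "\<And>x. norm (v x y) \<le> X * norm (w x y)" and "0 \<le> X"
  shows "slice p v y \<le> X ^ p * slice p w y"
proof -
  have i: "set_integrable lborel {-l..l} (\<lambda>x. X ^ p * norm (w x y) ^ p)"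
    using tame_slice(3)[OF assms(1)] by (rule set_integrable_mult_right)
  have "(LINT x|lborel. indicator {-l..l} x *\<^sub>R norm (v x y) ^ p) \<le> (LINT x|lborel. indicator {-l..l} x *\<^sub>R (X ^ p * norm (w x y) ^ p))"
  proof (rule integral_mono')
    show "integrable lborel (\<lambda>x. indicator {-l..l} x *\<^sub>R (X ^ p * norm (w x y) ^ p))"
      using i by (simp add: set_integrable_def)
    show "indicator {-l..l} x *\<^sub>R norm (v x y) ^ p \<le> indicator {-l..l} x *\<^sub>R (X ^ p * norm (w x y) ^ p)" for x
      using power_mono[OF le[of x] norm_ge_zero, of p] by (auto simp: indicator_def power_mult_distrib)
    show "0 \<le> indicator {-l..l} x *\<^sub>R (X ^ p * norm (w x y) ^ p)" for x
      using assms(4) by (simp add: indicator_def)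
  qed
  then have "slice p v y \<le> (LINT x:{-l..l}|lborel. X ^ p * norm (w x y) ^ p)"
    by (simp only: slice_def set_lebesgue_integral_def)
  also have "\<dots> = X ^ p * slice p w y"
    unfolding slice_def by (rule set_integral_mult_right)
  finally show ?thesis .
qed

lemma slice_measurable:
  assumes "(\<lambda>(x, y). v x y) \<in> borel_measurable borel"
  shows "slice p v \<in> borel_measurable borel"
proof -
  have "(\<lambda>(x, y). v x y) \<in> borel_measurable (borel \<Otimes>\<^sub>M borel)"
    using assms by (simp add: borel_prod)
  from measurable_compose[OF measurable_Pair[OF measurable_snd measurable_fst] this]
  have [measurable]: "(\<lambda>p. v (snd p) (fst p)) \<in> borel_measurable (borel \<Otimes>\<^sub>M borel)" by simp
  show ?thesis unfolding slice_def[abs_def] set_lebesgue_integral_def by measurable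
qed

text \<open>The powers \<open>c ^ p\<close> in \<open>tame\<close> make the constant homogeneous, so
  a factor with sup norm X multiplies it by X for both exponents at once.\<close>

lemma tame_mult:
  assumes w: "tame c w" and f: "(\<lambda>(x, y). f x y) \<in> borel_measurable borel" "x_periodic l f"
    "\<And>x y. norm (f x y) \<le> X" "0 < X"
  shows "tame (X * c) (w \<odot> f)"
  unfolding tame_def
proof (intro conjI ballI)
  show "0 < X * c" using tameD(1)[OF w] f by simp
  show "x_periodic l (w \<odot> f)" using tameD(2)[OF w] f by (simp add: x_periodic_def)
  have "(\<lambda>p. (\<lambda>(x, y). w x y) p * (\<lambda>(x, y). f x y) p) \<in> borel_measurable borel"
    using tame_borel[OF w] f(1) by (rule borel_measurable_times)
  then show m: "(\<lambda>(x, y). w x y * f x y) \<in> borel_measurable borel" by (simp add: case_prod_beta')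
  show "\<forall>y. \<exists>B. \<forall>x\<in>{-l..l}. norm (w x y * f x y) \<le> B"
  proof
    fix y
    obtain B where B: "\<And>x. x \<in> {-l..l} \<Longrightarrow> norm (w x y) \<le> B" using w unfolding tame_def by blast
    have "norm (w x y * f x y) \<le> \<bar>B\<bar> * X" if "x \<in> {-l..l}" for x
      unfolding norm_mult using B[OF that] f(3) by (intro mult_mono) auto
    then show "\<exists>B. \<forall>x\<in>{-l..l}. norm (w x y * f x y) \<le> B" by blast
  qed
  have le: "slice p (w \<odot> f) y \<le> X ^ p * slice p w y" for p y
    by (rule slice_mono[OF w m]) (use f in \<open>auto simp: norm_mult mult.commute[of X] intro: mult_left_mono\<close>)
  fix p :: nat assume p: "p \<in> {1, 2}"
  have i: "integrable lborel (\<lambda>y. X ^ p * slice p w y)" "(LINT y|lborel. slice p w y) \<le> c ^ p"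
    using tameD[OF w] p by auto
  show i2: "integrable lborel (slice p (w \<odot> f))"
    by (rule Bochner_Integration.integrable_bound[OF i(1)])
      (use slice_measurable[OF m] le slice_nonneg f in \<open>auto simp: abs_of_nonneg\<close>)
  have "(LINT y|lborel. slice p (w \<odot> f) y) \<le> (LINT y|lborel. X ^ p * slice p w y)"
    by (rule integral_mono[OF i2 i(1) le])
  also have "\<dots> \<le> X ^ p * c ^ p" using i(2) f(4) by (simp add: mult_left_mono)
  finally show "(LINT y|lborel. slice p (w \<odot> f) y) \<le> (X * c) ^ p" by (simp add: power_mult_distrib)
qed

text \<open>Minkowski's inequality is traded for |a + b|^p <= 2 (|a|^p + |b|^p), valid for p = 1 and
  p = 2; this is the origin of the factor 2.\<close>

lemma tame_add:
  assumes w: "tame c w" and v: "tame d v"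
  shows "tame (2 * (c + d)) (\<lambda>x y. w x y + v x y)"
  unfolding tame_def
proof (intro conjI ballI)
  have cd: "0 < c" "0 < d" using tameD(1) w v by auto
  then show "0 < 2 * (c + d)" by simp
  show "x_periodic l (\<lambda>x y. w x y + v x y)" using tameD(2)[OF w] tameD(2)[OF v] by (simp add: x_periodic_def)
  have "(\<lambda>p. (\<lambda>(x, y). w x y) p + (\<lambda>(x, y). v x y) p) \<in> borel_measurable borel"
    using tame_borel[OF w] tame_borel[OF v] by (rule borel_measurable_add)
  then show m: "(\<lambda>(x, y). w x y + v x y) \<in> borel_measurable borel" by (simp add: case_prod_beta')
  show "\<forall>y. \<exists>B. \<forall>x\<in>{-l..l}. norm (w x y + v x y) \<le> B"
  proof
    fix y
    obtain B1 B2 where B: "\<And>x. x \<in> {-l..l} \<Longrightarrow> norm (w x y) \<le> B1" "\<And>x. x \<in> {-l..l} \<Longrightarrow> norm (v x y) \<le> B2"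
      using w v unfolding tame_def by metis
    then have "norm (w x y + v x y) \<le> B1 + B2" if "x \<in> {-l..l}" for x
      using that by (meson add_mono norm_triangle_ineq order_trans)
    then show "\<exists>B. \<forall>x\<in>{-l..l}. norm (w x y + v x y) \<le> B" by blast
  qed
  fix p :: nat assume p: "p \<in> {1, 2}"
  have pw: "norm (a + b) ^ p \<le> 2 * (norm a ^ p + norm b ^ p)" for a b :: complex
  proof (cases "p = 1")
    case True
    have "norm (a + b) \<le> 2 * (norm a + norm b)"
    proof -
      define s where "s = norm a + norm b"
      have "norm (a + b) \<le> s" "0 \<le> s" unfolding s_def by (auto intro: norm_triangle_ineq)
      then show ?thesis unfolding s_def[symmetric] by linarith
    qed
    then show ?thesis using True by simp
  next
    case False
    have "norm (a + b) ^ 2 \<le> (norm a + norm b) ^ 2" by (intro power_mono norm_triangle_ineq) auto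
    also have "\<dots> \<le> 2 * (norm a ^ 2 + norm b ^ 2)"
      using sum_squares_bound[of "norm a" "norm b"] by (simp add: power2_sum)
    finally show ?thesis using False p by auto
  qed
  have le: "slice p (\<lambda>x y. w x y + v x y) y \<le> 2 * (slice p w y + slice p v y)" for y
  proof -
    note i = tame_slice(3)[OF w, of y p] tame_slice(3)[OF v, of y p]
    have "(LINT x|lborel. indicator {-l..l} x *\<^sub>R norm (w x y + v x y) ^ p)
        \<le> (LINT x|lborel. indicator {-l..l} x *\<^sub>R (2 * (norm (w x y) ^ p + norm (v x y) ^ p)))"
    proof (rule integral_mono')
      show "integrable lborel (\<lambda>x. indicator {-l..l} x *\<^sub>R (2 * (norm (w x y) ^ p + norm (v x y) ^ p)))"
        using set_integrable_mult_right[OF set_integral_add(1)[OF i], of 2] by (simp add: set_integrable_def)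
    qed (use pw in \<open>auto simp: indicator_def\<close>)
    also have "\<dots> = 2 * (slice p w y + slice p v y)"
      using set_integral_mult_right[of lborel "{-l..l}" 2 "\<lambda>x. norm (w x y) ^ p + norm (v x y) ^ p"] set_integral_add(2)[OF i]
      by (simp add: slice_def set_lebesgue_integral_def)
    finally show ?thesis by (simp add: slice_def set_lebesgue_integral_def)
  qed
  have i: "integrable lborel (slice p w)" "(LINT y|lborel. slice p w y) \<le> c ^ p"
    "integrable lborel (slice p v)" "(LINT y|lborel. slice p v y) \<le> d ^ p"
    using tameD[OF w] tameD[OF v] p by auto
  have i3: "integrable lborel (\<lambda>y. 2 * (slice p w y + slice p v y))" using i by simp
  show i2: "integrable lborel (slice p (\<lambda>x y. w x y + v x y))"
    by (rule Bochner_Integration.integrable_bound[OF i3])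
      (use slice_measurable[OF m] le slice_nonneg in \<open>auto simp: abs_of_nonneg\<close>)
  have "(LINT y|lborel. slice p (\<lambda>x y. w x y + v x y) y) \<le> (LINT y|lborel. 2 * (slice p w y + slice p v y))"
    by (rule integral_mono[OF i2 i3 le])
  also have "\<dots> \<le> 2 * (c ^ p + d ^ p)" using i by simp
  also have "\<dots> \<le> (2 * (c + d)) ^ p"
    using p cd by (auto simp: power2_eq_square algebra_simps)
  finally show "(LINT y|lborel. slice p (\<lambda>x y. w x y + v x y) y) \<le> (2 * (c + d)) ^ p" .
qed

lemma tame_mono: "tame c w \<Longrightarrow> c \<le> d \<Longrightarrow> tame d w"
  unfolding tame_def using power_mono[of c d] by (fastforce intro: order_trans)

lemma tame_uminus: "tame c w \<Longrightarrow> tame c (\<lambda>x y. (- 1) * w x y)"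
  using tame_mult[of c w "\<lambda>_ _. - 1" 1] by (simp add: x_periodic_def)

lemma green_op_diff:
  assumes "z \<in> C_omega l" "A \<subseteq> - {0}" "tame c w" "tame d v"
  shows "green_op z A (\<lambda>x y. w x y - v x y) x y = green_op z A w x y - green_op z A v x y"
  using green_op_add[OF assms(1-3) tame_uminus[OF assms(4)], of x y] green_op_cmult[of z A "-1" v x y] by simp

end

subsection \<open>Derivatives and classes of differentiable functions\<close>

text \<open>Partial derivatives in direction \<open>x\<close> (\<open>d = True\<close>) or \<open>y\<close> (\<open>d = False\<close>), so that both can be
  treated by the same argument.\<close>

definition has_pd :: "bool \<Rightarrow> (real \<Rightarrow> real \<Rightarrow> complex) \<Rightarrow> (real \<Rightarrow> real \<Rightarrow> complex) \<Rightarrow> bool" where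
  "has_pd d f f' \<longleftrightarrow> (\<forall>x y. if d then ((\<lambda>t. f t y) has_vector_derivative f' x y) (at x)
     else ((\<lambda>t. f x t) has_vector_derivative f' x y) (at y))"

lemma has_pd_True: "has_pd True f f' \<longleftrightarrow> (\<forall>x y. ((\<lambda>t. f t y) has_vector_derivative f' x y) (at x))"
  and has_pd_False: "has_pd False f f' \<longleftrightarrow> (\<forall>x y. ((\<lambda>t. f x t) has_vector_derivative f' x y) (at y))"
  by (simp_all add: has_pd_def)

lemma has_pd_const: "has_pd d (\<lambda>x y. c) (\<lambda>x y. 0)"
  by (cases d) (auto simp: has_pd_def)

lemma has_pd_add:
  assumes "has_pd d f f'" "has_pd d g g'"
  shows "has_pd d (\<lambda>x y. f x y + g x y) (\<lambda>x y. f' x y + g' x y)"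
  using assms by (cases d) (auto simp: has_pd_def intro!: has_vector_derivative_add)

lemma has_pd_cmult:
  assumes "has_pd d f f'"
  shows "has_pd d (\<lambda>x y. c * f x y) (\<lambda>x y. c * f' x y)"
  using assms by (cases d) (auto simp: has_pd_def intro!: has_vector_derivative_mult_right)

lemma has_pd_mult:
  assumes "has_pd d f f'" "has_pd d g g'"
  shows "has_pd d (f \<odot> g) (\<lambda>x y. f' x y * g x y + f x y * g' x y)"
  using assms has_vector_derivative_mult
  by (cases d) (fastforce simp: has_pd_def algebra_simps)+

lemma has_pd_unique:
  assumes "has_pd d f f'" "has_pd d f g'"
  shows "f' = g'"
proof (intro ext)
  fix x y show "f' x y = g' x y"
    using assms by (cases d) (simp_all add: has_pd_def, (meson vector_derivative_unique_at)+)
qed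

lemma has_pd_periodic:
  assumes "x_periodic l f" "has_pd d f f'"
  shows "x_periodic l f'"
proof (cases d)
  case True
  have "((\<lambda>t. f t y) has_vector_derivative f' (x + 2 * l) y) (at x)" for x y
  proof -
    have "((\<lambda>t. t + 2 * l) has_vector_derivative 1) (at x)"
      by (auto intro!: derivative_eq_intros)
    moreover have "((\<lambda>t. f t y) has_vector_derivative f' (x + 2 * l) y) (at (x + 2 * l))"
      using assms(2) True by (simp add: has_pd_def)
    ultimately have "((\<lambda>t. f t y) \<circ> (\<lambda>t. t + 2 * l) has_vector_derivative 1 *\<^sub>R f' (x + 2 * l) y) (at x)"
      by (rule vector_diff_chain_at)
    then show ?thesis using assms(1) by (simp add: comp_def x_periodic_def)
  qed
  then have "has_pd d f (\<lambda>x y. f' (x + 2 * l) y)" using True by (simp add: has_pd_def)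
  from has_pd_unique[OF this assms(2)] show ?thesis by (simp add: x_periodic_def fun_eq_iff)
next
  case False
  have "has_pd d f (\<lambda>x y. f' (x + 2 * l) y)"
    using assms False unfolding has_pd_def x_periodic_def by (metis ext)
  from has_pd_unique[OF this assms(2)] show ?thesis by (simp add: x_periodic_def fun_eq_iff)
qed

lemma has_vector_derivative_uniform_limit:
  fixes F :: "nat \<Rightarrow> real \<Rightarrow> complex"
  assumes "\<And>n x. (F n has_vector_derivative F' n x) (at x)"
    and "\<And>x. (\<lambda>n. F n x) \<longlonglongrightarrow> f x"
    and "uniform_limit UNIV F' D sequentially"
  shows "(f has_vector_derivative D x) (at x)"
proof -
  have "\<exists>g. \<forall>x\<in>UNIV. (\<lambda>n. F n x) \<longlonglongrightarrow> g x \<and> (g has_derivative (\<lambda>h. h *\<^sub>R D x)) (at x within UNIV)"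
  proof (rule has_derivative_sequence[where f'="\<lambda>n x h. h *\<^sub>R F' n x"])
    show "(F n has_derivative (\<lambda>h. h *\<^sub>R F' n x)) (at x within UNIV)" for n x
      using assms(1) by (simp add: has_vector_derivative_def)
    show "(\<lambda>n. F n 0) \<longlonglongrightarrow> f 0" by (rule assms)
    fix e :: real assume "0 < e"
    then have "\<forall>\<^sub>F n in sequentially. \<forall>x\<in>UNIV. dist (F' n x) (D x) < e"
      using assms(3) by (simp add: uniform_limit_iff)
    then show "\<forall>\<^sub>F n in sequentially. \<forall>x\<in>UNIV. \<forall>h. norm (h *\<^sub>R F' n x - h *\<^sub>R D x) \<le> e * norm h"
    proof eventually_elim
      case (elim n)
      then have "norm (F' n x - D x) \<le> e" for x by (auto simp: dist_norm intro: less_imp_le)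
      then show ?case
        by (auto simp: scaleR_diff_right[symmetric] mult.commute[of e] intro!: mult_left_mono)
    qed
  qed auto
  then obtain g where g: "\<And>x. (\<lambda>n. F n x) \<longlonglongrightarrow> g x" "\<And>x. (g has_vector_derivative D x) (at x)"
    by (auto simp: has_vector_derivative_def)
  have "g = f" using LIMSEQ_unique[OF g(1) assms(2)] by auto
  then show ?thesis using g(2) by simp
qed

lemma has_pd_uniform_limit:
  assumes F: "\<And>n. has_pd d (F n) (F' n)"
    and f: "\<And>x y. (\<lambda>n. F n x y) \<longlonglongrightarrow> f x y"
    and D: "uniform_limit UNIV (\<lambda>n (x, y). F' n x y) (\<lambda>(x, y). D x y) sequentially"
  shows "has_pd d f D"
proof (cases d)
  case True
  have "uniform_limit UNIV (\<lambda>n x. F' n x y) (\<lambda>x. D x y) sequentially" for y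
  proof (rule uniform_limitI)
    fix e :: real assume "0 < e"
    from uniform_limitD[OF D this]
    show "\<forall>\<^sub>F n in sequentially. \<forall>x\<in>UNIV. dist (F' n x y) (D x y) < e"
      by eventually_elim auto
  qed
  then have "((\<lambda>t. f t y) has_vector_derivative D x y) (at x)" for x y
    by (intro has_vector_derivative_uniform_limit[where F="\<lambda>n t. F n t y" and F'="\<lambda>n t. F' n t y" and D="\<lambda>t. D t y"])
      (use F True f in \<open>simp_all add: has_pd_def\<close>)
  then show ?thesis using True by (simp add: has_pd_def)
next
  case False
  have "uniform_limit UNIV (\<lambda>n y. F' n x y) (\<lambda>y. D x y) sequentially" for x
  proof (rule uniform_limitI)
    fix e :: real assume "0 < e"
    from uniform_limitD[OF D this]
    show "\<forall>\<^sub>F n in sequentially. \<forall>y\<in>UNIV. dist (F' n x y) (D x y) < e"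
      by eventually_elim auto
  qed
  then have "((\<lambda>t. f x t) has_vector_derivative D x y) (at y)" for x y
    by (intro has_vector_derivative_uniform_limit[where F="\<lambda>n t. F n x t" and F'="\<lambda>n t. F' n x t" and D="\<lambda>t. D x t"])
      (use F False f in \<open>simp_all add: has_pd_def\<close>)
  then show ?thesis using False by (simp add: has_pd_def)
qed

section \<open>Differentiating Fourier modes and the Green operator; classes of order k\<close>

context strip_setup
begin

definition ctame :: "real \<Rightarrow> (real \<Rightarrow> real \<Rightarrow> complex) \<Rightarrow> bool" where
  "ctame c w \<longleftrightarrow> tame c w \<and> continuous2 w"

text \<open>The constant is positive, as in \<open>tame\<close>, so that the products formed in
  \<open>ctame_mult\<close> are again admissible constants.\<close>

definition bounded_by :: "real \<Rightarrow> (real \<Rightarrow> real \<Rightarrow> complex) \<Rightarrow> bool" where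
  "bounded_by c f \<longleftrightarrow> 0 < c \<and> x_periodic l f \<and> continuous2 f \<and> (\<forall>x y. norm (f x y) \<le> c)"

lemma continuous_on_slices:
  assumes "continuous_on UNIV (\<lambda>(x, y). f x y :: complex)"
    and "continuous_on S g" "continuous_on S h"
  shows "continuous_on S (\<lambda>t. f (g t) (h t))"
  using continuous_on_compose2[OF assms(1) continuous_on_Pair[OF assms(2,3)]] by simp

lemma fcoef_eq_integral:
  assumes "continuous2 w"
  shows "fcoef w m y = 1 / (2 * of_real l) * integral {-l..l} (\<lambda>x. w x y * emode (- m) x)"
proof -
  have "set_integrable lborel {-l..l} (\<lambda>x. w x y * emode (- m) x)"
    by (intro borel_integrable_atLeastAtMost' continuous_intros continuous_on_slices[OF assms])
  from set_borel_integral_eq_integral(2)[OF this] show ?thesis by (simp add: fcoef_def)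
qed

text \<open>Integration by parts on [-l, l]; the boundary terms cancel because w and the mode are
  both periodic.\<close>

lemma fcoef_pd_x:
  assumes p: "x_periodic l w" and d: "has_pd True w w'"
    and c: "continuous2 w" "continuous2 w'"
  shows "fcoef w' m y = \<i> * of_real (omega l * of_int m) * fcoef w m y"
proof -
  let ?k = "\<i> * of_real (omega l * of_int m)"
  have "((\<lambda>x. w x y * emode (- m) x) has_vector_derivative w x y * (- ?k * emode (- m) x) + w' x y * emode (- m) x) (at x within S)" for x S
    by (rule has_vector_derivative_mult)
      (use d emode_has_vector_derivative[of "-m" x S] in \<open>auto simp: has_pd_True intro: has_vector_derivative_at_within\<close>)
  then have "(LINT x|lborel. indicator {-l..l} x *\<^sub>R (w x y * (- ?k * emode (- m) x) + w' x y * emode (- m) x))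
      = w l y * emode (- m) l - w (- l) y * emode (- m) (- l)"
    using l_pos by (intro integral_FTC_Icc) (auto intro!: continuous_intros continuous_on_slices[OF c(1)] continuous_on_slices[OF c(2)])
  also have "w l y = w (- l) y"
    using p[unfolded x_periodic_def, rule_format, of "-l" y] by simp
  finally have "(LINT x:{-l..l}|lborel. - ?k * (w x y * emode (- m) x) + w' x y * emode (- m) x) = 0"
    by (simp add: set_lebesgue_integral_def emode_ends algebra_simps)
  moreover have "(LINT x:{-l..l}|lborel. - ?k * (w x y * emode (- m) x) + w' x y * emode (- m) x)
     = - ?k * (LINT x:{-l..l}|lborel. w x y * emode (- m) x) + (LINT x:{-l..l}|lborel. w' x y * emode (- m) x)"
    unfolding set_integral_mult_right[symmetric]
    by (intro set_integral_add(2) borel_integrable_atLeastAtMost' continuous_intros continuous_on_slices[OF c(1)] continuous_on_slices[OF c(2)])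
  ultimately show ?thesis by (simp add: fcoef_def)
qed

lemma continuous_on_fcoef:
  assumes c: "continuous2 w"
  shows "continuous_on UNIV (fcoef w m)"
proof -
  have "continuous_on UNIV (\<lambda>y. integral (cbox (-l) l) (\<lambda>x. w x y * emode (- m) x))"
    by (rule integral_continuous_on_param)
      (auto intro!: continuous_intros continuous_on_slices[OF c] simp: case_prod_beta')
  then show ?thesis unfolding fcoef_eq_integral[OF c, abs_def] by (intro continuous_intros) simp
qed

lemma fcoef_pd_y:
  assumes d: "has_pd False w w'"
    and c: "continuous2 w" "continuous2 w'"
  shows "(fcoef w m has_vector_derivative fcoef w' m y) (at y)"
proof -
  have "((\<lambda>y. integral (cbox (-l) l) (\<lambda>x. w x y * emode (- m) x)) has_vector_derivative
      integral (cbox (-l) l) (\<lambda>x. w' x y * emode (- m) x)) (at y within UNIV)"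
  proof (rule leibniz_rule_vector_derivative)
    show "((\<lambda>y. w x y * emode (- m) x) has_vector_derivative w' x y * emode (- m) x) (at y within UNIV)" for x y
      using d by (auto simp: has_pd_False intro!: has_vector_derivative_mult_left)
    show "(\<lambda>x. w x y * emode (- m) x) integrable_on cbox (-l) l" for y
      by (intro integrable_continuous continuous_intros continuous_on_slices[OF c(1)])
    show "continuous_on (UNIV \<times> cbox (-l) l) (\<lambda>(y, x). w' x y * emode (- m) x)"
      by (auto intro!: continuous_intros continuous_on_slices[OF c(2)] simp: case_prod_beta')
  qed auto
  then show ?thesis
    unfolding fcoef_eq_integral[OF c(1), abs_def] fcoef_eq_integral[OF c(2)]
    by (intro has_vector_derivative_mult_right) simp
qed

lemma fcoef_bounded:
  assumes "ctame c w" "ctame c' w'" "has_pd False w w'"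
  shows "norm (fcoef w m y) \<le> c / (2 * l) + c' / (2 * l)"
proof -
  have "norm (fcoef w m y) \<le> (LINT t|lborel. norm (fcoef w m t)) + (LINT t|lborel. norm (fcoef w' m t))"
    using assms by (intro norm_le_integral_derivative fcoef_integrable fcoef_pd_y continuous_on_fcoef) (auto simp: ctame_def)
  also have "\<dots> \<le> c / (2 * l) + c' / (2 * l)"
    using assms by (intro add_mono fcoef_integrable) (auto simp: ctame_def)
  finally show ?thesis .
qed

lemma conv_fcoef_pd_y:
  assumes "ctame c w" "ctame c' w'" "has_pd False w w'" "Re b \<noteq> 0"
  shows "(conv b (fcoef w m) has_vector_derivative conv b (fcoef w' m) y) (at y)"
  by (rule conv_has_vector_derivative_conv[OF _ _ fcoef_bounded[OF assms(1-3)]])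
    (use assms in \<open>auto simp: ctame_def intro!: fcoef_integrable fcoef_pd_y continuous_on_fcoef\<close>)

lemma has_pd_mode_x: "has_pd True (\<lambda>x y. emode m x * p y) (\<lambda>x y. (\<i> * of_real (omega l * of_int m)) * (emode m x * p y))"
  unfolding has_pd_True
  using has_vector_derivative_mult_left[OF emode_has_vector_derivative] by (simp add: mult.assoc)

lemma has_pd_mode_y:
  assumes "\<And>y. (p has_vector_derivative p' y) (at y)"
  shows "has_pd False (\<lambda>x y. emode m x * p y) (\<lambda>x y. emode m x * p' y)"
  unfolding has_pd_False by (intro allI has_vector_derivative_mult_right assms)

lemma has_pd_sum:
  assumes "finite F" "\<And>i. i \<in> F \<Longrightarrow> has_pd d (f i) (f' i)"
  shows "has_pd d (\<lambda>x y. \<Sum>i\<in>F. f i x y) (\<lambda>x y. \<Sum>i\<in>F. f' i x y)"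
  using assms by (induction F rule: finite_induct) (auto intro: has_pd_const has_pd_add)

lemma green_op_single: "green_op z {m} w = (\<lambda>x y. emode m x * conv (bsym z m) (fcoef w m) y)"
  by (intro ext) (simp add: green_op_finite)

text \<open>In x both derivatives amount to multiplication by the same i omega m, by
  \<open>fcoef_pd_x\<close>; in y convolution commutes with differentiation.\<close>

lemma mode_pd:
  assumes z: "z \<in> C_omega l" "m \<noteq> 0" and w: "ctame c w" "ctame c' w'" "has_pd d w w'"
  shows "has_pd d (\<lambda>x y. emode m x * conv (bsym z m) (fcoef w m) y) (\<lambda>x y. emode m x * conv (bsym z m) (fcoef w' m) y)"
proof (cases d)
  case True
  have "fcoef w' m = (\<lambda>y. \<i> * of_real (omega l * of_int m) * fcoef w m y)"
    using fcoef_pd_x[of w w' m] w True by (auto simp: ctame_def dest: tameD)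
  then have "conv (bsym z m) (fcoef w' m) y = \<i> * of_real (omega l * of_int m) * conv (bsym z m) (fcoef w m) y" for y
    using conv_cmult[of "bsym z m" "\<i> * of_real (omega l * of_int m)" "fcoef w m"] by simp
  then show ?thesis
    using has_pd_mode_x[of m "conv (bsym z m) (fcoef w m)"] True by (simp add: algebra_simps)
next
  case False
  then show ?thesis
    using has_pd_mode_y[OF conv_fcoef_pd_y[OF w(1,2) _ Re_bsym_nonzero[OF z]]] w(3) by simp
qed

text \<open>Term-by-term differentiation: each truncation obeys \<open>mode_pd\<close>, and the
  differentiated series converges uniformly because it is the series of w'.\<close>

lemma green_op_pd:
  assumes z: "z \<in> C_omega l" "A \<subseteq> - {0}" and w: "ctame c w" "ctame c' w'" "has_pd d w w'"
  shows "has_pd d (green_op z A w) (green_op z A w')"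
proof (rule has_pd_uniform_limit)
  have t: "tame c w" "tame c' w'" using w by (auto simp: ctame_def)
  show "has_pd d (\<lambda>x y. \<Sum>m\<in>A \<inter> {- int n..int n}. emode m x * conv (bsym z m) (fcoef w m) y)
      (\<lambda>x y. \<Sum>m\<in>A \<inter> {- int n..int n}. emode m x * conv (bsym z m) (fcoef w' m) y)" for n
    by (intro has_pd_sum mode_pd[OF z(1) _ w]) (use z in auto)
  show "uniform_limit UNIV (\<lambda>n (x, y). \<Sum>m\<in>A \<inter> {- int n..int n}. emode m x * conv (bsym z m) (fcoef w' m) y)
    (\<lambda>(x, y). green_op z A w' x y) sequentially"
    by (rule green_op_sequence[OF z t(2)])
  show "(\<lambda>n. \<Sum>m\<in>A \<inter> {- int n..int n}. emode m x * conv (bsym z m) (fcoef w m) y) \<longlonglongrightarrow> green_op z A w x y" for x y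
    using tendsto_uniform_limitI[OF green_op_sequence[OF z t(1)], of "(x, y)"] by simp
qed

text \<open>The second way to differentiate a mode in y. \<open>mode_pd\<close> moves the derivative
  onto w; here the equation of the mode gives it without differentiating w, at the cost of a factor
  \<open>bsym z m\<close>.\<close>

lemma green_op_mode_pd_y:
  assumes z: "z \<in> C_omega l" "m \<noteq> 0" and w: "ctame c w"
  shows "has_pd False (green_op z {m} w) (\<lambda>x y. emode m x * fcoef w m y + (- bsym z m) * green_op z {m} w x y)"
proof -
  have "tame c w" "continuous2 w" using w by (auto simp: ctame_def)
  then have "has_pd False (\<lambda>x y. emode m x * conv (bsym z m) (fcoef w m) y)
      (\<lambda>x y. emode m x * (fcoef w m y - bsym z m * conv (bsym z m) (fcoef w m) y))"
    by (intro has_pd_mode_y conv_has_vector_derivative fcoef_integrable continuous_on_fcoef Re_bsym_nonzero z)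
  then show ?thesis unfolding green_op_single by (simp add: algebra_simps)
qed

lemma green_op_mode_pd_x: "has_pd True (green_op z {m} w) (\<lambda>x y. (\<i> * of_real (omega l * of_int m)) * green_op z {m} w x y)"
  unfolding green_op_single by (rule has_pd_mode_x)

text \<open>The analogue of \<open>norm_le_integral_derivative\<close> for L1 norms in x. It bounds
  the Fourier coefficients of u f at every y even if f is merely bounded, since the derivative falls
  on u alone.\<close>

lemma slice_sup:
  assumes u: "ctame c u" "ctame c' u'" "has_pd False u u'"
  shows "slice 1 u y \<le> c + c'"
proof -
  have cu: "continuous2 u" "continuous2 u'"
    and t: "tame c u" "tame c' u'" using u by (auto simp: ctame_def)
  define I where "I = (\<lambda>x. LINT r:{0..1::real}|lborel. norm (u' x (y + r)))"
  have inorm: "set_integrable lborel {a..b} (\<lambda>r. norm (u' x (y + r)))" for a b x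
    by (intro borel_integrable_atLeastAtMost' continuous_intros continuous_on_slices[OF cu(2)])
  have pw: "norm (u x y) \<le> norm (u x (y + s)) + I x" if s: "s \<in> {0..1}" for x s
  proof -
    have "(LINT t|lborel. indicator {0..s} t *\<^sub>R u' x (y + t)) = u x (y + s) - u x (y + 0)"
    proof (rule integral_FTC_Icc)
      fix t
      have "((\<lambda>s. y + s) has_vector_derivative 1) (at t)"
        by (auto intro!: derivative_eq_intros)
      moreover have "((\<lambda>y. u x y) has_vector_derivative u' x (y + t)) (at (y + t))"
        using u(3) by (simp add: has_pd_False)
      ultimately have "((\<lambda>y. u x y) \<circ> (\<lambda>s. y + s) has_vector_derivative 1 *\<^sub>R u' x (y + t)) (at t)"
        by (rule vector_diff_chain_at)
      then show "((\<lambda>t. u x (y + t)) has_vector_derivative u' x (y + t)) (at t within {0..s})"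
        by (simp add: comp_def has_vector_derivative_at_within)
    qed (use s in \<open>auto intro!: continuous_intros continuous_on_slices[OF cu(2)]\<close>)
    then have "norm (u x (y + s) - u x y) \<le> (LINT t|lborel. norm (indicator {0..s} t *\<^sub>R u' x (y + t)))"
      by (metis add.right_neutral integral_norm_bound)
    also have "\<dots> = (LINT t|lborel. indicator {0..s} t *\<^sub>R norm (u' x (y + t)))"
      by (rule Bochner_Integration.integral_cong) auto
    also have "\<dots> \<le> (LINT t|lborel. indicator {0..1} t *\<^sub>R norm (u' x (y + t)))"
      using inorm s by (intro integral_mono) (auto simp: set_integrable_def indicator_def)
    finally show ?thesis
      using norm_triangle_ineq4[of "u x (y + s)" "u x (y + s) - u x y"]
      by (simp add: I_def set_lebesgue_integral_def)
  qed
  have box: "integrable (lborel \<Otimes>\<^sub>M lborel) (\<lambda>(x, r). indicator {-l..l} x * (indicator {0..1} r * norm (u' x (y + r))))"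
  proof -
    have "integrable lborel (\<lambda>p. indicator ({-l..l} \<times> {0..1::real}) p *\<^sub>R norm (u' (fst p) (y + snd p)))"
      by (rule borel_integrable_compact)
        (auto intro!: compact_Times continuous_intros continuous_on_slices[OF cu(2)])
    then show ?thesis
      unfolding lborel_prod by (rule Bochner_Integration.integrable_cong[THEN iffD1, rotated 2]) (auto simp: indicator_def)
  qed
  have II: "set_integrable lborel {-l..l} I" "(LINT x:{-l..l}|lborel. I x) \<le> c'"
  proof -
    from lborel_pair.integrable_fst[OF box]
    show "set_integrable lborel {-l..l} I"
      by (simp add: set_integrable_def I_def set_lebesgue_integral_def)
    have "(LINT x:{-l..l}|lborel. I x) = (LINT x|lborel. LINT r|lborel. indicator {-l..l} x * (indicator {0..1} r * norm (u' x (y + r))))"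
      by (simp add: I_def set_lebesgue_integral_def)
    also have "\<dots> = (LINT r|lborel. LINT x|lborel. indicator {-l..l} x * (indicator {0..1} r * norm (u' x (y + r))))"
      by (rule lborel_pair.Fubini_integral[OF box, symmetric])
    also have "\<dots> = (LINT r|lborel. indicator {0..1} r * slice 1 u' (y + r))"
    proof (rule Bochner_Integration.integral_cong)
      fix r :: real
      have "(LINT x|lborel. indicator {-l..l} x * (indicator {0..1} r * norm (u' x (y + r))))
          = (LINT x|lborel. indicator {0..1} r * (indicator {-l..l} x * norm (u' x (y + r))))"
        by (simp add: algebra_simps)
      then show "(LINT x|lborel. indicator {-l..l} x * (indicator {0..1} r * norm (u' x (y + r)))) = indicator {0..1} r * slice 1 u' (y + r)"
        by (simp add: slice_def set_lebesgue_integral_def)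
    qed simp
    also have "\<dots> \<le> (LINT r|lborel. slice 1 u' (y + r))"
    proof (rule integral_mono')
      show "integrable lborel (\<lambda>r. slice 1 u' (y + r))"
        using lborel_integrable_real_affine[OF tameD(3)[OF t(2)], of 1 y] by simp
    qed (use slice_nonneg in \<open>auto simp: indicator_def\<close>)
    also have "\<dots> \<le> c'"
      using lborel_integral_real_affine[of 1 "slice 1 u'" y] tameD(5)[OF t(2)] by simp
    finally show "(LINT x:{-l..l}|lborel. I x) \<le> c'" .
  qed
  have le: "slice 1 u y - c' \<le> slice 1 u (y + s)" if s: "s \<in> {0..1}" for s
  proof -
    have i: "set_integrable lborel {-l..l} (\<lambda>x. norm (u x (y + s)))"
      using tame_slice(3)[OF t(1), of "y + s" 1] by simp
    have "slice 1 u y \<le> (LINT x:{-l..l}|lborel. norm (u x (y + s)) + I x)"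
      unfolding slice_def
      by (rule set_integral_mono) (use tame_slice(3)[OF t(1), of y 1] set_integral_add(1)[OF i II(1)] pw[OF s] in auto)
    also have "\<dots> = slice 1 u (y + s) + (LINT x:{-l..l}|lborel. I x)"
      using set_integral_add(2)[OF i II(1)] by (simp add: slice_def)
    finally show ?thesis using II(2) by simp
  qed
  have "slice 1 u y - c' = (LINT s|lborel. indicator {0..1::real} s * (slice 1 u y - c'))" by simp
  also have "\<dots> \<le> (LINT s|lborel. slice 1 u (y + s))"
  proof (rule integral_mono')
    show "integrable lborel (\<lambda>s. slice 1 u (y + s))"
      using lborel_integrable_real_affine[OF tameD(3)[OF t(1)], of 1 y] by simp
  qed (use le slice_nonneg in \<open>auto simp: indicator_def\<close>)
  also have "\<dots> \<le> c"
    using lborel_integral_real_affine[of 1 "slice 1 u" y] tameD(5)[OF t(1)] by simp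
  finally show ?thesis by simp
qed

text \<open>Derivatives enter existentially and the direction is quantified anew at each level, so
  all mixed derivatives in every order share the bound c and no canonical order has to be
  fixed.\<close>

primrec bounded_upto :: "nat \<Rightarrow> real \<Rightarrow> (real \<Rightarrow> real \<Rightarrow> complex) \<Rightarrow> bool" where
  "bounded_upto 0 c f \<longleftrightarrow> bounded_by c f"
| "bounded_upto (Suc k) c f \<longleftrightarrow> bounded_by c f \<and> (\<forall>d. \<exists>f'. has_pd d f f' \<and> bounded_upto k c f')"

primrec tame_upto :: "nat \<Rightarrow> real \<Rightarrow> (real \<Rightarrow> real \<Rightarrow> complex) \<Rightarrow> bool" where
  "tame_upto 0 c w \<longleftrightarrow> ctame c w"
| "tame_upto (Suc k) c w \<longleftrightarrow> ctame c w \<and> (\<forall>d. \<exists>w'. has_pd d w w' \<and> tame_upto k c w')"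

lemma bounded_by_pos: "bounded_by c f \<Longrightarrow> 0 < c"
  and bounded_by_norm: "bounded_by c f \<Longrightarrow> norm (f x y) \<le> c"
  and bounded_by_continuous: "bounded_by c f \<Longrightarrow> continuous2 f"
  and bounded_by_periodic: "bounded_by c f \<Longrightarrow> x_periodic l f"
  by (auto simp: bounded_by_def)

lemma ctame_tame: "ctame c w \<Longrightarrow> tame c w"
  and ctame_continuous: "ctame c w \<Longrightarrow> continuous2 w"
  and ctame_pos: "ctame c w \<Longrightarrow> 0 < c"
  by (auto simp: ctame_def dest: tameD)

lemma bounded_by_add: "bounded_by c f \<Longrightarrow> bounded_by d g \<Longrightarrow> bounded_by (c + d) (\<lambda>x y. f x y + g x y)"
  unfolding bounded_by_def
  by (auto simp: x_periodic_def case_prod_beta' intro!: continuous_intros norm_triangle_le add_mono)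

lemma bounded_by_cmult: "bounded_by c f \<Longrightarrow> 0 < K \<Longrightarrow> norm k \<le> K \<Longrightarrow> bounded_by (K * c) (\<lambda>x y. k * f x y)"
  unfolding bounded_by_def
  by (auto simp: x_periodic_def case_prod_beta' norm_mult intro!: continuous_intros mult_mono)

lemma bounded_by_mono: "bounded_by c f \<Longrightarrow> c \<le> d \<Longrightarrow> bounded_by d f"
  unfolding bounded_by_def by (auto intro: order_trans)

lemma bounded_upto_bounded_by: "bounded_upto k c f \<Longrightarrow> bounded_by c f"
  by (cases k) auto

lemma tame_upto_ctame: "tame_upto k c w \<Longrightarrow> ctame c w"
  by (cases k) auto

lemma bounded_upto_Suc_imp: "bounded_upto (Suc k) c f \<Longrightarrow> bounded_upto k c f"
  by (induction k arbitrary: f) (auto, meson)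

lemma tame_upto_Suc_imp: "tame_upto (Suc k) c w \<Longrightarrow> tame_upto k c w"
  by (induction k arbitrary: w) (auto, meson)

lemma bounded_upto_antimono: "bounded_upto k c f \<Longrightarrow> j \<le> k \<Longrightarrow> bounded_upto j c f"
  by (induction k) (auto simp: le_Suc_eq simp del: bounded_upto.simps dest: bounded_upto_Suc_imp)

lemma tame_upto_antimono: "tame_upto k c w \<Longrightarrow> j \<le> k \<Longrightarrow> tame_upto j c w"
  by (induction k) (auto simp: le_Suc_eq simp del: tame_upto.simps dest: tame_upto_Suc_imp)

lemma bounded_upto_mono: "bounded_upto k c f \<Longrightarrow> c \<le> d \<Longrightarrow> bounded_upto k d f"
  by (induction k arbitrary: f) (auto intro: bounded_by_mono, meson)

lemma tame_upto_mono: "tame_upto k c w \<Longrightarrow> c \<le> d \<Longrightarrow> tame_upto k d w"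
  by (induction k arbitrary: w) (auto simp: ctame_def intro: tame_mono, meson)

lemma bounded_upto_add: "bounded_upto k c f \<Longrightarrow> bounded_upto k d g \<Longrightarrow> bounded_upto k (c + d) (\<lambda>x y. f x y + g x y)"
proof (induction k arbitrary: f g)
  case (Suc k)
  have "\<exists>h. has_pd e (\<lambda>x y. f x y + g x y) h \<and> bounded_upto k (c + d) h" for e
  proof -
    obtain f' g' where "has_pd e f f'" "bounded_upto k c f'" "has_pd e g g'" "bounded_upto k d g'"
      using Suc.prems by auto meson
    then show ?thesis using Suc.IH has_pd_add by blast
  qed
  then show ?case using Suc.prems bounded_by_add by auto
qed (simp add: bounded_by_add)

lemma bounded_upto_cmult: "bounded_upto k c f \<Longrightarrow> 0 < K \<Longrightarrow> norm a \<le> K \<Longrightarrow> bounded_upto k (K * c) (\<lambda>x y. a * f x y)"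
proof (induction k arbitrary: f)
  case (Suc k)
  have "\<exists>h. has_pd e (\<lambda>x y. a * f x y) h \<and> bounded_upto k (K * c) h" for e
  proof -
    obtain f' where "has_pd e f f'" "bounded_upto k c f'" using Suc.prems by auto
    then show ?thesis using Suc.IH Suc.prems has_pd_cmult by blast
  qed
  then show ?case using Suc.prems bounded_by_cmult by auto
qed (simp add: bounded_by_cmult)

lemma bounded_upto_const: "0 < c \<Longrightarrow> norm a \<le> c \<Longrightarrow> bounded_upto k c (\<lambda>x y. a)"
proof (induction k arbitrary: a)
  case (Suc k)
  then have "bounded_upto k c (\<lambda>x y. 0)" by simp
  with Suc.prems show ?case by (auto simp: bounded_by_def x_periodic_def case_prod_beta' intro: has_pd_const)
qed (simp add: bounded_by_def x_periodic_def case_prod_beta')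

lemma bounded_upto_sum:
  assumes "finite F" "0 < c" "\<And>i. i \<in> F \<Longrightarrow> bounded_upto k c (f i)"
  shows "bounded_upto k ((real (card F) + 1) * c) (\<lambda>x y. \<Sum>i\<in>F. f i x y)"
  using assms
proof (induction F rule: finite_induct)
  case (insert i F)
  then have "bounded_upto k (c + (real (card F) + 1) * c) (\<lambda>x y. f i x y + (\<Sum>i\<in>F. f i x y))"
    by (intro bounded_upto_add) auto
  then show ?case using insert by (simp add: algebra_simps)
qed (simp add: bounded_upto_const)

lemma ctame_add: "ctame c w \<Longrightarrow> ctame d v \<Longrightarrow> ctame (2 * (c + d)) (\<lambda>x y. w x y + v x y)"
  unfolding ctame_def case_prod_beta' by (intro conjI tame_add continuous_on_add) simp_all

lemma bounded_by_borel: "bounded_by c f \<Longrightarrow> (\<lambda>(x, y). f x y) \<in> borel_measurable borel"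
  by (auto simp: bounded_by_def intro: borel_measurable_continuous_onI)

lemma ctame_mult: "ctame c w \<Longrightarrow> bounded_by d f \<Longrightarrow> ctame (c * d) (w \<odot> f)"
  using tame_mult[of c w f d] bounded_by_borel[of d f] unfolding ctame_def
  by (auto simp: bounded_by_def case_prod_beta' mult.commute[of c] intro!: continuous_intros)

lemma tame_upto_add: "tame_upto k c f \<Longrightarrow> tame_upto k d g \<Longrightarrow> tame_upto k (2 * (c + d)) (\<lambda>x y. f x y + g x y)"
proof (induction k arbitrary: f g)
  case (Suc k)
  have "\<exists>h. has_pd e (\<lambda>x y. f x y + g x y) h \<and> tame_upto k (2 * (c + d)) h" for e
  proof -
    obtain f' g' where "has_pd e f f'" "tame_upto k c f'" "has_pd e g g'" "tame_upto k d g'"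
      using Suc.prems by auto meson
    then show ?thesis using Suc.IH has_pd_add by blast
  qed
  then show ?case using Suc.prems ctame_add unfolding tame_upto.simps by blast
qed (simp only: tame_upto.simps ctame_add)

text \<open>Each application of the product rule yields two terms, and \<open>tame_upto_add\<close>
  doubles their sum; hence a factor 4 per order.\<close>

lemma tame_upto_mult: "tame_upto k c u \<Longrightarrow> bounded_upto k d f \<Longrightarrow> tame_upto k (4 ^ k * (c * d)) (u \<odot> f)"
proof (induction k arbitrary: u f)
  case (Suc k)
  have pos: "0 < c * d" using Suc.prems by (auto dest: bounded_by_pos ctame_pos intro!: mult_pos_pos)
  have "\<exists>h. has_pd e (u \<odot> f) h \<and> tame_upto k (4 ^ Suc k * (c * d)) h" for e
  proof -
    obtain u' f' where *: "has_pd e u u'" "tame_upto k c u'" "has_pd e f f'" "bounded_upto k d f'"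
      using Suc.prems by auto meson
    have "tame_upto k (2 * (4 ^ k * (c * d) + 4 ^ k * (c * d))) (\<lambda>x y. u' x y * f x y + u x y * f' x y)"
      using Suc.IH[OF *(2) bounded_upto_Suc_imp[OF Suc.prems(2)]] Suc.IH[OF tame_upto_Suc_imp[OF Suc.prems(1)] *(4)] by (rule tame_upto_add)
    moreover have eq: "2 * (4 ^ k * (c * d) + 4 ^ k * (c * d)) = 4 ^ Suc k * (c * d)" by simp
    ultimately have "tame_upto k (4 ^ Suc k * (c * d)) (\<lambda>x y. u' x y * f x y + u x y * f' x y)"
      by (simp only:)
    with has_pd_mult[OF *(1,3)] show ?thesis by (intro exI conjI)
  qed
  moreover have "ctame (4 ^ Suc k * (c * d)) (u \<odot> f)"
  proof -
    have "ctame (c * d) (u \<odot> f)" using Suc.prems by (auto intro: ctame_mult)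
    moreover have "1 * (c * d) \<le> 4 ^ Suc k * (c * d)" using pos 
      using one_le_power[of "4 :: real" "Suc k"] by (intro mult_right_mono) auto
    ultimately show ?thesis by (auto simp: ctame_def intro: tame_mono)
  qed
  ultimately show ?case by simp
qed (simp add: ctame_mult)

text \<open>A fixed witness of \<open>green_op_bounded\<close>, so that later constants can be
  explicit expressions in the norm of T.\<close>

definition green_bound :: real where
  "green_bound = (SOME t. 0 < t \<and> (\<forall>z\<in>C_omega l. \<forall>A c w x y. A \<subseteq> - {0} \<longrightarrow> tame c w \<longrightarrow> norm (green_op z A w x y) \<le> t * c))"

lemma green_bound: "0 < green_bound"
  and green_op_norm_le_green_bound: "z \<in> C_omega l \<Longrightarrow> A \<subseteq> - {0} \<Longrightarrow> tame c w \<Longrightarrow> norm (green_op z A w x y) \<le> green_bound * c"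
proof -
  have "\<exists>t. 0 < t \<and> (\<forall>z\<in>C_omega l. \<forall>A c w x y. A \<subseteq> - {0} \<longrightarrow> tame c w \<longrightarrow> norm (green_op z A w x y) \<le> t * c)"
    using green_op_bounded by metis
  from someI_ex[OF this]
  show "0 < green_bound" "z \<in> C_omega l \<Longrightarrow> A \<subseteq> - {0} \<Longrightarrow> tame c w \<Longrightarrow> norm (green_op z A w x y) \<le> green_bound * c"
    by (auto simp: green_bound_def)
qed

lemma green_op_bounded_by: "z \<in> C_omega l \<Longrightarrow> A \<subseteq> - {0} \<Longrightarrow> tame c w \<Longrightarrow> bounded_by (green_bound * c) (green_op z A w)"
  unfolding bounded_by_def using green_bound tameD(1)[of c w] green_op_norm_le_green_bound green_op_periodic green_op_continuous by auto

lemma green_op_bounded_upto: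
  assumes "z \<in> C_omega l" "A \<subseteq> - {0}"
  shows "tame_upto k c w \<Longrightarrow> bounded_upto k (green_bound * c) (green_op z A w)"
proof (induction k arbitrary: w)
  case (Suc k)
  have "\<exists>f'. has_pd d (green_op z A w) f' \<and> bounded_upto k (green_bound * c) f'" for d
  proof -
    obtain w' where "has_pd d w w'" "tame_upto k c w'" using Suc.prems by auto
    then show ?thesis using green_op_pd[OF assms tame_upto_ctame[OF Suc.prems] tame_upto_ctame, of k c w' d] Suc.IH by blast
  qed
  then show ?case using Suc.prems green_op_bounded_by[OF assms] by (auto dest: ctame_tame)
qed (auto intro: green_op_bounded_by[OF assms] dest: ctame_tame)

text \<open>This is the source term in \<open>green_op_mode_pd_y\<close>. Per order, an x-derivative
  costs |omega m| and a y-derivative produces two terms, which explains the base 2 + |omega m|. u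
  must be one order better than f because \<open>slice_sup\<close> differentiates it.\<close>

lemma bounded_upto_mode_coefficient:
  assumes "tame_upto (Suc k) c u" "bounded_upto k d f"
  shows "bounded_upto k ((2 + \<bar>omega l * of_int m\<bar>) ^ k * (c * d / l)) (\<lambda>x y. emode m x * fcoef (u \<odot> f) m y)"
  using assms
proof (induction k arbitrary: u f)
  case 0
  then obtain u' where u: "ctame c u" "ctame c u'" "has_pd False u u'" and f: "bounded_by d f"
    by auto
  have cd: "0 < c" "0 < d" using ctame_pos[OF u(1)] bounded_by_pos[OF f] by auto
  have uf: "ctame (c * d) (u \<odot> f)" by (rule ctame_mult[OF u(1) f])
  have "norm (fcoef (u \<odot> f) m y) \<le> c * d / l" for y
  proof -
    have "norm (fcoef (u \<odot> f) m y) \<le> slice 1 (u \<odot> f) y / (2 * l)"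
      by (rule norm_fcoef_le[OF ctame_tame[OF uf]])
    also have "slice 1 (u \<odot> f) y \<le> d ^ 1 * slice 1 u y"
      using bounded_by_norm[OF f] cd by (intro slice_mono[OF ctame_tame[OF u(1)] tame_borel[OF ctame_tame[OF uf]]])
        (auto simp: norm_mult mult.commute[of d] intro: mult_left_mono)
    also have "\<dots> \<le> d ^ 1 * (c + c)" using slice_sup[OF u] cd by (intro mult_left_mono) auto
    finally show ?thesis using l_pos by (simp add: divide_right_mono field_simps)
  qed
  moreover have "continuous_on UNIV (\<lambda>p. emode m (fst p) * fcoef (u \<odot> f) m (snd p))"
    by (intro continuous_intros continuous_on_compose2[OF continuous_on_fcoef[OF ctame_continuous[OF uf]]]) auto
  ultimately show ?case
    using cd l_pos by (simp add: bounded_by_def norm_mult x_periodic_def emode_periodic case_prod_beta')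
next
  case (Suc k)
  let ?D = "2 + \<bar>omega l * of_int m\<bar>" and ?g = "\<lambda>u f x y. emode m x * fcoef (u \<odot> f) m y"
  have cd: "0 < c" "0 < d" using Suc.prems by (auto dest: bounded_by_pos ctame_pos)
  define E where "E = ?D ^ k * (c * d / l)"
  have E: "0 < E" using cd l_pos by (simp add: E_def add_pos_nonneg)
  have IH: "bounded_upto k E (?g u f)"
    unfolding E_def by (rule Suc.IH[OF tame_upto_Suc_imp[OF Suc.prems(1)] bounded_upto_Suc_imp[OF Suc.prems(2)]])
  have uf: "ctame (c * d) (u \<odot> f)"
    using Suc.prems by (intro ctame_mult) (auto dest: tame_upto_ctame bounded_upto_bounded_by)
  have le: "2 * E \<le> ?D * E" "\<bar>omega l * of_int m\<bar> * E \<le> ?D * E" "1 * E \<le> ?D * E"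
    using E by (intro mult_right_mono; simp)+
  have x: "bounded_upto k (?D * E) (\<lambda>x y. (\<i> * of_real (omega l * of_int m)) * ?g u f x y)"
    by (rule bounded_upto_cmult[OF IH]) (auto simp: norm_mult abs_mult add_pos_nonneg)
  obtain u' f' where u': "has_pd False u u'" "tame_upto (Suc k) c u'" and f': "has_pd False f f'" "bounded_upto k d f'"
    using Suc.prems unfolding tame_upto.simps(2)[of "Suc k"] bounded_upto.simps(2) by meson
  have uf1: "ctame (c * d) (u' \<odot> f)" and uf2: "ctame (c * d) (u \<odot> f')"
    using Suc.prems u' f' by (auto intro!: ctame_mult dest: tame_upto_ctame bounded_upto_bounded_by simp del: tame_upto.simps bounded_upto.simps)
  have "has_pd False (?g u f) (\<lambda>x y. emode m x * fcoef (\<lambda>x y. u' x y * f x y + u x y * f' x y) m y)"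
    by (intro has_pd_mode_y fcoef_pd_y has_pd_mult u' f' ctame_continuous[OF uf] ctame_continuous[OF ctame_add[OF uf1 uf2]])
  also have "(\<lambda>x y. emode m x * fcoef (\<lambda>x y. u' x y * f x y + u x y * f' x y) m y) = (\<lambda>x y. ?g u' f x y + ?g u f' x y)"
    using fcoef_add[OF ctame_tame[OF uf1] ctame_tame[OF uf2]] by (simp add: distrib_left)
  finally have pdy: "has_pd False (?g u f) (\<lambda>x y. ?g u' f x y + ?g u f' x y)" .
  have "bounded_upto k (E + E) (\<lambda>x y. ?g u' f x y + ?g u f' x y)"
    unfolding E_def
    by (intro bounded_upto_add Suc.IH u' f' bounded_upto_Suc_imp[OF Suc.prems(2)] tame_upto_Suc_imp[OF Suc.prems(1)])
  then have y: "bounded_upto k (?D * E) (\<lambda>x y. ?g u' f x y + ?g u f' x y)"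
    by (rule bounded_upto_mono) (use le in simp)
  have "\<exists>h. has_pd e (?g u f) h \<and> bounded_upto k (?D * E) h" for e
    using x y pdy has_pd_mode_x[of m "fcoef (u \<odot> f) m"] by (cases e) auto
  moreover have "bounded_by (?D * E) (?g u f)" using bounded_upto_bounded_by[OF IH] le(3) by (auto intro: bounded_by_mono)
  ultimately have "bounded_upto (Suc k) (?D * E) (?g u f)" by simp
  then show ?case by (simp add: E_def mult.assoc)
qed

end

subsection \<open>Regularity of solutions\<close>

context strip_setup
begin

text \<open>Iterating Y -> B + Y / 2 from any finite X converges to 2 B. Thus qualitative
  boundedness becomes a bound that depends on the source alone.\<close>

lemma sup_halving:
  assumes X: "\<And>x y. norm (f x y :: complex) \<le> X" "0 < X" and B: "0 < B"
    and step: "\<And>Y. 0 < Y \<Longrightarrow> (\<And>x y. norm (f x y) \<le> Y) \<Longrightarrow> (\<And>x y. norm (f x y) \<le> B + Y / 2)"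
  shows "norm (f x y) \<le> 2 * B"
proof -
  have n: "norm (f x y) \<le> 2 * B + X * (1 / 2) ^ n" for n x y
  proof (induction n arbitrary: x y)
    case 0
    then show ?case using X(1)[of x y] B by simp
  next
    case (Suc n)
    have "norm (f x y) \<le> B + (2 * B + X * (1 / 2) ^ n) / 2"
      by (rule step) (use Suc X B in \<open>auto intro!: add_pos_pos mult_pos_pos\<close>)
    then show ?case by (simp add: field_simps)
  qed
  have "(\<lambda>n. 2 * B + X * (1 / 2) ^ n) \<longlonglongrightarrow> 2 * B + X * 0"
    by (intro tendsto_intros LIMSEQ_power_zero) auto
  then have "(\<lambda>n. 2 * B + X * (1 / 2) ^ n) \<longlonglongrightarrow> 2 * B" by simp
  then show ?thesis by (rule tendsto_lowerbound) (auto simp: n)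
qed

lemma bounded_by_tighten: "bounded_by c f \<Longrightarrow> 0 < c' \<Longrightarrow> (\<And>x y. norm (f x y) \<le> c') \<Longrightarrow> bounded_by c' f"
  by (simp add: bounded_by_def)

lemma bounded_by_diff: "bounded_by c f \<Longrightarrow> bounded_by d g \<Longrightarrow> bounded_by (c + d) (\<lambda>x y. f x y - g x y)"
  using bounded_by_add[of c f d "\<lambda>x y. (-1) * g x y"] bounded_by_cmult[of d g 1 "-1"] by simp

lemma green_op_mult_norm_le:
  assumes q: "\<And>c w x y. tame c w \<Longrightarrow> norm (green_op z A w x y) \<le> q * c"
    and u: "ctame cu u" and half: "q * cu \<le> 1 / 2" and f: "bounded_by X f"
  shows "norm (green_op z A (u \<odot> f) x y) \<le> X / 2"
proof -
  have "norm (green_op z A (u \<odot> f) x y) \<le> q * (cu * X)"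
    by (rule q[OF ctame_tame[OF ctame_mult[OF u f]]])
  also have "\<dots> = (q * cu) * X" by simp
  also have "\<dots> \<le> (1 / 2) * X" using half bounded_by_pos[OF f] by (intro mult_right_mono) auto
  finally show ?thesis by simp
qed

lemma apriori_contraction:
  assumes q: "\<And>c w x y. tame c w \<Longrightarrow> norm (green_op z A w x y) \<le> q * c"
    and u: "ctame cu u" and half: "q * cu \<le> 1 / 2"
    and f: "bounded_by X f" and g: "bounded_by B g"
    and eq: "\<And>x y. f x y = g x y + green_op z A (u \<odot> f) x y"
  shows "norm (f x y) \<le> 2 * B"
proof (rule sup_halving[OF bounded_by_norm[OF f] bounded_by_pos[OF f] bounded_by_pos[OF g]])
  fix Y x y assume "0 < Y" "\<And>x y. norm (f x y) \<le> Y"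
  then have "bounded_by Y f" using bounded_by_tighten[OF f] by blast
  from green_op_mult_norm_le[OF q u half this] bounded_by_norm[OF g, of x y]
  show "norm (f x y) \<le> B + Y / 2"
    unfolding eq[of x y] by (intro norm_triangle_le add_mono)
qed

text \<open>The fixed point of the contraction \<open>\<nu> \<mapsto> G + green_op z A (u \<nu>)\<close> inherits the differentiability of \<open>G\<close>:
  the derivatives of the Picard iterates converge geometrically, at a rate between that of the iterates and 1.\<close>

lemma contraction_differentiable:
  assumes z: "z \<in> C_omega l" "A \<subseteq> - {0}"
    and q: "\<And>c w x y. tame c w \<Longrightarrow> norm (green_op z A w x y) \<le> q * c"
    and u: "ctame cu u" "ctame cu u'" "has_pd d u u'" and half: "q * cu \<le> 1 / 2"
    and f: "bounded_by X f" and G: "bounded_by B G" "bounded_by B' G'" "has_pd d G G'"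
    and eq: "\<And>x y. f x y = G x y + green_op z A (u \<odot> f) x y"
  shows "\<exists>f' X'. bounded_by X' f' \<and> has_pd d f f'"
proof -
  let ?S = "green_op z A"
  \<comment> \<open>The iteration runs on pairs of a function and its derivative, so both sequences
    come from one recursion and \<open>has_pd\<close> passes from each step to the next.\<close>
  define it where "it = (\<lambda>p :: (real \<Rightarrow> real \<Rightarrow> complex) \<times> (real \<Rightarrow> real \<Rightarrow> complex).
     ((\<lambda>x y. G x y + ?S (\<lambda>x y. u x y * fst p x y) x y),
      (\<lambda>x y. G' x y + ?S (\<lambda>x y. u' x y * fst p x y + u x y * snd p x y) x y)))"
  define P where "P = (\<lambda>n. (it ^^ n) (\<lambda>x y. 0, \<lambda>x y. 0))"
  define N where "N = (\<lambda>n. fst (P n))"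
  define D where "D = (\<lambda>n. snd (P n))"
  have N0: "N 0 = (\<lambda>x y. 0)" and D0: "D 0 = (\<lambda>x y. 0)" by (simp_all add: N_def D_def P_def)
  have NS: "N (Suc n) = (\<lambda>x y. G x y + ?S (\<lambda>x y. u x y * N n x y) x y)"
    and DS: "D (Suc n) = (\<lambda>x y. G' x y + ?S (\<lambda>x y. u' x y * N n x y + u x y * D n x y) x y)" for n
    by (simp_all add: N_def D_def P_def it_def)
  have inv: "\<exists>a b. bounded_by a (N n) \<and> bounded_by b (D n) \<and> has_pd d (N n) (D n)" for n
  proof (induction n)
    case 0
    have "bounded_by 1 (\<lambda>x y. 0)" by (simp add: bounded_by_def x_periodic_def case_prod_beta')
    then show ?case using has_pd_const by (auto simp: N0 D0)
  next
    case (Suc n)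
    then obtain a b where n: "bounded_by a (N n)" "bounded_by b (D n)" "has_pd d (N n) (D n)" by blast
    note c1 = ctame_mult[OF u(1) n(1)]
    note c2 = ctame_add[OF ctame_mult[OF u(2) n(1)] ctame_mult[OF u(1) n(2)]]
    have "has_pd d (N (Suc n)) (D (Suc n))"
      unfolding NS DS by (rule has_pd_add[OF G(3) green_op_pd[OF z c1 c2 has_pd_mult[OF u(3) n(3)]]])
    moreover note bounded_by_add[OF G(1) green_op_bounded_by[OF z ctame_tame[OF c1]], folded NS]
      bounded_by_add[OF G(2) green_op_bounded_by[OF z ctame_tame[OF c2]], folded DS]
    ultimately show ?case by blast
  qed
  obtain a where a: "bounded_by a (N 1)" using inv by blast
  obtain b0 where b0: "bounded_by b0 (D 1)" using inv by blast
  \<comment> \<open>Gives a <= b / 2, hence (a + b) / 2 <= 3 b / 4: the rate 3/4, weaker than the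
    contraction rate 1/2, absorbs the term in which u' meets the increment of the iterates.\<close>
  define b where "b = b0 + 2 * a"
  have ab: "0 < a" "0 < b" "b0 \<le> b" "2 * a \<le> b"
    using bounded_by_pos[OF a] bounded_by_pos[OF b0] by (auto simp: b_def)
  have dN: "bounded_by (a * (3 / 4) ^ n) (\<lambda>x y. N (Suc n) x y - N n x y)" for n
  proof (induction n)
    case 0
    then show ?case using a by (simp add: N0)
  next
    case (Suc n)
    obtain a1 a2 where n: "bounded_by a1 (N n)" "bounded_by a2 (N (Suc n))" using inv by meson
    obtain a3 where n3: "bounded_by a3 (N (Suc (Suc n)))" using inv by meson
    show ?case
    proof (rule bounded_by_tighten[OF bounded_by_diff[OF n3 n(2)]])
      fix x y
      have "N (Suc (Suc n)) x y - N (Suc n) x y = ?S (\<lambda>x y. u x y * N (Suc n) x y) x y - ?S (\<lambda>x y. u x y * N n x y) x y"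
        by (simp add: NS[of "Suc n"]) (simp add: NS[of n])
      also have "\<dots> = ?S (\<lambda>x y. u x y * N (Suc n) x y - u x y * N n x y) x y"
        by (rule green_op_diff[OF z ctame_tame[OF ctame_mult[OF u(1) n(2)]] ctame_tame[OF ctame_mult[OF u(1) n(1)]], symmetric])
      also have "\<dots> = ?S (\<lambda>x y. u x y * (N (Suc n) x y - N n x y)) x y"
        by (simp add: right_diff_distrib)
      also have "norm \<dots> \<le> (a * (3 / 4) ^ n) / 2"
        by (rule green_op_mult_norm_le[OF q u(1) half Suc])
      also have "\<dots> \<le> a * (3 / 4) ^ Suc n" using ab by simp
      finally show "norm (N (Suc (Suc n)) x y - N (Suc n) x y) \<le> a * (3 / 4) ^ Suc n" .
    qed (use ab in simp)
  qed
  have dD: "bounded_by (b * (3 / 4) ^ n) (\<lambda>x y. D (Suc n) x y - D n x y)" for n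
  proof (induction n)
    case 0
    then show ?case using b0 ab by (simp add: D0 bounded_by_mono)
  next
    case (Suc n)
    obtain a1 b1 where n: "bounded_by a1 (N n)" "bounded_by b1 (D n)" using inv by meson
    obtain a2 b2 where n2: "bounded_by a2 (N (Suc n))" "bounded_by b2 (D (Suc n))" using inv by meson
    obtain b3 where n3: "bounded_by b3 (D (Suc (Suc n)))" using inv by meson
    show ?case
    proof (rule bounded_by_tighten[OF bounded_by_diff[OF n3 n2(2)]])
      fix x y
      let ?W = "\<lambda>n x y. u' x y * N n x y + u x y * D n x y"
      let ?dN = "\<lambda>x y. N (Suc n) x y - N n x y" and ?dD = "\<lambda>x y. D (Suc n) x y - D n x y"
      note t1 = ctame_tame[OF ctame_add[OF ctame_mult[OF u(2) n(1)] ctame_mult[OF u(1) n(2)]]]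
      note t2 = ctame_tame[OF ctame_add[OF ctame_mult[OF u(2) n2(1)] ctame_mult[OF u(1) n2(2)]]]
      have "D (Suc (Suc n)) x y - D (Suc n) x y = ?S (?W (Suc n)) x y - ?S (?W n) x y"
        by (simp add: DS[of "Suc n"]) (simp add: DS[of n])
      also have "\<dots> = ?S (\<lambda>x y. ?W (Suc n) x y - ?W n x y) x y"
        by (rule green_op_diff[OF z t2 t1, symmetric])
      also have "(\<lambda>x y. ?W (Suc n) x y - ?W n x y) = (\<lambda>x y. u' x y * ?dN x y + u x y * ?dD x y)"
        by (simp add: algebra_simps)
      also have "?S \<dots> x y = ?S (\<lambda>x y. u' x y * ?dN x y) x y + ?S (\<lambda>x y. u x y * ?dD x y) x y"
        by (rule green_op_add[OF z ctame_tame[OF ctame_mult[OF u(2) dN]] ctame_tame[OF ctame_mult[OF u(1) Suc]]])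
      also have "norm \<dots> \<le> (a * (3 / 4) ^ n) / 2 + (b * (3 / 4) ^ n) / 2"
        by (intro norm_triangle_le add_mono green_op_mult_norm_le[OF q u(2) half dN] green_op_mult_norm_le[OF q u(1) half Suc])
      also have "\<dots> = (a + b) * (3 / 4) ^ n / 2" by (simp add: algebra_simps)
      also have "\<dots> \<le> (3 / 2 * b) * (3 / 4) ^ n / 2"
        using ab by (intro divide_right_mono mult_right_mono) auto
      also have "\<dots> = b * (3 / 4) ^ Suc n" by simp
      finally show "norm (D (Suc (Suc n)) x y - D (Suc n) x y) \<le> b * (3 / 4) ^ Suc n" .
    qed (use ab in simp)
  qed
  have tele: "(\<Sum>i<n. D (Suc i) x y - D i x y) = D n x y" for n x y
    using sum_lessThan_telescope[of "\<lambda>i. D i x y" n] by (simp add: D0)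
  define L where "L = (\<lambda>x y. \<Sum>i. D (Suc i) x y - D i x y)"
  have lim: "uniform_limit UNIV (\<lambda>n (x, y). D n x y) (\<lambda>(x, y). L x y) sequentially"
  proof -
    have "uniform_limit UNIV (\<lambda>n p. \<Sum>i<n. D (Suc i) (fst p) (snd p) - D i (fst p) (snd p))
       (\<lambda>p. \<Sum>i. D (Suc i) (fst p) (snd p) - D i (fst p) (snd p)) sequentially"
      by (rule Weierstrass_m_test[where M="\<lambda>n. b * (3 / 4) ^ n"])
        (use bounded_by_norm[OF dD] in \<open>auto intro!: summable_mult summable_geometric\<close>)
    then show ?thesis by (simp add: tele L_def case_prod_beta')
  qed
  \<comment> \<open>The iterates start at 0 and converge to the given solution f itself, since the
    distance to it is halved at every step from at most X.\<close>
  have Nlim: "(\<lambda>n. N n x y) \<longlonglongrightarrow> f x y" for x y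
  proof -
    have le: "bounded_by (X * (1 / 2) ^ n) (\<lambda>x y. f x y - N n x y)" for n
    proof (induction n)
      case 0
      then show ?case using f by (simp add: N0)
    next
      case (Suc n)
      obtain a1 a2 where n: "bounded_by a1 (N n)" "bounded_by a2 (N (Suc n))" using inv by meson
      show ?case
      proof (rule bounded_by_tighten[OF bounded_by_diff[OF f n(2)]])
        fix x y
        have "f x y - N (Suc n) x y = ?S (u \<odot> f) x y - ?S (\<lambda>x y. u x y * N n x y) x y"
          by (simp add: NS) (subst eq, simp)
        also have "\<dots> = ?S (\<lambda>x y. u x y * f x y - u x y * N n x y) x y"
          by (rule green_op_diff[OF z ctame_tame[OF ctame_mult[OF u(1) f]] ctame_tame[OF ctame_mult[OF u(1) n(1)]], symmetric])
        also have "\<dots> = ?S (\<lambda>x y. u x y * (f x y - N n x y)) x y"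
          by (simp add: right_diff_distrib)
        also have "norm \<dots> \<le> (X * (1 / 2) ^ n) / 2"
          by (rule green_op_mult_norm_le[OF q u(1) half Suc])
        finally show "norm (f x y - N (Suc n) x y) \<le> X * (1 / 2) ^ Suc n" by simp
      qed (use bounded_by_pos[OF f] in simp)
    qed
    have "(\<lambda>n. X * (1 / 2) ^ n) \<longlonglongrightarrow> X * 0"
      by (intro tendsto_intros LIMSEQ_power_zero) auto
    then have "(\<lambda>n. X * (1 / 2) ^ n) \<longlonglongrightarrow> 0" by simp
    from Lim_null_comparison[OF always_eventually this, of "\<lambda>n. f x y - N n x y"]
    have "(\<lambda>n. f x y - N n x y) \<longlonglongrightarrow> 0" using bounded_by_norm[OF le] by simp
    from tendsto_diff[OF tendsto_const this, of "f x y"] show ?thesis by simp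
  qed
  have pd: "has_pd d f L"
    by (rule has_pd_uniform_limit[OF _ Nlim lim]) (use inv in blast)
  have "continuous2 L"
  proof (rule uniform_limit_theorem[OF _ lim])
    show "\<forall>\<^sub>F n in sequentially. continuous_on UNIV (\<lambda>(x, y). D n x y)"
      using inv by (intro always_eventually allI) (metis bounded_by_continuous)
  qed simp
  moreover have "norm (L x y) \<le> 4 * b" for x y
  proof (rule tendsto_upperbound)
    show "((\<lambda>n. norm (D n x y)) \<longlongrightarrow> norm (L x y)) sequentially"
      using tendsto_uniform_limitI[OF lim, of "(x, y)"] by (intro tendsto_norm) simp
    have "norm (D n x y) \<le> 4 * b" for n
    proof -
      have "norm (D n x y) \<le> (\<Sum>i<n. b * (3 / 4) ^ i)"
        unfolding tele[symmetric, of n x y] by (rule sum_norm_le) (use bounded_by_norm[OF dD] in blast)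
      also have "\<dots> = b * ((1 - (3 / 4) ^ n) * 4)"
        unfolding sum_distrib_left[symmetric] by (simp add: sum_gp_strict)
      also have "\<dots> \<le> 4 * b" using ab by (simp add: mult_left_le)
      finally show ?thesis .
    qed
    then show "\<forall>\<^sub>F n in sequentially. norm (D n x y) \<le> 4 * b" by simp
  qed simp
  ultimately have "bounded_by (4 * b) L"
    using ab has_pd_periodic[OF bounded_by_periodic[OF f] pd] by (simp add: bounded_by_def)
  with pd show ?thesis by blast
qed

section \<open>Low modes, contractive high modes, and regularity of solutions\<close>

text \<open>M bounds |m| and Z bounds |z|. The first summand bounds the source of the mode equation,
  the second the multiples of the mode itself that differentiation produces.\<close>

definition low_const :: "nat \<Rightarrow> real \<Rightarrow> real \<Rightarrow> real \<Rightarrow> real" where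
  "low_const k M Z c = (2 + omega l * M) ^ k * (c / l) + (omega l * M * (omega l * M + 2 * Z) + omega l * M + 2) * (green_bound * (4 ^ k * c))"

text \<open>A derivative is gained: f has order k, the mode order k + 1. Its x-derivative is a
  multiple of the mode, its y-derivative comes from \<open>green_op_mode_pd_y\<close>; the factor
  \<open>bsym z m\<close> there ties the bound to bounded z.\<close>

lemma low_mode_bounded_upto:
  assumes z: "z \<in> C_omega l" "norm z \<le> Z" and m: "m \<noteq> 0" "\<bar>of_int m\<bar> \<le> M"
    and u: "tame_upto (Suc k) c u" and f: "bounded_upto k d f"
  shows "bounded_upto (Suc k) (low_const k M Z (c * d)) (green_op z {m} (u \<odot> f))"
proof -
  let ?w = "\<lambda>x y. u x y * f x y" and ?o = "\<bar>omega l * of_int m\<bar>"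
  have cd: "0 < c * d" using u f by (auto dest!: tame_upto_ctame bounded_upto_bounded_by bounded_by_pos ctame_pos simp del: tame_upto.simps)
  have MZ: "0 \<le> M" "0 \<le> Z" using m z norm_ge_zero order_trans abs_ge_zero by metis+
  have o: "?o \<le> omega l * M" using m omega_pos by (simp add: abs_mult)
  have oM: "0 \<le> omega l * M" using MZ omega_pos by simp
  define P where "P = (2 + ?o) ^ k * (c * d / l)"
  define T where "T = green_bound * (4 ^ k * (c * d))"
  \<comment> \<open>The summand 1 makes K positive, as \<open>bounded_upto_cmult\<close>
    requires.\<close>
  define K where "K = omega l * M * (omega l * M + 2 * Z) + 1"
  have T: "0 < T" using cd green_bound by (simp add: T_def)
  have P: "0 < P" using cd l_pos by (simp add: P_def add_pos_nonneg)
  have K: "0 < K" using oM MZ by (simp add: K_def add_nonneg_pos)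
  have PE: "P \<le> (2 + omega l * M) ^ k * (c * d / l)"
    unfolding P_def using o cd l_pos by (intro mult_right_mono power_mono) auto
  have E: "low_const k M Z (c * d) = (2 + omega l * M) ^ k * (c * d / l) + (K + omega l * M + 1) * T"
    by (simp add: low_const_def K_def T_def algebra_simps)
  have bK: "norm (- bsym z m) \<le> K"
  proof -
    have "norm (bsym z m) = ?o * norm (of_real (omega l * of_int m) + 2 * z)"
      by (simp add: bsym_eq norm_mult abs_mult)
    also have "\<dots> \<le> (omega l * M) * (omega l * M + 2 * Z)"
    proof (intro mult_mono o)
      have "norm (of_real (omega l * of_int m) + 2 * z) \<le> norm (of_real (omega l * of_int m) :: complex) + norm (2 * z)"
        by (rule norm_triangle_ineq)
      also have "\<dots> = ?o + 2 * norm z" unfolding norm_of_real norm_mult by simp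
      finally show "norm (of_real (omega l * of_int m) + 2 * z) \<le> omega l * M + 2 * Z" using o z by simp
    qed (use oM in auto)
    finally show ?thesis by (simp add: K_def)
  qed
  have w: "tame_upto k (4 ^ k * (c * d)) ?w" by (rule tame_upto_mult[OF tame_upto_Suc_imp[OF u] f])
  have TB: "bounded_upto k T (green_op z {m} ?w)"
    unfolding T_def by (rule green_op_bounded_upto[OF z(1) _ w]) (use m in auto)
  have le1: "(?o + 1) * T \<le> low_const k M Z (c * d)"
  proof -
    have "(?o + 1) * T \<le> (K + omega l * M + 1) * T" using o K T by (intro mult_right_mono) auto
    then show ?thesis using PE P unfolding E by linarith
  qed
  have le2: "P + K * T \<le> low_const k M Z (c * d)"
  proof -
    have "K * T \<le> (K + omega l * M + 1) * T" using oM K T by (intro mult_right_mono) auto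
    then show ?thesis using PE unfolding E by linarith
  qed
  have x: "bounded_upto k (low_const k M Z (c * d)) (\<lambda>x y. (\<i> * of_real (omega l * of_int m)) * green_op z {m} ?w x y)"
    by (rule bounded_upto_mono[OF bounded_upto_cmult[OF TB, of "?o + 1"] le1]) (auto simp: norm_mult abs_mult intro!: add_nonneg_pos)
  have y: "bounded_upto k (low_const k M Z (c * d)) (\<lambda>x y. emode m x * fcoef ?w m y + (- bsym z m) * green_op z {m} ?w x y)"
    by (rule bounded_upto_mono[OF bounded_upto_add[OF bounded_upto_mode_coefficient[OF u f, of m, folded P_def] bounded_upto_cmult[OF TB K bK]] le2])
  have "\<exists>h. has_pd e (green_op z {m} ?w) h \<and> bounded_upto k (low_const k M Z (c * d)) h" for e
    using x y green_op_mode_pd_x[of z m ?w] green_op_mode_pd_y[OF z(1) m(1) tame_upto_ctame[OF w]] by (cases e) auto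
  moreover have "bounded_by (low_const k M Z (c * d)) (green_op z {m} ?w)"
  proof (rule bounded_by_mono[OF bounded_upto_bounded_by[OF TB]])
    have "1 * T \<le> (?o + 1) * T" using T by (intro mult_right_mono) auto
    then show "T \<le> low_const k M Z (c * d)" using le1 by simp
  qed
  ultimately show ?thesis by simp
qed

lemma low_modes_bounded_upto:
  assumes z: "z \<in> C_omega l" "norm z \<le> Z" and L: "finite L" "\<And>m. m \<in> L \<Longrightarrow> m \<noteq> 0 \<and> \<bar>of_int m\<bar> \<le> M" "0 \<le> M"
    and u: "tame_upto (Suc k) c u" and f: "bounded_upto k d f"
  shows "bounded_upto (Suc k) ((real (card L) + 1) * low_const k M Z (c * d)) (green_op z L (u \<odot> f))"
proof -
  have cd: "0 < c * d" using u f by (auto dest!: tame_upto_ctame bounded_upto_bounded_by bounded_by_pos ctame_pos simp del: tame_upto.simps)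
  have oM: "0 \<le> omega l * M" and Z: "0 \<le> Z"
    using L(3) omega_pos order_trans[OF norm_ge_zero z(2)] by auto
  define e where "e = c * d"
  have "0 < (2 + omega l * M) ^ k * (e / l)"
    using cd l_pos oM by (intro mult_pos_pos zero_less_power add_pos_nonneg divide_pos_pos) (auto simp: e_def)
  moreover have "0 \<le> (omega l * M * (omega l * M + 2 * Z) + omega l * M + 2) * (green_bound * (4 ^ k * e))"
    using oM Z green_bound cd by (intro mult_nonneg_nonneg[of "_ + _"] add_nonneg_nonneg mult_nonneg_nonneg[OF oM]) (auto simp: e_def)
  ultimately have pos: "0 < low_const k M Z (c * d)"
    unfolding low_const_def e_def by (rule add_pos_nonneg)
  have "bounded_upto (Suc k) ((real (card L) + 1) * low_const k M Z (c * d)) (\<lambda>x y. \<Sum>m\<in>L. green_op z {m} (u \<odot> f) x y)"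
    by (rule bounded_upto_sum[OF L(1) pos low_mode_bounded_upto[OF z _ _ u f]]) (use L in auto)
  also have "(\<lambda>x y. \<Sum>m\<in>L. green_op z {m} (u \<odot> f) x y) = green_op z L (u \<odot> f)"
    using L(1) by (intro ext) (simp add: green_op_finite)
  finally show ?thesis .
qed

lemma high_modes_small:
  assumes "0 < q"
  obtains N where "0 < N"
    "\<And>z A c w x y. z \<in> C_omega l \<Longrightarrow> (\<And>m. m \<in> A \<Longrightarrow> int N \<le> \<bar>m\<bar> \<and> m \<notin> resonant z) \<Longrightarrow> tame c w \<Longrightarrow> norm (green_op z A w x y) \<le> q * c"
proof -
  \<comment> \<open>With total weight s = 2 l q^2 the bound sqrt (s / (2 l)) of
    \<open>green_op_norm_le_mode_weight\<close> is exactly q.\<close>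
  have e: "0 < 2 * l * q\<^sup>2" using assms l_pos by simp
  obtain N where N: "0 < N"
    "\<And>z F. finite F \<Longrightarrow> (\<And>m. m \<in> F \<Longrightarrow> int N \<le> \<bar>m\<bar> \<and> m \<notin> resonant z) \<Longrightarrow> (\<Sum>m\<in>F. mode_weight z m) \<le> 2 * l * q\<^sup>2"
    using mode_weight_tail[OF e] by metis
  show ?thesis
  proof
    show "0 < N" by fact
    fix z and A :: "int set" and c :: real and w x y
    assume z: "z \<in> C_omega l" and A: "\<And>m. m \<in> A \<Longrightarrow> int N \<le> \<bar>m\<bar> \<and> m \<notin> resonant z" and w: "tame c w"
    have "A \<subseteq> - {0}" using A N(1) by force
    then have "norm (green_op z A w x y) \<le> sqrt (2 * l * q\<^sup>2 / (2 * l)) * c"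
      by (rule green_op_norm_le_mode_weight[OF z _ w e N(2)]) (use A in auto)
    also have "sqrt (2 * l * q\<^sup>2 / (2 * l)) = q" using assms l_pos by simp
    finally show "norm (green_op z A w x y) \<le> q * c" .
  qed
qed

text \<open>Purely qualitative, at a fixed z. The finitely many modes outside H, the resonant one
  among them, are moved into the source. That source involves f itself, but it has order 1 because
  low modes gain a derivative; what remains is a contraction.\<close>

lemma solution_differentiable:
  assumes z: "z \<in> C_omega l" "A \<subseteq> - {0}" and u: "tame_upto 1 cu u" and f: "bounded_by X f" and g: "bounded_upto 1 B g"
    and eq: "\<And>x y. f x y = g x y + green_op z A (u \<odot> f) x y"
  shows "\<exists>f' X'. bounded_by X' f' \<and> has_pd d f f'"
proof -
  have cu: "0 < cu" using u by (auto dest: ctame_pos)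
  have q: "0 < 1 / (2 * cu)" using cu by simp
  obtain N where N: "0 < N"
    "\<And>z A c w x y. z \<in> C_omega l \<Longrightarrow> (\<And>m. m \<in> A \<Longrightarrow> int N \<le> \<bar>m\<bar> \<and> m \<notin> resonant z) \<Longrightarrow> tame c w \<Longrightarrow> norm (green_op z A w x y) \<le> 1 / (2 * cu) * c"
    using high_modes_small[OF q] by metis
  define H where "H = {m\<in>A. int N \<le> \<bar>m\<bar> \<and> m \<notin> resonant z}"
  define L where "L = A - H"
  have "L \<subseteq> {- int N..int N} \<union> resonant z" by (auto simp: L_def H_def)
  then have L: "finite L" by (rule finite_subset) simp
  define M where "M = real_of_int (Max (insert 0 (abs ` L)))"
  have M: "0 \<le> M" "\<And>m. m \<in> L \<Longrightarrow> m \<noteq> 0 \<and> \<bar>of_int m\<bar> \<le> M"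
  proof -
    show "0 \<le> M" using L by (simp add: M_def)
    fix m assume "m \<in> L"
    moreover from this have "\<bar>m\<bar> \<le> Max (insert 0 (abs ` L))" using L by (intro Max_ge) auto
    ultimately show "m \<noteq> 0 \<and> \<bar>of_int m\<bar> \<le> M" using z by (auto simp: M_def L_def simp flip: of_int_abs)
  qed
  have f0: "bounded_upto 0 X f" using f by simp
  have uf: "ctame (cu * X) (u \<odot> f)" by (rule ctame_mult[OF tame_upto_ctame[OF u] f])
  note low = low_modes_bounded_upto[OF z(1) order_refl L M(2,1) u[unfolded One_nat_def] f0]
  note G = bounded_upto_add[OF g[unfolded One_nat_def] low]
  have split: "f x y = (g x y + green_op z L (u \<odot> f) x y) + green_op z H (u \<odot> f) x y" for x y
  proof -
    have "A = L \<union> H" "L \<inter> H = {}" by (auto simp: L_def H_def)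
    then show ?thesis
      using eq[of x y] green_op_Un[OF z(1) _ _ _ ctame_tame[OF uf], of L H x y] z(2) by (auto simp: L_def H_def)
  qed
  obtain G' where G': "has_pd d (\<lambda>x y. g x y + green_op z L (u \<odot> f) x y) G'"
    "bounded_upto 0 (B + (real (card L) + 1) * low_const 0 M (norm z) (cu * X)) G'"
    using G by auto
  obtain u' where u': "has_pd d u u'" "ctame cu u'" using u by auto
  show ?thesis
  proof (rule contraction_differentiable[OF z(1) _ _ tame_upto_ctame[OF u] u'(2,1) _ f bounded_upto_bounded_by[OF G] G'(2)[unfolded bounded_upto.simps] G'(1) split])
    show "H \<subseteq> - {0}" using z(2) by (auto simp: H_def)
    show "norm (green_op z H w x y) \<le> 1 / (2 * cu) * c" if "tame c w" for c w x y
      by (rule N(2)[OF z(1) _ that]) (simp add: H_def)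
    show "1 / (2 * cu) * cu \<le> 1 / 2" using cu by simp
  qed
qed

text \<open>In the product rule the term with u' f joins the source, so f' solves the same equation
  with a new source that contains no derivative of f.\<close>

lemma solution_derivative_equation:
  assumes z: "z \<in> C_omega l" "A \<subseteq> - {0}"
    and u: "ctame c u" "ctame c u'" "has_pd d u u'" and f: "bounded_by X f" "bounded_by X' f'" "has_pd d f f'"
    and g: "has_pd d g g'"
    and eq: "\<And>x y. f x y = g x y + green_op z A (u \<odot> f) x y"
  shows "f' x y = (g' x y + green_op z A (u' \<odot> f) x y) + green_op z A (u \<odot> f') x y"
proof -
  note c1 = ctame_mult[OF u(2) f(1)] and c2 = ctame_mult[OF u(1) f(2)]
  have fe: "(\<lambda>x y. g x y + green_op z A (u \<odot> f) x y) = f" by (intro ext) (rule eq[symmetric])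
  have "has_pd d (\<lambda>x y. g x y + green_op z A (u \<odot> f) x y)
      (\<lambda>x y. g' x y + green_op z A (\<lambda>x y. u' x y * f x y + u x y * f' x y) x y)"
    by (rule has_pd_add[OF g green_op_pd[OF z ctame_mult[OF u(1) f(1)] ctame_add[OF c1 c2] has_pd_mult[OF u(3) f(3)]]])
  then have "has_pd d f (\<lambda>x y. g' x y + green_op z A (\<lambda>x y. u' x y * f x y + u x y * f' x y) x y)"
    unfolding fe .
  from fun_cong[OF fun_cong[OF has_pd_unique[OF f(3) this]], of x y]
  have "f' x y = g' x y + green_op z A (\<lambda>x y. u' x y * f x y + u x y * f' x y) x y" .
  also have "green_op z A (\<lambda>x y. u' x y * f x y + u x y * f' x y) x y = green_op z A (u' \<odot> f) x y + green_op z A (u \<odot> f') x y"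
    by (rule green_op_add[OF z ctame_tame[OF c1] ctame_tame[OF c2]])
  finally show ?thesis by (simp only: add.assoc)
qed

text \<open>A sup-norm bound that is uniform over a family \<open>\<F>\<close> of pairs \<open>(z, A)\<close> propagates to all derivatives,
  since these solve equations of the same form.\<close>

lemma regularity:
  assumes fam: "\<And>z A. (z, A) \<in> \<F> \<Longrightarrow> z \<in> C_omega l \<and> A \<subseteq> - {0}"
    and apriori: "\<And>z A f g X B x y. (z, A) \<in> \<F> \<Longrightarrow> bounded_by X f \<Longrightarrow> bounded_by B g \<Longrightarrow>
       (\<And>x y. f x y = g x y + green_op z A (u \<odot> f) x y) \<Longrightarrow> norm (f x y) \<le> K * B"
    and K: "0 < K"
  shows "tame_upto k cu u \<Longrightarrow> \<exists>C. \<forall>z A f g X. (z, A) \<in> \<F> \<longrightarrow> bounded_by X f \<longrightarrow> bounded_upto k c g \<longrightarrow>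
       (\<forall>x y. f x y = g x y + green_op z A (u \<odot> f) x y) \<longrightarrow> bounded_upto k C f"
proof (induction k arbitrary: c)
  case 0
  show ?case
  proof (intro exI[of _ "K * c"] allI impI)
    fix z A f g X
    assume *: "(z, A) \<in> \<F>" "bounded_by X f" "bounded_upto 0 c g" "\<forall>x y. f x y = g x y + green_op z A (u \<odot> f) x y"
    have g: "bounded_by c g" using *(3) by simp
    show "bounded_upto 0 (K * c) f"
      unfolding bounded_upto.simps
      by (rule bounded_by_tighten[OF *(2) mult_pos_pos[OF K bounded_by_pos[OF g]] apriori[OF *(1,2) g *(4)[rule_format]]])
  qed
next
  case (Suc k)
  have uk: "tame_upto k cu u" by (rule tame_upto_Suc_imp[OF Suc.prems])
  from Suc.IH[OF uk, of c] obtain C0 where "\<forall>z A f g X. (z, A) \<in> \<F> \<longrightarrow> bounded_by X f \<longrightarrow> bounded_upto k c g \<longrightarrow>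
       (\<forall>x y. f x y = g x y + green_op z A (u \<odot> f) x y) \<longrightarrow> bounded_upto k C0 f" ..
  note C0 = this[rule_format]
  \<comment> \<open>Bounds the source of the differentiated equation: c for g', the rest for the
    term with u' f, where f is under control to order k by C0. The induction is over arbitrary c
    because of this change of source.\<close>
  define c1 where "c1 = c + green_bound * (4 ^ k * (cu * C0))"
  from Suc.IH[OF uk, of c1] obtain C1 where "\<forall>z A f g X. (z, A) \<in> \<F> \<longrightarrow> bounded_by X f \<longrightarrow> bounded_upto k c1 g \<longrightarrow>
       (\<forall>x y. f x y = g x y + green_op z A (u \<odot> f) x y) \<longrightarrow> bounded_upto k C1 f" ..
  note C1 = this[rule_format]
  show ?case
  proof (intro exI[of _ "max C0 C1"] allI impI)
    fix z A f g X
    assume *: "(z, A) \<in> \<F>" "bounded_by X f" "bounded_upto (Suc k) c g" and eq: "\<forall>x y. f x y = g x y + green_op z A (u \<odot> f) x y"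
    have z: "z \<in> C_omega l" "A \<subseteq> - {0}" using fam[OF *(1)] by auto
    have f0: "bounded_upto k C0 f" by (rule C0[OF *(1,2) bounded_upto_Suc_imp[OF *(3)] eq[rule_format]])
    have "\<exists>f'. has_pd d f f' \<and> bounded_upto k (max C0 C1) f'" for d
    proof -
      have "tame_upto 1 cu u" "bounded_upto 1 c g" using tame_upto_antimono[OF Suc.prems, of 1] bounded_upto_antimono[OF *(3), of 1] by linarith+
      then obtain f' X' where f': "bounded_by X' f'" "has_pd d f f'"
        using solution_differentiable[OF z _ *(2) _ eq[rule_format]] by meson
      obtain u' where u': "has_pd d u u'" "tame_upto k cu u'" using Suc.prems by auto
      obtain g' where g': "has_pd d g g'" "bounded_upto k c g'" using *(3) by auto
      have "bounded_upto k c1 (\<lambda>x y. g' x y + green_op z A (u' \<odot> f) x y)"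
        unfolding c1_def by (rule bounded_upto_add[OF g'(2) green_op_bounded_upto[OF z tame_upto_mult[OF u'(2) f0]]])
      moreover have "f' x y = (g' x y + green_op z A (u' \<odot> f) x y) + green_op z A (u \<odot> f') x y" for x y
        by (rule solution_derivative_equation[OF z tame_upto_ctame[OF uk] tame_upto_ctame[OF u'(2)] u'(1) *(2) f' g'(1) eq[rule_format]])
      ultimately have "bounded_upto k C1 f'" by (rule C1[OF *(1) f'(1)])
      then show ?thesis using f'(2) bounded_upto_mono max.cobounded2 by blast
    qed
    moreover have "bounded_by (max C0 C1) f" using bounded_upto_bounded_by[OF f0] bounded_by_mono max.cobounded1 by blast
    ultimately show "bounded_upto (Suc k) (max C0 C1) f" by simp
  qed
qed

text \<open>For |z| <= Z the resonant index is bounded, so a single finite set L serves all z. If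
  the solution has order k, its modes in L have order k + 1, and \<open>regularity\<close> with the
  contractive modes H lifts the solution to that order.\<close>

lemma regularity_bounded_z:
  assumes \<mu>: "\<And>z. z \<in> C_omega l \<Longrightarrow> bounded_by X (\<mu> z)"
    and eq: "\<And>z x y. z \<in> C_omega l \<Longrightarrow> \<mu> z x y = 1 + green_op z (- {0}) (u \<odot> (\<mu> z)) x y"
  shows "tame_upto k cu u \<Longrightarrow> \<exists>C. \<forall>z\<in>C_omega l. norm z \<le> Z \<longrightarrow> bounded_upto k C (\<mu> z)"
proof (induction k)
  case 0
  then show ?case using \<mu> by auto
next
  case (Suc k)
  obtain C0 where C0: "\<And>z. z \<in> C_omega l \<Longrightarrow> norm z \<le> Z \<Longrightarrow> bounded_upto k C0 (\<mu> z)"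
    using Suc.IH[OF tame_upto_Suc_imp[OF Suc.prems]] by blast
  have cu: "0 < cu" using ctame_pos[OF tame_upto_ctame[OF Suc.prems]] .
  then have q: "0 < 1 / (2 * cu)" by simp
  obtain N0 where N0: "0 < N0"
    "\<And>z A c w x y. z \<in> C_omega l \<Longrightarrow> (\<And>m. m \<in> A \<Longrightarrow> int N0 \<le> \<bar>m\<bar> \<and> m \<notin> resonant z) \<Longrightarrow> tame c w \<Longrightarrow> norm (green_op z A w x y) \<le> 1 / (2 * cu) * c"
    using high_modes_small[OF q] by metis
  \<comment> \<open>From |m| >= N1 on, |m + 2 Re z / omega| >= 1, so m cannot be resonant.\<close>
  obtain N1 :: nat where N1: "2 * Z / omega l + 1 \<le> real N1" using real_arch_simple by blast
  define N where "N = N0 + N1"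
  define H where "H = {m::int. int N \<le> \<bar>m\<bar>}"
  define L where "L = {m::int. m \<noteq> 0 \<and> \<bar>m\<bar> < int N}"
  have LH: "L \<union> H = - {0}" "L \<inter> H = {}" "L \<subseteq> - {0}" "H \<subseteq> - {0}" using N0(1) by (auto simp: L_def H_def N_def)
  have L: "finite L" by (rule finite_subset[of _ "{- int N..int N}"]) (auto simp: L_def)
  have Lb: "m \<noteq> 0 \<and> \<bar>of_int m\<bar> \<le> real N" if "m \<in> L" for m
    using that by (auto simp: L_def)
  have Hq: "norm (green_op z H w x y) \<le> 1 / (2 * cu) * c" if z: "z \<in> C_omega l" "norm z \<le> Z" and w: "tame c w" for z c w x y
  proof (rule N0(2)[OF z(1) _ w])
    fix m assume m: "m \<in> H"
    have "\<bar>2 * Re z / omega l\<bar> \<le> 2 * Z / omega l"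
      using abs_Re_le_cmod[of z] z omega_pos by (simp add: abs_mult divide_right_mono)
    moreover have "real N1 \<le> \<bar>real_of_int m\<bar>" using m by (simp add: H_def N_def)
    ultimately have "1 \<le> \<bar>of_int m + 2 * Re z / omega l\<bar>" using N1 by linarith
    then show "int N0 \<le> \<bar>m\<bar> \<and> m \<notin> resonant z" using m by (auto simp: resonant_def H_def N_def)
  qed
  define \<F> where "\<F> = {(z, A). z \<in> C_omega l \<and> norm z \<le> Z \<and> A = H}"
  define c where "c = 1 + (real (card L) + 1) * low_const k (real N) Z (cu * C0)"
  have "\<exists>C. \<forall>z A f g X. (z, A) \<in> \<F> \<longrightarrow> bounded_by X f \<longrightarrow> bounded_upto (Suc k) c g \<longrightarrow>
       (\<forall>x y. f x y = g x y + green_op z A (u \<odot> f) x y) \<longrightarrow> bounded_upto (Suc k) C f"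
  proof (rule regularity[OF _ _ _ Suc.prems])
    show "z \<in> C_omega l \<and> A \<subseteq> - {0}" if "(z, A) \<in> \<F>" for z A using that LH by (auto simp: \<F>_def)
    show "norm (f x y) \<le> 2 * B"
      if "(z, A) \<in> \<F>" "bounded_by X f" "bounded_by B g" "\<And>x y. f x y = g x y + green_op z A (u \<odot> f) x y" for z A f g X B x y
    proof (rule apriori_contraction[OF _ tame_upto_ctame[OF Suc.prems] _ that(2-4)])
      show "norm (green_op z A w x y) \<le> 1 / (2 * cu) * c" if "tame c w" for c w x y
        using Hq[OF _ _ that] \<open>(z, A) \<in> \<F>\<close> by (simp add: \<F>_def)
      show "1 / (2 * cu) * cu \<le> 1 / 2" using cu by simp
    qed
  qed simp
  then obtain C where "\<forall>z A f g X. (z, A) \<in> \<F> \<longrightarrow> bounded_by X f \<longrightarrow> bounded_upto (Suc k) c g \<longrightarrow>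
       (\<forall>x y. f x y = g x y + green_op z A (u \<odot> f) x y) \<longrightarrow> bounded_upto (Suc k) C f" ..
  note C = this[rule_format]
  have "bounded_upto (Suc k) C (\<mu> z)" if z: "z \<in> C_omega l" "norm z \<le> Z" for z
  proof (rule C)
    show "(z, H) \<in> \<F>" using z by (simp add: \<F>_def)
    show "bounded_by X (\<mu> z)" by (rule \<mu>[OF z(1)])
    show "bounded_upto (Suc k) c (\<lambda>x y. 1 + green_op z L (u \<odot> (\<mu> z)) x y)"
      unfolding c_def
      by (rule bounded_upto_add[OF bounded_upto_const low_modes_bounded_upto[OF z L Lb _ Suc.prems C0[OF z]]]) auto
    have t: "tame (cu * X) (u \<odot> (\<mu> z))"
      by (rule ctame_tame[OF ctame_mult[OF tame_upto_ctame[OF Suc.prems] \<mu>[OF z(1)]]])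
    show "\<mu> z x y = 1 + green_op z L (u \<odot> (\<mu> z)) x y + green_op z H (u \<odot> (\<mu> z)) x y" for x y
    proof -
      have h1: "\<mu> z x y = 1 + green_op z (L \<union> H) (u \<odot> (\<mu> z)) x y"
        unfolding LH(1) by (rule eq[OF z(1)])
      have h2: "green_op z (L \<union> H) (u \<odot> (\<mu> z)) x y = green_op z L (u \<odot> (\<mu> z)) x y + green_op z H (u \<odot> (\<mu> z)) x y"
        by (rule green_op_Un[OF z(1) LH(3,4,2) t])
      from h1 show ?thesis unfolding h2 add.assoc .
    qed
  qed
  then show ?case by blast
qed

end

subsection \<open>Large spectral parameters\<close>

lemma integrable_times_bounded:
  fixes a b :: "real \<Rightarrow> complex"
  assumes a: "integrable lborel a" and b: "b \<in> borel_measurable borel" "\<And>y. norm (b y) \<le> B"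
  shows "integrable lborel (\<lambda>y. a y * b y)"
    and "(LINT y|lborel. norm (a y * b y)) \<le> B * (LINT y|lborel. norm (a y))"
proof -
  have B: "0 \<le> B" using b(2)[of 0] norm_ge_zero order_trans by blast
  have le: "norm (a y * b y) \<le> B * norm (a y)" for y
    using b(2)[of y] by (simp add: norm_mult mult.commute[of B] mult_left_mono)
  have i: "integrable lborel (\<lambda>y. B * norm (a y))" using a by simp
  show ab: "integrable lborel (\<lambda>y. a y * b y)"
    by (rule Bochner_Integration.integrable_bound[OF i]) (use a b(1) le B in \<open>auto simp: abs_mult\<close>)
  have "(LINT y|lborel. norm (a y * b y)) \<le> (LINT y|lborel. B * norm (a y))"
    by (rule integral_mono[OF integrable_norm[OF ab] i le])
  then show "(LINT y|lborel. norm (a y * b y)) \<le> B * (LINT y|lborel. norm (a y))" by simp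
qed

context strip_setup
begin

lemma bsym_diff:
  "bsym z m - bsym z n = of_real (omega l * of_int (m - n)) * (2 * z + of_real (omega l * of_int (m + n)))"
  by (simp add: bsym_eq algebra_simps)

text \<open>Integration by parts in \<open>y\<close>: the coupling of two distinct modes through \<open>u\<close> oscillates with
  frequency \<open>bsym z m - bsym z n\<close>.\<close>

lemma mode_coupling_bound:
  assumes z: "z \<in> C_omega l" "m \<noteq> 0" "n \<noteq> 0"
    and u: "ctame c u" "ctame c u'" "has_pd False u u'" and h: "ctame d h"
  shows "norm (bsym z m - bsym z n) * norm (conv (bsym z m) (\<lambda>y. conv (bsym z n) (fcoef h n) y * fcoef u k y) y) \<le> 3 * (d * c / (2 * l\<^sup>2))"
proof -
  let ?a = "bsym z m" and ?b = "bsym z n"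
  define p where "p = conv ?b (fcoef h n)"
  define v where "v = fcoef u k"
  define v' where "v' = fcoef u' k"
  define g where "g = (\<lambda>y. p y * v y)"
  define P where "P = d / (2 * l)"
  define V where "V = c / l"
  have cd: "0 < c" "0 < d" using ctame_pos u h by auto
  have PV: "0 < P" "0 < V" using cd l_pos by (auto simp: P_def V_def)
  have ab: "Re ?a \<noteq> 0" "Re ?b \<noteq> 0" using Re_bsym_nonzero z by auto
  have hi: "integrable lborel (fcoef h n)" "continuous_on UNIV (fcoef h n)" "(LINT y|lborel. norm (fcoef h n y)) \<le> P"
    unfolding P_def using fcoef_integrable[OF ctame_tame[OF h]] continuous_on_fcoef[OF ctame_continuous[OF h]] by auto
  have vi: "integrable lborel v" "continuous_on UNIV v" and v'i: "integrable lborel v'" "continuous_on UNIV v'" "(LINT y|lborel. norm (v' y)) \<le> V"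
    unfolding v_def v'_def V_def
    using fcoef_integrable[OF ctame_tame[OF u(1)]] continuous_on_fcoef[OF ctame_continuous[OF u(1)]]
      fcoef_integrable[OF ctame_tame[OF u(2)], of k] continuous_on_fcoef[OF ctame_continuous[OF u(2)]] cd l_pos
    by (auto simp: field_simps intro: order_trans)
  have vb: "norm (v y) \<le> V" for y
    using fcoef_bounded[OF u, of k y] l_pos by (simp add: v_def V_def field_simps)
  have pb: "norm (p y) \<le> P" for y
    using order_trans[OF norm_conv_le[OF hi(1), of ?b y] hi(3)] by (simp add: p_def)
  have pc: "continuous_on UNIV p" unfolding p_def by (rule continuous_on_conv[OF hi(1) ab(2)])
  have pd: "(p has_vector_derivative fcoef h n y - ?b * p y) (at y)" for y
    unfolding p_def by (rule conv_has_vector_derivative[OF hi(1,2) ab(2)])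
  have vd: "(v has_vector_derivative v' y) (at y)" for y
    unfolding v_def v'_def by (rule fcoef_pd_y[OF u(3) ctame_continuous[OF u(1)] ctame_continuous[OF u(2)]])
  have meas: "p \<in> borel_measurable borel" "v \<in> borel_measurable borel"
    using pc vi(2) by (auto intro: borel_measurable_continuous_onI)
  have hv: "integrable lborel (\<lambda>y. fcoef h n y * v y)" "(LINT y|lborel. norm (fcoef h n y * v y)) \<le> P * V"
    using integrable_times_bounded[OF hi(1) meas(2) vb] mult_left_mono[OF hi(3) less_imp_le[OF PV(2)]]
    by (auto simp: mult.commute[of P] intro: order_trans)
  have v'p: "integrable lborel (\<lambda>y. v' y * p y)" "(LINT y|lborel. norm (v' y * p y)) \<le> P * V"
    using integrable_times_bounded[OF v'i(1) meas(1) pb] mult_left_mono[OF v'i(3) less_imp_le[OF PV(1)]]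
    by (auto intro: order_trans)
  have gi: "integrable lborel g"
    using integrable_times_bounded(1)[OF vi(1) meas(1) pb] by (simp add: g_def mult.commute)
  have gb: "norm (g y) \<le> P * V" for y
    unfolding g_def norm_mult using pb vb PV by (intro mult_mono) auto
  \<comment> \<open>The part of the derivative of g in which no symbol occurs; its L1 norm is at
    most 2 P V whatever z is. With the sup bound P V for g this makes up the factor 3.\<close>
  define w where "w = (\<lambda>y. fcoef h n y * v y + v' y * p y)"
  have wi: "integrable lborel w" unfolding w_def using hv(1) v'p(1) by simp
  have gd: "(g has_vector_derivative w y + (- ?b) * g y) (at y)" for y
    unfolding g_def
    by (rule has_vector_derivative_eq_rhs[OF has_vector_derivative_mult[OF pd vd]]) (simp add: w_def algebra_simps)
  have "conv ?a (\<lambda>y. w y + (- ?b) * g y) y = g y - ?a * conv ?a g y"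
  proof (rule conv_deriv_eq[OF gi gd gb _ _ ab(1)])
    show "integrable lborel (\<lambda>y. w y + (- ?b) * g y)" using wi gi by simp
    show "continuous_on UNIV (\<lambda>y. w y + (- ?b) * g y)"
      unfolding w_def g_def by (intro continuous_intros hi vi v'i pc)
  qed
  moreover have "conv ?a (\<lambda>y. w y + (- ?b) * g y) y = conv ?a w y + (- ?b) * conv ?a g y"
    using conv_add[OF wi, of "\<lambda>y. (- ?b) * g y" ?a y] gi conv_cmult[of ?a "- ?b" g y] by simp
  ultimately have "g y - ?a * conv ?a g y = conv ?a w y + (- ?b) * conv ?a g y" by simp
  \<comment> \<open>The two large symbols appear only through their difference, multiplied by the
    quantity to be estimated.\<close>
  then have "(?a - ?b) * conv ?a g y = g y - conv ?a w y" by (simp add: algebra_simps)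
  then have "norm (?a - ?b) * norm (conv ?a g y) = norm (g y - conv ?a w y)" by (metis norm_mult)
  also have "\<dots> \<le> norm (g y) + norm (conv ?a w y)" by (rule norm_triangle_ineq4)
  also have "\<dots> \<le> P * V + (P * V + P * V)"
  proof (rule add_mono[OF gb])
    have "norm (conv ?a w y) \<le> (LINT y|lborel. norm (w y))" by (rule norm_conv_le[OF wi])
    also have "\<dots> \<le> (LINT y|lborel. norm (fcoef h n y * v y) + norm (v' y * p y))"
      using hv(1) v'p(1) wi
      by (intro integral_mono integrable_norm Bochner_Integration.integrable_add) (auto simp: w_def norm_triangle_ineq)
    also have "\<dots> = (LINT y|lborel. norm (fcoef h n y * v y)) + (LINT y|lborel. norm (v' y * p y))"
      using hv(1) v'p(1) by (intro Bochner_Integration.integral_add integrable_norm)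
    also have "\<dots> \<le> P * V + P * V" using hv(2) v'p(2) by (rule add_mono)
    finally show "norm (conv ?a w y) \<le> P * V + P * V" .
  qed
  also have "\<dots> = 3 * (d * c / (2 * l\<^sup>2))" by (simp add: P_def V_def power2_eq_square)
  finally show ?thesis by (simp add: g_def p_def v_def)
qed

lemma fcoef_sum:
  assumes "finite F" "\<And>i. i \<in> F \<Longrightarrow> tame (c i) (w i)"
  shows "fcoef (\<lambda>x y. \<Sum>i\<in>F. w i x y) m y = (\<Sum>i\<in>F. fcoef (w i) m y)"
proof -
  have "(LINT x:{-l..l}|lborel. (\<Sum>i\<in>F. w i x y * emode (- m) x)) = (\<Sum>i\<in>F. (LINT x:{-l..l}|lborel. w i x y * emode (- m) x))"
    by (rule set_integral_sum_finite(2)[OF assms(1) tame_slice(2)[OF assms(2)]])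
  then show ?thesis by (simp add: fcoef_def sum_distrib_right sum_distrib_left)
qed

text \<open>The square of the finite-rank part as a sum over transitions from n to m, each with
  coefficient \<open>fcoef u (m - n)\<close>: zero mass treats m = n,
  \<open>mode_coupling_bound\<close> the rest.\<close>

lemma green_op_squared_finite:
  assumes z: "z \<in> C_omega l" and F: "finite F" "F \<subseteq> - {0}" and u: "ctame c u" and h: "ctame d h"
  shows "green_op z F (\<lambda>x y. u x y * green_op z F h x y) x y =
    (\<Sum>m\<in>F. \<Sum>n\<in>F. emode m x * conv (bsym z m) (\<lambda>y. conv (bsym z n) (fcoef h n) y * fcoef u (m - n) y) y)"
proof -
  have t: "tame (c * (green_bound * d)) (\<lambda>x y. u x y * (emode n x * conv (bsym z n) (fcoef h n) y))" if "n \<in> F" for n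
  proof -
    have "bounded_by (green_bound * d) (green_op z {n} h)" using that F(2) by (intro green_op_bounded_by[OF z _ ctame_tame[OF h]]) auto
    from ctame_tame[OF ctame_mult[OF u this]] show ?thesis unfolding green_op_single .
  qed
  have shift: "fcoef (\<lambda>x y. u x y * (emode n x * conv (bsym z n) (fcoef h n) y)) m
      = (\<lambda>y. conv (bsym z n) (fcoef h n) y * fcoef u (m - n) y)" for m n
    by (intro ext fcoef_mode_mult)
  have "fcoef (\<lambda>x y. u x y * green_op z F h x y) m = (\<lambda>y. \<Sum>n\<in>F. conv (bsym z n) (fcoef h n) y * fcoef u (m - n) y)" for m
  proof
    fix y
    have "fcoef (\<lambda>x y. u x y * green_op z F h x y) m y = fcoef (\<lambda>x y. \<Sum>n\<in>F. u x y * (emode n x * conv (bsym z n) (fcoef h n) y)) m y"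
      by (simp add: green_op_finite[OF F(1)] sum_distrib_left)
    also have "\<dots> = (\<Sum>n\<in>F. conv (bsym z n) (fcoef h n) y * fcoef u (m - n) y)"
      by (simp add: fcoef_sum[OF F(1) t] shift)
    finally show "fcoef (\<lambda>x y. u x y * green_op z F h x y) m y = (\<Sum>n\<in>F. conv (bsym z n) (fcoef h n) y * fcoef u (m - n) y)" .
  qed
  moreover have "conv (bsym z m) (\<lambda>y. \<Sum>n\<in>F. conv (bsym z n) (fcoef h n) y * fcoef u (m - n) y) y
      = (\<Sum>n\<in>F. conv (bsym z m) (\<lambda>y. conv (bsym z n) (fcoef h n) y * fcoef u (m - n) y) y)" for m
    by (rule conv_sum[OF F(1)]) (use fcoef_integrable(1)[OF t, of _ m] in \<open>simp add: shift\<close>)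
  ultimately show ?thesis by (simp add: green_op_finite[OF F(1)] sum_distrib_left)
qed

text \<open>The linear arithmetic of \<open>bsym_separated\<close>, with s = Re z and w = omega. The
  first two estimate the two factors of \<open>bsym_diff\<close> for a resonant p against a small t,
  the third the sum factor for two small indices.\<close>

lemma abs_separation:
  fixes p s t w n q :: real
  shows "\<bar>p + 2 * s\<bar> \<le> w / 2 \<Longrightarrow> w \<le> \<bar>t\<bar> \<Longrightarrow> w / 2 \<le> \<bar>2 * s + (p + t)\<bar>"
    and "\<bar>p + 2 * s\<bar> \<le> w / 2 \<Longrightarrow> \<bar>t\<bar> \<le> n \<Longrightarrow> q + n + w \<le> \<bar>s\<bar> \<Longrightarrow> 2 * q \<le> \<bar>p - t\<bar>"
    and "\<bar>p\<bar> \<le> n \<Longrightarrow> \<bar>t\<bar> \<le> n \<Longrightarrow> q + n + w \<le> \<bar>s\<bar> \<Longrightarrow> 0 \<le> q \<Longrightarrow> 0 \<le> w \<Longrightarrow> q \<le> \<bar>2 * s + (p + t)\<bar>"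
  by linarith+

text \<open>For large \<open>z\<close> any two of the modes that are small or resonant are far apart: either \<open>Im z\<close> is large,
  or the resonant index is.\<close>

lemma bsym_separated:
  assumes R: "0 < R" and z: "R / omega l + omega l * real N + omega l + R / (2 * omega l) \<le> norm z"
    and m: "m \<noteq> 0" "\<bar>m\<bar> < int N \<or> m \<in> resonant z" and n: "n \<noteq> 0" "\<bar>n\<bar> < int N \<or> n \<in> resonant z" and "m \<noteq> n"
  shows "R \<le> norm (bsym z m - bsym z n)"
proof -
  let ?o = "omega l"
  have o: "0 < ?o" by (rule omega_pos)
  have nrm: "norm (bsym z m - bsym z n) = ?o * \<bar>of_int (m - n)\<bar> * norm (2 * z + of_real (?o * of_int (m + n)))"
    unfolding bsym_diff norm_mult norm_of_real using o by (simp add: abs_mult)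
  have mn: "1 \<le> \<bar>real_of_int (m - n)\<bar>" using \<open>m \<noteq> n\<close> by linarith
  show ?thesis
  \<comment> \<open>If |Im z| is large, the factor containing 2 z is large in every case; otherwise
    |Re z| must be large.\<close>
  proof (cases "R / (2 * ?o) \<le> \<bar>Im z\<bar>")
    case True
    have "2 * \<bar>Im z\<bar> \<le> norm (2 * z + of_real (?o * of_int (m + n)))"
      using abs_Im_le_cmod[of "2 * z + of_real (?o * of_int (m + n))"] by simp
    then have "R / ?o \<le> norm (2 * z + of_real (?o * of_int (m + n)))"
      using True by simp
    then have "?o * 1 * (R / ?o) \<le> ?o * \<bar>of_int (m - n)\<bar> * norm (2 * z + of_real (?o * of_int (m + n)))"
      using mn o R by (intro mult_mono) auto
    then show ?thesis using o by (simp add: nrm)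
  next
    case False
    have "norm z \<le> \<bar>Re z\<bar> + \<bar>Im z\<bar>" by (rule cmod_le)
    then have r: "R / ?o + ?o * real N + ?o \<le> \<bar>Re z\<bar>" using z False by linarith
    have Re_le: "\<bar>2 * Re z + ?o * of_int (m + n)\<bar> \<le> norm (2 * z + of_real (?o * of_int (m + n)))"
      using abs_Re_le_cmod[of "2 * z + of_real (?o * of_int (m + n))"] by simp
    \<comment> \<open>A resonant i against a small nonzero j. The sum factor may be as small as
      omega / 2, kept from 0 by j being nonzero; the growth comes from the difference, since i lies
      near - 2 Re z / omega.\<close>
    have far: "R \<le> ?o * \<bar>of_int (i - j)\<bar> * \<bar>2 * Re z + ?o * of_int (i + j)\<bar>"
      if i: "i \<in> resonant z" and j: "j \<noteq> 0" "\<bar>j\<bar> < int N" for i j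
    proof -
      have "\<bar>of_int i + 2 * Re z / ?o\<bar> < 1 / 2" using i by (simp add: resonant_def)
      then have "\<bar>?o * (of_int i + 2 * Re z / ?o)\<bar> \<le> ?o * (1 / 2)"
        unfolding abs_mult using o by (intro mult_mono) auto
      then have i1: "\<bar>?o * of_int i + 2 * Re z\<bar> \<le> ?o / 2" using o by (simp add: distrib_left)
      have j1: "?o * 1 \<le> \<bar>?o * of_int j\<bar>" "\<bar>?o * of_int j\<bar> \<le> ?o * real N"
        unfolding abs_mult using o j by (auto intro!: mult_left_mono)
      have A: "?o / 2 \<le> \<bar>2 * Re z + ?o * of_int (i + j)\<bar>"
        using abs_separation(1)[OF i1 j1(1)[unfolded mult_1_right]] by (simp only: distrib_left of_int_add)
      have B: "2 * R / ?o \<le> ?o * \<bar>of_int (i - j)\<bar>"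
      proof -
        have "?o * of_int (i - j) = ?o * of_int i - ?o * of_int j"
          by (simp only: of_int_diff right_diff_distrib)
        then have "?o * \<bar>of_int (i - j)\<bar> = \<bar>?o * of_int i - ?o * of_int j\<bar>"
          using abs_mult_pos'[of ?o "of_int (i - j)"] o by (metis less_imp_le)
        then show ?thesis using abs_separation(2)[OF i1 j1(2) r] by simp
      qed
      have "2 * R / ?o * (?o / 2) \<le> ?o * \<bar>of_int (i - j)\<bar> * \<bar>2 * Re z + ?o * of_int (i + j)\<bar>"
        using A B R o by (intro mult_mono) auto
      then show ?thesis using o by simp
    qed
    have "R \<le> ?o * \<bar>of_int (m - n)\<bar> * \<bar>2 * Re z + ?o * of_int (m + n)\<bar>"
    proof (cases "\<bar>m\<bar> < int N")
      case mN: True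
      show ?thesis
      proof (cases "\<bar>n\<bar> < int N")
        case True
        have "\<bar>?o * of_int m\<bar> \<le> ?o * real N" "\<bar>?o * of_int n\<bar> \<le> ?o * real N"
          unfolding abs_mult using o mN True by (auto intro!: mult_left_mono)
        then have "R / ?o \<le> \<bar>2 * Re z + ?o * of_int (m + n)\<bar>"
          using abs_separation(3)[OF _ _ r] R o by (simp add: distrib_left del: abs_mult)
        then have "?o * 1 * (R / ?o) \<le> ?o * \<bar>of_int (m - n)\<bar> * \<bar>2 * Re z + ?o * of_int (m + n)\<bar>"
          using mn o R by (intro mult_mono) auto
        then show ?thesis using o by simp
      next
        case False
        then show ?thesis using far[of n m] n m mN by (simp add: abs_minus_commute add.commute)
      qed
    next
      case False
      then have mr: "m \<in> resonant z" using m by simp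
      then have "n \<notin> resonant z" using resonant_subset_singleton[of z] \<open>m \<noteq> n\<close> by auto
      then show ?thesis using far[OF mr] n by simp
    qed
    also have "\<dots> \<le> norm (bsym z m - bsym z n)"
      unfolding nrm using Re_le o by (intro mult_left_mono) auto
    finally show ?thesis .
  qed
qed

text \<open>The equation is inserted once into its own finite-rank term, leaving a multiple of the
  source, the small square, and a product with the contractive part. The small terms add up to Y /
  2, and \<open>sup_halving\<close> concludes.\<close>

lemma apriori_large_z:
  assumes u: "tame_upto 1 c u" and zero: "\<And>y. fcoef u 0 y = 0"
  obtains Z K where "0 < K"
    "\<And>z f g X B x y. z \<in> C_omega l \<Longrightarrow> Z \<le> norm z \<Longrightarrow> bounded_by X f \<Longrightarrow> bounded_by B g \<Longrightarrow>
       (\<And>x y. f x y = g x y + green_op z (- {0}) (u \<odot> f) x y) \<Longrightarrow> norm (f x y) \<le> K * B"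
proof -
  obtain u' where u': "has_pd False u u'" "ctame c u'" and uc: "ctame c u" using u by auto
  have c: "0 < c" using ctame_pos[OF uc] .
  define c0 where "c0 = green_bound * c"
  have c0: "0 < c0" using green_bound c by (simp add: c0_def)
  \<comment> \<open>The contractive part enters directly and once more through the finite-rank part,
    whose norm is at most c0. The factor 1 + c0 makes these contributions at most Y / 4
    together.\<close>
  define q where "q = 1 / (4 * (1 + c0) * c)"
  have q: "0 < q" using c c0 by (simp add: q_def)
  obtain N where N: "0 < N"
    "\<And>z A c w x y. z \<in> C_omega l \<Longrightarrow> (\<And>m. m \<in> A \<Longrightarrow> int N \<le> \<bar>m\<bar> \<and> m \<notin> resonant z) \<Longrightarrow> tame c w \<Longrightarrow> norm (green_op z A w x y) \<le> q * c"
    using high_modes_small[OF q] by metis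
  \<comment> \<open>Bounds the number of kept modes: 2 N + 1 integers between - N and N, and at most
    one resonant index.\<close>
  define k where "k = real (2 * N + 2)"
  have k: "0 < k" by (simp add: k_def)
  \<comment> \<open>Chosen so that k^2 transitions, each at most 3 c^2 Y / (2 l^2 R), add up to Y /
    4.\<close>
  define R where "R = 6 * k\<^sup>2 * c\<^sup>2 / l\<^sup>2"
  have R: "0 < R" using k c l_pos by (simp add: R_def)
  define Z where "Z = R / omega l + omega l * real N + omega l + R / (2 * omega l)"
  show ?thesis
  proof
    show "0 < 2 * (1 + c0)" using c0 by simp
    fix z f g X B x y
    assume z: "z \<in> C_omega l" "Z \<le> norm z" and f: "bounded_by X f" and g: "bounded_by B g"
      and eq: "\<And>x y. f x y = g x y + green_op z (- {0}) (u \<odot> f) x y"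
    define F where "F = {m. m \<noteq> 0 \<and> \<bar>m\<bar> < int N} \<union> resonant z"
    define H where "H = - {0} - F"
    have F0: "F \<subseteq> - {0}" by (auto simp: F_def resonant_def)
    have FH: "F \<union> H = - {0}" "F \<inter> H = {}" "H \<subseteq> - {0}" using F0 by (auto simp: H_def)
    have Fsub: "F \<subseteq> {- int N..int N} \<union> resonant z" by (auto simp: F_def)
    then have F: "finite F" by (rule finite_subset) simp
    have "card F \<le> card ({- int N..int N} \<union> resonant z)" by (rule card_mono) (use Fsub in auto)
    also have "\<dots> \<le> card {- int N..int N} + card (resonant z)" by (rule card_Un_le)
    also have "\<dots> \<le> (2 * N + 1) + 1" using card_resonant_le[of z] by (intro add_mono) auto
    finally have cardF: "real (card F) \<le> k" by (simp add: k_def)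
    have Tc: "norm (green_op z F (u \<odot> h) x y) \<le> c0 * Y" if "bounded_by Y h" for h Y x y
      using green_op_norm_le_green_bound[OF z(1) F0 ctame_tame[OF ctame_mult[OF uc that]], of x y] by (simp add: c0_def mult.assoc)
    have Sc: "norm (green_op z H (u \<odot> h) x y) \<le> Y / (4 * (1 + c0))" if "bounded_by Y h" for h Y x y
    proof -
      have "norm (green_op z H (u \<odot> h) x y) \<le> q * (c * Y)"
        by (rule N(2)[OF z(1) _ ctame_tame[OF ctame_mult[OF uc that]]]) (auto simp: H_def F_def)
      also have "\<dots> = Y / (4 * (1 + c0))" using c by (simp add: q_def)
      finally show ?thesis .
    qed
    have QQ: "norm (green_op z F (\<lambda>x y. u x y * green_op z F (u \<odot> h) x y) x y) \<le> Y / 4" if h: "bounded_by Y h" for h Y x y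
    proof -
      have Y: "0 < Y" by (rule bounded_by_pos[OF h])
      note uh = ctame_mult[OF uc h]
      let ?t = "\<lambda>m n. emode m x * conv (bsym z m) (\<lambda>y. conv (bsym z n) (fcoef (u \<odot> h) n) y * fcoef u (m - n) y) y"
      have t: "norm (?t m n) \<le> 3 * (c * Y * c / (2 * l\<^sup>2)) / R" if mn: "m \<in> F" "n \<in> F" for m n
      proof (cases "m = n")
        case True
        \<comment> \<open>The zero mass assumption enters here: the coupling of a mode with itself
          is \<open>fcoef u 0\<close>.\<close>
        then show ?thesis using zero c Y R by (simp add: norm_mult)
      next
        case False
        have "R \<le> norm (bsym z m - bsym z n)"
          by (rule bsym_separated[OF R z(2)[unfolded Z_def]]) (use mn False in \<open>auto simp: F_def resonant_def\<close>)
        then have "R * norm (?t m n) \<le> norm (bsym z m - bsym z n) * norm (?t m n)" by (intro mult_right_mono) auto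
        also have "\<dots> \<le> 3 * (c * Y * c / (2 * l\<^sup>2))"
          using mode_coupling_bound[OF z(1) _ _ uc u'(2,1) uh, of m n "m - n" y] mn F0 by (auto simp: norm_mult)
        finally show ?thesis unfolding pos_le_divide_eq[OF R] mult.commute[of _ R] .
      qed
      have "norm (green_op z F (\<lambda>x y. u x y * green_op z F (u \<odot> h) x y) x y) \<le> (\<Sum>m\<in>F. \<Sum>n\<in>F. 3 * (c * Y * c / (2 * l\<^sup>2)) / R)"
        unfolding green_op_squared_finite[OF z(1) F F0 uc uh] by (intro sum_norm_le t)
      also have "\<dots> = real (card F) * real (card F) * (3 * (c * Y * c / (2 * l\<^sup>2)) / R)" by simp
      also have "\<dots> \<le> k * k * (3 * (c * Y * c / (2 * l\<^sup>2)) / R)"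
        using cardF k c Y R by (intro mult_right_mono mult_mono) auto
      also have "\<dots> = Y / 4"
        using k c l_pos by (simp add: R_def power2_eq_square)
      finally show ?thesis .
    qed
    have decomp: "f x y = g x y + green_op z F (u \<odot> f) x y + green_op z H (u \<odot> f) x y" for x y
    proof -
      have h1: "f x y = g x y + green_op z (F \<union> H) (u \<odot> f) x y" unfolding FH(1) by (rule eq)
      have h2: "green_op z (F \<union> H) (u \<odot> f) x y = green_op z F (u \<odot> f) x y + green_op z H (u \<odot> f) x y"
        by (rule green_op_Un[OF z(1) F0 FH(3,2) ctame_tame[OF ctame_mult[OF uc f]]])
      from h1 show ?thesis unfolding h2 add.assoc .
    qed
    have "norm (f x y) \<le> 2 * ((1 + c0) * B)"
    proof (rule sup_halving[OF bounded_by_norm[OF f] bounded_by_pos[OF f]])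
      show "0 < (1 + c0) * B" using c0 bounded_by_pos[OF g] by simp
      fix Y x y assume Y: "0 < Y" "\<And>x y. norm (f x y) \<le> Y"
      then have fY: "bounded_by Y f" using bounded_by_tighten[OF f] by blast
      let ?uf = "\<lambda>x y. u x y * f x y"
      note uf = ctame_tame[OF ctame_mult[OF uc fY]]
      have bF: "bounded_by (green_bound * (c * Y)) (green_op z F ?uf)" by (rule green_op_bounded_by[OF z(1) F0 uf])
      have bH: "bounded_by (Y / (4 * (1 + c0))) (green_op z H ?uf)"
        by (rule bounded_by_tighten[OF green_op_bounded_by[OF z(1) FH(3) uf]]) (use Sc[OF fY] Y c0 in auto)
      have "?uf = (\<lambda>x y. (u x y * g x y + u x y * green_op z F ?uf x y) + u x y * green_op z H ?uf x y)"
      proof (intro ext)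
        fix x y
        show "u x y * f x y = (u x y * g x y + u x y * green_op z F ?uf x y) + u x y * green_op z H ?uf x y"
          by (subst decomp) (simp only: distrib_left)
      qed
      then have "green_op z F ?uf x y = green_op z F (\<lambda>x y. (u x y * g x y + u x y * green_op z F ?uf x y) + u x y * green_op z H ?uf x y) x y"
        by (rule arg_cong[where f="\<lambda>w. green_op z F w x y"])
      also have "\<dots> = green_op z F (\<lambda>x y. u x y * g x y + u x y * green_op z F ?uf x y) x y + green_op z F (\<lambda>x y. u x y * green_op z H ?uf x y) x y"
        by (rule green_op_add[OF z(1) F0 ctame_tame[OF ctame_add[OF ctame_mult[OF uc g] ctame_mult[OF uc bF]]] ctame_tame[OF ctame_mult[OF uc bH]]])
      also have "green_op z F (\<lambda>x y. u x y * g x y + u x y * green_op z F ?uf x y) x y = green_op z F (u \<odot> g) x y + green_op z F (\<lambda>x y. u x y * green_op z F ?uf x y) x y"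
        by (rule green_op_add[OF z(1) F0 ctame_tame[OF ctame_mult[OF uc g]] ctame_tame[OF ctame_mult[OF uc bF]]])
      also have "norm (green_op z F (u \<odot> g) x y + green_op z F (\<lambda>x y. u x y * green_op z F ?uf x y) x y + green_op z F (\<lambda>x y. u x y * green_op z H ?uf x y) x y)
          \<le> c0 * B + Y / 4 + c0 * (Y / (4 * (1 + c0)))"
        by (intro norm_triangle_le add_mono Tc[OF g] QQ[OF fY] Tc[OF bH])
      finally have TF: "norm (green_op z F ?uf x y) \<le> c0 * B + Y / 4 + c0 * (Y / (4 * (1 + c0)))" .
      have "norm (f x y) \<le> B + (c0 * B + Y / 4 + c0 * (Y / (4 * (1 + c0)))) + Y / (4 * (1 + c0))"
        unfolding decomp[of x y] by (intro norm_triangle_le add_mono TF Sc[OF fY] bounded_by_norm[OF g])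
      also have "\<dots> = (1 + c0) * B + Y / 4 + (1 + c0) * (Y / (4 * (1 + c0)))" by (simp only: distrib_right mult_1_left)
      also have "(1 + c0) * (Y / (4 * (1 + c0))) = Y / 4"
      proof -
        have "1 + c0 \<noteq> 0" using c0 by simp
        then show ?thesis by (simp del: distrib_left_numeral)
      qed
      finally show "norm (f x y) \<le> (1 + c0) * B + Y / 2" by simp
    qed
    then show "norm (f x y) \<le> 2 * (1 + c0) * B" by (simp only: mult.assoc)
  qed
qed

lemma regularity_uniform:
  assumes zero: "\<And>y. fcoef u 0 y = 0"
    and \<mu>: "\<And>z. z \<in> C_omega l \<Longrightarrow> bounded_by X (\<mu> z)"
    and eq: "\<And>z x y. z \<in> C_omega l \<Longrightarrow> \<mu> z x y = 1 + green_op z (- {0}) (u \<odot> (\<mu> z)) x y"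
    and u: "tame_upto k cu u"
  obtains C where "\<And>z. z \<in> C_omega l \<Longrightarrow> bounded_upto k C (\<mu> z)"
\<comment> \<open>At order 0 the assumed bound X suffices; the estimate for large z relies on a
  derivative of u.\<close>
proof (cases "k = 0")
  case True
  then show ?thesis using \<mu> that by auto
next
  case False
  then have u1: "tame_upto 1 cu u" using tame_upto_antimono[OF u, of 1] by simp
  obtain Z K where K: "0 < K"
    and apriori: "\<And>z f g X B x y. z \<in> C_omega l \<Longrightarrow> Z \<le> norm z \<Longrightarrow> bounded_by X f \<Longrightarrow> bounded_by B g \<Longrightarrow>
       (\<And>x y. f x y = g x y + green_op z (- {0}) (u \<odot> f) x y) \<Longrightarrow> norm (f x y) \<le> K * B"
    by (rule apriori_large_z[OF u1 zero]) blast
  define \<F> where "\<F> = {(z, A). z \<in> C_omega l \<and> Z \<le> norm z \<and> A = - {0 :: int}}"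
  have "\<exists>C. \<forall>z A f g X. (z, A) \<in> \<F> \<longrightarrow> bounded_by X f \<longrightarrow> bounded_upto k 1 g \<longrightarrow>
       (\<forall>x y. f x y = g x y + green_op z A (u \<odot> f) x y) \<longrightarrow> bounded_upto k C f"
  proof (rule regularity[OF _ _ K u])
    show "z \<in> C_omega l \<and> A \<subseteq> - {0}" if "(z, A) \<in> \<F>" for z A using that by (auto simp: \<F>_def)
    show "norm (f x y) \<le> K * B"
      if "(z, A) \<in> \<F>" "bounded_by X f" "bounded_by B g" "\<And>x y. f x y = g x y + green_op z A (u \<odot> f) x y" for z A f g X B x y
    proof -
      have z: "z \<in> C_omega l" "Z \<le> norm z" "A = - {0}" using that(1) by (auto simp: \<F>_def)
      show ?thesis by (rule apriori[OF z(1,2) that(2,3) that(4)[unfolded z(3)]])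
    qed
  qed
  then obtain C1 where "\<forall>z A f g X. (z, A) \<in> \<F> \<longrightarrow> bounded_by X f \<longrightarrow> bounded_upto k 1 g \<longrightarrow>
       (\<forall>x y. f x y = g x y + green_op z A (u \<odot> f) x y) \<longrightarrow> bounded_upto k C1 f" ..
  note C1 = this[rule_format]
  obtain C2 where C2: "\<And>z. z \<in> C_omega l \<Longrightarrow> norm z \<le> Z \<Longrightarrow> bounded_upto k C2 (\<mu> z)"
    using regularity_bounded_z[where Z=Z, OF \<mu> eq u] by blast
  have "bounded_upto k (max C1 C2) (\<mu> z)" if z: "z \<in> C_omega l" for z
  proof (cases "norm z \<le> Z")
    case True
    then show ?thesis using C2[OF z] bounded_upto_mono max.cobounded2 by blast
  next
    case False
    have "bounded_upto k C1 (\<mu> z)"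
    proof (rule C1[OF _ \<mu>[OF z] bounded_upto_const eq[OF z]])
      show "(z, - {0}) \<in> \<F>" using False z by (simp add: \<F>_def)
    qed simp_all
    then show ?thesis using bounded_upto_mono max.cobounded1 by blast
  qed
  then show ?thesis by (rule that)
qed

end

subsection \<open>The Jost function\<close>

lemma smooth_to_order_continuous: "smooth_to_order k f \<Longrightarrow> continuous2 f"
  by (cases k) auto

lemma smooth_has_pd:
  assumes "smooth_to_order (Suc k) f"
  shows "has_pd True f (partial_x f)" "has_pd False f (partial_y f)"
  using assms by (auto simp: has_pd_def partial_x_def partial_y_def vector_derivative_works[symmetric])

lemma has_pd_imp_partial:
  shows "has_pd True f f' \<Longrightarrow> partial_x f = f'" and "has_pd False f f' \<Longrightarrow> partial_y f = f'"
  by (auto simp: has_pd_def partial_x_def partial_y_def vector_derivative_at intro!: ext)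

text \<open>Write f as the integral of fy, differentiate in x under the integral sign, then in y.
  \<open>partial_deriv\<close> fixes one order of differentiation while the classes of order k use
  all of them, so the orders have to be reconciled.\<close>

lemma mixed_partials_commute:
  assumes f: "has_pd True f fx" "has_pd False f fy" and fyx: "has_pd True fy fyx" and fxy: "has_pd False fx fxy"
    and c: "continuous2 fy" "continuous2 fyx"
  shows "fxy = fyx"
proof (intro ext)
  fix x y :: real
  \<comment> \<open>As in \<open>conv_has_vector_derivative\<close>, this makes y an interior point
    of the interval on which the formula holds.\<close>
  define a where "a = y - 1"
  have cy: "continuous_on S (fy x)" "continuous_on S (fyx x)" for S x
  proof -
    have p: "continuous_on S (\<lambda>s. (x, s))" by (intro continuous_intros)
    show "continuous_on S (fy x)" "continuous_on S (fyx x)"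
      using continuous_on_compose2[OF c(1) p] continuous_on_compose2[OF c(2) p] by simp_all
  qed
  have int: "f x v = f x a + integral {a..v} (fy x)" if "a \<le> v" for x v
  proof -
    have "(fy x has_integral f x v - f x a) {a..v}"
      by (rule fundamental_theorem_of_calculus[OF that])
        (use f(2) in \<open>auto simp: has_pd_False intro: has_vector_derivative_at_within\<close>)
    then show ?thesis by (simp add: integral_unique)
  qed
  have fx: "fx x v = fx x a + integral {a..v} (fyx x)" if v: "a \<le> v" for v
  proof -
    have "((\<lambda>x. integral (cbox a v) (fy x)) has_vector_derivative integral (cbox a v) (fyx x)) (at x within UNIV)"
    proof (rule leibniz_rule_vector_derivative)
      show "((\<lambda>x. fy x s) has_vector_derivative fyx x s) (at x within UNIV)" for x s
        using fyx by (simp add: has_pd_True)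
      show "fy x integrable_on cbox a v" for x
        by (rule integrable_continuous) (rule cy)
      show "continuous_on (UNIV \<times> cbox a v) (\<lambda>(x, s). fyx x s)"
        using c(2) by (rule continuous_on_subset) simp
    qed auto
    then have "((\<lambda>x. f x a + integral {a..v} (fy x)) has_vector_derivative fx x a + integral {a..v} (fyx x)) (at x)"
      using f(1) by (intro has_vector_derivative_add) (auto simp: has_pd_True)
    then have "((\<lambda>x. f x v) has_vector_derivative fx x a + integral {a..v} (fyx x)) (at x)"
      using int[OF v] by simp
    moreover have "((\<lambda>x. f x v) has_vector_derivative fx x v) (at x)"
      using f(1) by (simp add: has_pd_True)
    ultimately show ?thesis by (rule vector_derivative_unique_at[symmetric])
  qed
  have "((\<lambda>v. integral {a..v} (fyx x)) has_vector_derivative fyx x y) (at y within {a..y+1})"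
    by (rule integral_has_vector_derivative[OF cy(2)]) (simp add: a_def)
  from has_vector_derivative_add[OF has_vector_derivative_const this, of "fx x a"]
  have "((\<lambda>v. fx x a + integral {a..v} (fyx x)) has_vector_derivative fyx x y) (at y within {a..y+1})" by simp
  then have "((\<lambda>v. fx x v) has_vector_derivative fyx x y) (at y within {a..y+1})"
    by (rule has_vector_derivative_transform_within[OF _ zero_less_one _ fx[symmetric]]) (simp_all add: a_def)
  moreover have "at y within {a..y+1} = at y" by (rule at_within_interior) (simp add: a_def)
  ultimately have "((\<lambda>v. fx x v) has_vector_derivative fyx x y) (at y)" by simp
  moreover have "((\<lambda>v. fx x v) has_vector_derivative fxy x y) (at y)"
    using fxy by (simp add: has_pd_False)
  ultimately show "fxy x y = fyx x y" by (rule vector_derivative_unique_at[symmetric])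
qed

lemma partial_y_partial_x:
  assumes "smooth_to_order (Suc (Suc k)) f"
  shows "partial_y (partial_x f) = partial_x (partial_y f)"
proof -
  have s: "smooth_to_order (Suc k) (partial_x f)" "smooth_to_order (Suc k) (partial_y f)"
    using assms by auto
  then have "smooth_to_order k (partial_x (partial_y f))" by auto
  then show ?thesis
    using mixed_partials_commute[OF smooth_has_pd[OF assms] smooth_has_pd(1)[OF s(2)] smooth_has_pd(2)[OF s(1)]]
      smooth_to_order_continuous s(2) by blast
qed

lemma funpow_partial_y_partial_x:
  "smooth_to_order (Suc k) f \<Longrightarrow> j \<le> k \<Longrightarrow> (partial_y ^^ j) (partial_x f) = partial_x ((partial_y ^^ j) f)"
proof (induction j arbitrary: f k)
  case (Suc j)
  then obtain k' where k: "k = Suc k'" by (cases k) auto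
  have "(partial_y ^^ Suc j) (partial_x f) = (partial_y ^^ j) (partial_y (partial_x f))"
    by (simp add: funpow_Suc_right del: funpow.simps)
  also have "\<dots> = (partial_y ^^ j) (partial_x (partial_y f))"
    using partial_y_partial_x[of k' f] Suc.prems(1) unfolding k by simp
  also have "\<dots> = partial_x ((partial_y ^^ j) (partial_y f))"
    by (rule Suc.IH[of k']) (use Suc.prems in \<open>auto simp: k\<close>)
  also have "\<dots> = partial_x ((partial_y ^^ Suc j) f)"
    by (simp add: funpow_Suc_right del: funpow.simps)
  finally show ?case .
qed simp

lemma partial_deriv_partial_x:
  assumes "smooth_to_order (Suc k) f" "b \<le> k"
  shows "partial_deriv (a, b) (partial_x f) = partial_deriv (Suc a, b) f"
  unfolding partial_deriv_def fst_conv snd_conv funpow_partial_y_partial_x[OF assms]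
  by (simp add: funpow_Suc_right del: funpow.simps)

lemma partial_deriv_partial_y: "partial_deriv (a, b) (partial_y f) = partial_deriv (a, Suc b) f"
  by (simp add: partial_deriv_def funpow_Suc_right del: funpow.simps)

lemma x_periodic_of_int:
  assumes "x_periodic l f"
  shows "f (x + 2 * l * of_int k) y = f x y"
proof (induction k arbitrary: x rule: int_induct[where k=0])
  case (step1 i)
  have "f (x + 2 * l * of_int (i + 1)) y = f ((x + 2 * l * of_int i) + 2 * l) y" by (simp add: algebra_simps)
  then show ?case using assms step1(2) by (simp add: x_periodic_def)
next
  case (step2 i)
  have "f (x + 2 * l * of_int (i - 1)) y = f ((x + 2 * l * of_int (i - 1)) + 2 * l) y"
    using assms by (simp add: x_periodic_def)
  also have "\<dots> = f (x + 2 * l * of_int i) y" by (simp add: algebra_simps)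
  finally show ?case using step2(2) by simp
qed simp

section \<open>From the hypotheses on u and the Jost equation to regularity classes and Fourier
  decay\<close>

context strip_setup
begin

text \<open>One representative serves all periodic functions and all y, so both sides of an equation
  can be moved into the strip together.\<close>

lemma periodic_representative:
  obtains x' where "x' \<in> {-l..l}" "\<And>f y. x_periodic l f \<Longrightarrow> f x y = f x' y"
proof
  define k where "k = \<lfloor>(x + l) / (2 * l)\<rfloor>"
  have "of_int k \<le> (x + l) / (2 * l)" "(x + l) / (2 * l) < of_int k + 1" unfolding k_def by linarith+
  then have "2 * l * of_int k \<le> x + l" "x + l < 2 * l * of_int k + 2 * l"
    using l_pos by (auto simp: field_simps)
  then show "x - 2 * l * of_int k \<in> {-l..l}" by auto
  show "f x y = f (x - 2 * l * of_int k) y" if "x_periodic l f" for f y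
    using x_periodic_of_int[OF that, of "x - 2 * l * of_int k" k y] by simp
qed

lemma in_Lp_slice:
  assumes "in_Lp l (real p) f" "0 < p"
  shows "integrable lborel (slice p f)"
proof -
  have "set_integrable lborel (strip l) (\<lambda>(x, y). norm (f x y) powr real p)"
    using assms by (simp add: in_Lp_def)
  then have "integrable (lborel \<Otimes>\<^sub>M lborel) (\<lambda>(x, y). indicator {-l..l} x *\<^sub>R norm (f x y) ^ p)"
  proof -
    \<comment> \<open>At v = 0 the two notions of power agree because p is positive.\<close>
    have "norm v powr real p = norm v ^ p" for v :: complex
      using assms(2) by (cases "v = 0") (auto simp: powr_realpow)
    then have "(\<lambda>q. indicator (strip l) q *\<^sub>R (case q of (x, y) \<Rightarrow> norm (f x y) powr real p))
        = (\<lambda>(x, y). indicator {-l..l} x *\<^sub>R norm (f x y) ^ p)"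
      by (auto simp: fun_eq_iff strip_def indicator_def)
    with \<open>set_integrable lborel (strip l) _\<close> show ?thesis
      by (simp add: set_integrable_def lborel_prod)
  qed
  from lborel_pair.integrable_snd[OF this] show ?thesis
    by (simp add: slice_def[abs_def] set_lebesgue_integral_def)
qed

lemma ctame_of_in_Lp:
  assumes per: "x_periodic l f" and cont: "continuous2 f"
    and L1: "in_Lp l 1 f" and L2: "in_Lp l 2 f"
  shows "\<exists>c. ctame c f"
proof -
  \<comment> \<open>The summand 1 gives c <= c^2, so one constant serves both exponents in
    \<open>tame\<close>.\<close>
  define c where "c = 1 + \<bar>LINT y|lborel. slice 1 f y\<bar> + \<bar>LINT y|lborel. slice 2 f y\<bar>"
  have i: "integrable lborel (slice 1 f)" "integrable lborel (slice 2 f)"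
    using in_Lp_slice[of 1 f] in_Lp_slice[of 2 f] L1 L2 by auto
  have c: "1 \<le> c" "(LINT y|lborel. slice 1 f y) \<le> c" "(LINT y|lborel. slice 2 f y) \<le> c" by (auto simp: c_def)
  have "c \<le> c\<^sup>2" using c(1) by (simp add: power2_eq_square)
  with c have cp: "\<forall>p\<in>{1, 2}. (LINT y|lborel. slice p f y) \<le> c ^ p" by auto
  have bd: "\<exists>B. \<forall>x\<in>{-l..l}. norm (f x y) \<le> B" for y
  proof -
    have "compact ((\<lambda>x. f x y) ` {-l..l})"
      by (intro compact_continuous_image continuous_on_slices[OF cont] continuous_intros) auto
    then have "bounded ((\<lambda>x. f x y) ` {-l..l})" by (rule compact_imp_bounded)
    then obtain B where "\<forall>v\<in>(\<lambda>x. f x y) ` {-l..l}. norm v \<le> B" unfolding bounded_iff ..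
    then show ?thesis by blast
  qed
  have "tame c f"
    unfolding tame_def
  proof (intro conjI allI)
    show "\<forall>p\<in>{1, 2}. integrable lborel (slice p f) \<and> (LINT y|lborel. slice p f y) \<le> c ^ p"
      using i cp by blast
    show "(\<lambda>(x, y). f x y) \<in> borel_measurable borel" using cont by (rule borel_measurable_continuous_onI)
  qed (use c(1) per bd in auto)
  then show ?thesis using cont by (auto simp: ctame_def)
qed

lemma tame_upto_of_smooth:
  assumes "x_periodic l f" "smooth_to_order k f"
    and "\<And>a b. a + b \<le> k \<Longrightarrow> in_Lp l 1 (partial_deriv (a, b) f) \<and> in_Lp l 2 (partial_deriv (a, b) f)"
  shows "\<exists>c. tame_upto k c f"
  using assms
proof (induction k arbitrary: f)
  case 0
  have "partial_deriv (0, 0) f = f" by (simp add: partial_deriv_def)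
  then show ?case using ctame_of_in_Lp 0(1) 0(2) 0(3)[of 0 0] by simp
next
  case (Suc k)
  have "partial_deriv (0, 0) f = f" by (simp add: partial_deriv_def)
  then obtain c0 where c0: "ctame c0 f"
    using ctame_of_in_Lp[OF Suc.prems(1) smooth_to_order_continuous[OF Suc.prems(2)]] Suc.prems(3)[of 0 0] by auto
  note pd = smooth_has_pd[OF Suc.prems(2)]
  obtain c1 where c1: "tame_upto k c1 (partial_x f)"
    using Suc.IH[OF has_pd_periodic[OF Suc.prems(1) pd(1)]] Suc.prems(2,3) partial_deriv_partial_x[OF Suc.prems(2)]
    by fastforce
  obtain c2 where c2: "tame_upto k c2 (partial_y f)"
    using Suc.IH[OF has_pd_periodic[OF Suc.prems(1) pd(2)]] Suc.prems(2,3) partial_deriv_partial_y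
    by fastforce
  define c where "c = max c0 (max c1 c2)"
  have "ctame c f" using c0 by (auto simp: ctame_def c_def intro: tame_mono)
  moreover have "tame_upto k c (partial_x f)" "tame_upto k c (partial_y f)"
    using tame_upto_mono[OF c1, of c] tame_upto_mono[OF c2, of c] by (auto simp: c_def)
  then have "\<exists>g. has_pd d f g \<and> tame_upto k c g" for d using pd by (cases d) auto
  ultimately have "tame_upto (Suc k) c f" by simp
  then show ?case by blast
qed

lemma bounded_upto_smooth: "bounded_upto k c f \<Longrightarrow> smooth_to_order k f"
proof (induction k arbitrary: f)
  case (Suc k)
  obtain fx fy where x: "has_pd True f fx" "bounded_upto k c fx" and y: "has_pd False f fy" "bounded_upto k c fy"
    using Suc.prems by auto meson
  have "smooth_to_order k (partial_x f)" "smooth_to_order k (partial_y f)"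
    using Suc.IH[OF x(2)] Suc.IH[OF y(2)] has_pd_imp_partial(1)[OF x(1)] has_pd_imp_partial(2)[OF y(1)] by auto
  moreover have "continuous2 f" using bounded_upto_bounded_by[OF Suc.prems] by (rule bounded_by_continuous)
  moreover have "(\<lambda>t. f t y) differentiable at x" "(\<lambda>t. f x t) differentiable at y" for x y
    using x(1) y(1) unfolding has_pd_True has_pd_False by (metis differentiableI_vector)+
  ultimately show ?case by simp
qed (simp add: bounded_by_def)

lemma norm_fourier_le:
  assumes "tame c w"
  shows "norm (fourier l w m \<xi>) \<le> c / (2 * l)"
  unfolding fourier_eq_ft using norm_ft_le[OF fcoef_integrable(1)[OF assms]] fcoef_integrable(2)[OF assms] by (rule order_trans)

lemma fourier_pd_x:
  assumes "ctame c w" "ctame c w'" "has_pd True w w'"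
  shows "fourier l w' m \<xi> = \<i> * of_real (omega l * of_int m) * fourier l w m \<xi>"
proof -
  have "fcoef w' m = (\<lambda>y. \<i> * of_real (omega l * of_int m) * fcoef w m y)"
    using assms by (intro ext fcoef_pd_x) (auto simp: ctame_def dest: tameD)
  then show ?thesis by (simp add: fourier_eq_ft ft_def mult.assoc)
qed

lemma fourier_pd_y:
  assumes "ctame c w" "ctame c w'" "has_pd False w w'"
  shows "fourier l w' m \<xi> = \<i> * of_real \<xi> * fourier l w m \<xi>"
  unfolding fourier_eq_ft using assms
  by (intro ft_derivative fcoef_integrable fcoef_pd_y continuous_on_fcoef) (auto simp: ctame_def)

lemma fourier_decay_x:
  "tame_upto k c w \<Longrightarrow> norm (fourier l w m \<xi>) * \<bar>omega l * of_int m\<bar> ^ k \<le> c / (2 * l)"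
proof (induction k arbitrary: w)
  case (Suc k)
  obtain w' where w': "has_pd True w w'" "tame_upto k c w'" using Suc.prems by auto
  have "norm (fourier l w m \<xi>) * \<bar>omega l * of_int m\<bar> ^ Suc k = norm (fourier l w' m \<xi>) * \<bar>omega l * of_int m\<bar> ^ k"
    unfolding fourier_pd_x[OF tame_upto_ctame[OF Suc.prems] tame_upto_ctame[OF w'(2)] w'(1)] norm_mult norm_of_real by simp
  also have "\<dots> \<le> c / (2 * l)" by (rule Suc.IH[OF w'(2)])
  finally show ?case .
qed (auto intro: norm_fourier_le dest: ctame_tame)

lemma fourier_decay_y:
  "tame_upto k c w \<Longrightarrow> norm (fourier l w m \<xi>) * \<bar>\<xi>\<bar> ^ k \<le> c / (2 * l)"
proof (induction k arbitrary: w)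
  case (Suc k)
  obtain w' where w': "has_pd False w w'" "tame_upto k c w'" using Suc.prems by auto
  have "norm (fourier l w m \<xi>) * \<bar>\<xi>\<bar> ^ Suc k = norm (fourier l w' m \<xi>) * \<bar>\<xi>\<bar> ^ k"
    unfolding fourier_pd_y[OF tame_upto_ctame[OF Suc.prems] tame_upto_ctame[OF w'(2)] w'(1)] norm_mult norm_of_real by simp
  also have "\<dots> \<le> c / (2 * l)" by (rule Suc.IH[OF w'(2)])
  finally show ?case .
qed (auto intro: norm_fourier_le dest: ctame_tame)

text \<open>The integrability clause of \<open>jost_function\<close> allows Fourier inversion mode
  by mode, and periodicity extends the equation from the strip to the plane. Continuity of the
  solution is then read off from the right-hand side.\<close>

lemma jost_equation:
  assumes u: "ctame c u" and jost: "jost_function l u \<mu>"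
  obtains X where "\<And>z. z \<in> C_omega l \<Longrightarrow> bounded_by X (\<lambda>x y. \<mu> x y z)"
    "\<And>z x y. z \<in> C_omega l \<Longrightarrow> \<mu> x y z = 1 + green_op z (- {0}) (\<lambda>x y. u x y * \<mu> x y z) x y"
proof -
  obtain B where B: "\<And>x y z. x \<in> {-l..l} \<Longrightarrow> z \<in> C_omega l \<Longrightarrow> norm (\<mu> x y z) \<le> B"
    using jost unfolding jost_function_def bounded_iff strip_def by fastforce
  define X where "X = max B 1"
  have per: "x_periodic l (\<lambda>x y. \<mu> x y z)" and meas: "(\<lambda>(x, y). \<mu> x y z) \<in> borel_measurable borel" if "z \<in> C_omega l" for z
    using jost that by (auto simp: jost_function_def)
  have X: "norm (\<mu> x y z) \<le> X" if z: "z \<in> C_omega l" for x y z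
  proof -
    obtain x' where x': "x' \<in> {-l..l}" "\<And>f y. x_periodic l f \<Longrightarrow> f x y = f x' y"
      using periodic_representative[of x] by metis
    show ?thesis using x'(2)[OF per[OF z], of y] B[OF x'(1) z, of y] by (simp add: X_def)
  qed
  have "0 < X" by (simp add: X_def)
  have t: "tame (X * c) (\<lambda>x y. u x y * \<mu> x y z)" if z: "z \<in> C_omega l" for z
    by (rule tame_mult[OF ctame_tame[OF u] meas[OF z] per[OF z] X[OF z] \<open>0 < X\<close>])
  have strip_eq: "\<mu> x y z = 1 + green_op z (- {0}) (\<lambda>x y. u x y * \<mu> x y z) x y" if z: "z \<in> C_omega l" and x: "x \<in> {-l..l}" for x y z
  proof -
    let ?w = "\<lambda>x y. u x y * \<mu> x y z"
    have int: "(LINT \<xi>|lborel. jost_integrand l u \<mu> z x y m \<xi>) = 2 * of_real pi * (emode m x * conv (bsym z m) (fcoef ?w m) y)"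
      if m: "m \<noteq> 0" for m
    proof -
      let ?h = "\<lambda>\<xi>. ft (fcoef ?w m) \<xi> / (bsym z m + \<i> * of_real \<xi>) * exp (\<i> * of_real (\<xi> * y))"
      have j: "jost_integrand l u \<mu> z x y m \<xi> = emode m x * ?h \<xi>" for \<xi>
        by (simp add: jost_integrand_def fourier_eq_ft P_symbol_def bsym_def emode_def exp_add)
      have "integrable lborel (jost_integrand l u \<mu> z x y m)"
        using jost z x m by (auto simp: jost_function_def strip_def)
      \<comment> \<open>Multiplying by the inverse phase strips off the dependence on x, so that
        \<open>conv_inversion\<close> applies.\<close>
      then have "integrable lborel (\<lambda>\<xi>. emode (- m) x * (emode m x * ?h \<xi>))"
        unfolding j[abs_def] by (rule integrable_mult_right)
      moreover have "emode (- m) x * emode m x = 1" using emode_add[of "-m" m x] by simp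
      ultimately have "integrable lborel ?h" by (simp add: mult.assoc[symmetric])
      from conv_inversion[OF fcoef_integrable(1)[OF t[OF z]] Re_bsym_nonzero[OF z m] this]
      have "(LINT \<xi>|lborel. ?h \<xi>) = 2 * of_real pi * conv (bsym z m) (fcoef ?w m) y" by simp
      then show ?thesis unfolding j integral_mult_right_zero by simp
    qed
    have "\<mu> x y z = 1 + 1 / (2 * of_real pi) * (\<Sum>\<^sub>\<infinity>m\<in>UNIV - {0}. (LINT \<xi>|lborel. jost_integrand l u \<mu> z x y m \<xi>))"
      using jost z x unfolding jost_function_def strip_def by fastforce
    also have "(\<Sum>\<^sub>\<infinity>m\<in>UNIV - {0}. (LINT \<xi>|lborel. jost_integrand l u \<mu> z x y m \<xi>))
        = (\<Sum>\<^sub>\<infinity>m\<in>- {0}. 2 * of_real pi * (emode m x * conv (bsym z m) (fcoef ?w m) y))"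
      by (rule infsum_cong_neutral) (use int in auto)
    also have "\<dots> = 2 * of_real pi * green_op z (- {0}) ?w x y"
      unfolding green_op_def by (rule infsum_cmult_right')
    finally show ?thesis by simp
  qed
  have eq: "\<mu> x y z = 1 + green_op z (- {0}) (\<lambda>x y. u x y * \<mu> x y z) x y" if z: "z \<in> C_omega l" for x y z
  proof -
    obtain x' where x': "x' \<in> {-l..l}" "\<And>f y. x_periodic l f \<Longrightarrow> f x y = f x' y"
      using periodic_representative[of x] by metis
    show ?thesis
      using x'(2)[OF per[OF z], of y] x'(2)[OF green_op_periodic, of z "- {0}" "\<lambda>x y. u x y * \<mu> x y z" y] strip_eq[OF z x'(1), of y]
      by simp
  qed
  have "bounded_by X (\<lambda>x y. \<mu> x y z)" if z: "z \<in> C_omega l" for z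
  proof -
    have "continuous_on UNIV (\<lambda>p. 1 + (\<lambda>(x, y). green_op z (- {0}) (\<lambda>x y. u x y * \<mu> x y z) x y) p)"
      by (intro continuous_intros green_op_continuous[OF z _ t[OF z]]) simp
    also have "(\<lambda>p. 1 + (\<lambda>(x, y). green_op z (- {0}) (\<lambda>x y. u x y * \<mu> x y z) x y) p) = (\<lambda>(x, y). \<mu> x y z)"
      using eq[OF z, symmetric] by (simp add: case_prod_beta')
    finally show ?thesis using \<open>0 < X\<close> per[OF z] X[OF z] by (simp add: bounded_by_def)
  qed
  then show ?thesis using eq by (rule that)
qed

end

theorem lemma2p6:
  fixes l :: real
    and u :: "real \<Rightarrow> real \<Rightarrow> complex"
    and \<mu> :: "real \<Rightarrow> real \<Rightarrow> complex \<Rightarrow> complex"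
    and \<alpha>\<^sub>1 \<alpha>\<^sub>2 :: nat
  assumes "l > 0"
    and "x_periodic l u"
    and zero_mass: "\<And>y. (LINT x:{-l..l}|lborel. u x y) = 0"
    and small: "max (omega l * Lp_norm l 1 u) (sqrt (omega l) * Lp_norm l 2 u) < 2 * pi / C_const l"
    and smooth: "smooth_to_order (\<alpha>\<^sub>1 + \<alpha>\<^sub>2) u"
    and in_L1_L2: "\<And>\<beta>\<^sub>1 \<beta>\<^sub>2. \<beta>\<^sub>1 + \<beta>\<^sub>2 \<le> \<alpha>\<^sub>1 + \<alpha>\<^sub>2 \<Longrightarrow>
           in_Lp l 1 (partial_deriv (\<beta>\<^sub>1, \<beta>\<^sub>2) u) \<and> in_Lp l 2 (partial_deriv (\<beta>\<^sub>1, \<beta>\<^sub>2) u)"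
    and jost: "jost_function l u \<mu>"
  shows "(\<forall>z \<in> C_omega l. smooth_to_order (\<alpha>\<^sub>1 + \<alpha>\<^sub>2) (\<lambda>x y. \<mu> x y z)) \<and>
         (\<exists>M. \<forall>m::int. \<forall>\<xi>::real. \<forall>z \<in> C_omega l.
            norm (fourier l (\<lambda>x y. u x y * \<mu> x y z) m \<xi>)
              \<le> M * (1 / (1 + \<bar>omega l * of_int m\<bar> ^ \<alpha>\<^sub>1 + \<bar>\<xi>\<bar> ^ \<alpha>\<^sub>2)))"
proof -
  interpret strip_setup l by standard fact
  let ?k = "\<alpha>\<^sub>1 + \<alpha>\<^sub>2"
  obtain c where u: "tame_upto ?k c u"
    using tame_upto_of_smooth[OF assms(2) smooth in_L1_L2] by blast
  have zero: "fcoef u 0 y = 0" for y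
    using zero_mass by (simp add: fcoef_def)
  obtain X where X: "\<And>z. z \<in> C_omega l \<Longrightarrow> bounded_by X (\<lambda>x y. \<mu> x y z)"
    and eq: "\<And>z x y. z \<in> C_omega l \<Longrightarrow> \<mu> x y z = 1 + green_op z (- {0}) (\<lambda>x y. u x y * \<mu> x y z) x y"
    by (rule jost_equation[OF tame_upto_ctame[OF u] jost]) blast
  have "\<exists>C. \<forall>z\<in>C_omega l. bounded_upto ?k C (\<lambda>x y. \<mu> x y z)"
    by (rule regularity_uniform[where \<mu>="\<lambda>z x y. \<mu> x y z", OF zero X eq u]) blast+
  then obtain C where C: "\<And>z. z \<in> C_omega l \<Longrightarrow> bounded_upto ?k C (\<lambda>x y. \<mu> x y z)" by blast
  define W where "W = 4 ^ ?k * (c * C)"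
  have "norm (fourier l (\<lambda>x y. u x y * \<mu> x y z) m \<xi>)
      \<le> 3 * W / (2 * l) * (1 / (1 + \<bar>omega l * of_int m\<bar> ^ \<alpha>\<^sub>1 + \<bar>\<xi>\<bar> ^ \<alpha>\<^sub>2))" if z: "z \<in> C_omega l" for m \<xi> z
  proof -
    have w: "tame_upto ?k W (\<lambda>x y. u x y * \<mu> x y z)"
      unfolding W_def by (rule tame_upto_mult[OF u C[OF z]])
    let ?F = "norm (fourier l (\<lambda>x y. u x y * \<mu> x y z) m \<xi>)"
    let ?D = "1 + \<bar>omega l * of_int m\<bar> ^ \<alpha>\<^sub>1 + \<bar>\<xi>\<bar> ^ \<alpha>\<^sub>2"
    \<comment> \<open>Each of the three terms of the denominator costs W / (2 l): the plain bound,
      decay in m from x-derivatives, and decay in \<xi> from y-derivatives.\<close>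
    have "?F * ?D = ?F + ?F * \<bar>omega l * of_int m\<bar> ^ \<alpha>\<^sub>1 + ?F * \<bar>\<xi>\<bar> ^ \<alpha>\<^sub>2" by (simp only: distrib_left mult_1_right)
    also have "\<dots> \<le> W / (2 * l) + W / (2 * l) + W / (2 * l)"
      by (intro add_mono norm_fourier_le ctame_tame[OF tame_upto_ctame[OF w]] fourier_decay_x fourier_decay_y tame_upto_antimono[OF w]) auto
    also have "\<dots> = 3 * W / (2 * l)" by simp
    finally have le: "?F * ?D \<le> 3 * W / (2 * l)" .
    have "0 < ?D" by (simp add: add_pos_nonneg)
    with le have "?F \<le> 3 * W / (2 * l) / ?D" by (simp only: pos_le_divide_eq)
    then show ?thesis by simp
  qed
  then show ?thesis using bounded_upto_smooth[OF C] by blast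
qed

end
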